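(* Let $\mu$ be a box-like self-affine measure which satisfies the rectangular open set condition. Then, for all $\alpha\ge0$, \[ f_{\mathrm H,\mu}(\alpha)\leq f_{\mathrm P,\mu}(\alpha)\leq\gamma^*(\alpha), \] where $\gamma^*$ is the Legendre transform of the moment scaling function $\gamma$ of $\mu$.
   Context: Box-like self-affine measure: Let $\mathcal I$ be a finite index set with $|\mathcal I|\ge2$. For each $i\in\mathcal I$ let $S_i=T_i\circ L_i+t_i:\mathbb{R}^2\to\mathbb{R}^2$, where $T_i=\mathrm{diag}(c_i,d_i)$ with $c_i,d_i\in(0,1)$, $L_i$ is a linear isometry of $\mathbb{R}^2$ with $L_i([-1,1]^2)=[-1,1]^2$, and $t_i\in\mathbb{R}^2$, such that $S_i([0,1]^2)\subseteq[0,1]^2$. Let $(p_i)_{i\in\mathcal I}$ be a probability vector with all $p_i\in(0,1)$. Let $\mu$ be the unique Borel probability measure with $\mu=\sum_{i\in\mathcal I}p_i\,\mu\circ S_i^{-1}$; its support $F$ is the unique non-empty compact set with $F=\bigcup_iS_i(F)$. Rectangular open set condition: there is a non-empty open rectangle $R=(a,b)\times(c,d)\subset\mathbb{R}^2$ such that the sets $S_i(R)$, $i\in\mathcal I$, are pairwise disjoint subsets of $R$. Multifractal spectra: for $\alpha\ge0$, $\Delta_\alpha=\{x\in F:\dim_{\mathrm{loc}}\mu(x)=\alpha\}$, where $\dim_{\mathrm{loc}}\mu(x)=\lim_{r\to0}\log\mu(B(x,r))/\log r$ if the limit exists; $f_{\mathrm H,\mu}(\alpha)=\dim_{\mathrm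 H}\Delta_\alpha$ and $f_{\mathrm P,\mu}(\alpha)=\dim_{\mathrm P}\Delta_\alpha$ (Hausdorff and packing dimension, with the convention $\dim\emptyset=-\infty$). Legendre transform: $\gamma^*(\alpha)=\inf_{q\ge0}\{\alpha q+\gamma(q)\}$. Moment scaling function: for a compactly supported Borel probability measure $\nu$, $\tau_\nu(q)=\lim_{\delta\to0}\log\int_{\operatorname{supp}\nu}\nu(B(x,\delta))^{q-1}d\nu(x)/(-\log\delta)$ when the limit exists. $\mathcal I^*=\bigcup_{k\ge1}\mathcal I^k$; for $\mathbf i=(i_1,\dots,i_k)$, $S_{\mathbf i}=S_{i_1}\circ\cdots\circ S_{i_k}$, $p(\mathbf i)=p_{i_1}\cdots p_{i_k}$; $\alpha_1(\mathbf i)\ge\alpha_2(\mathbf i)$ are the singular values of the linear part of $S_{\mathbf i}$. $\pi_1(x,y)=x$, $\pi_2(x,y)=y$; $\pi_j(\mu)=\mu\circ\pi_j^{-1}$; $\tau_j(q)=\tau_{\pi_j(\mu)}(q)$, which exists for all $q\ge0$. Let $b(\mathbf i)$, $h(\mathbf i)$ be the base and height lengths of the rectangle $S_{\mathbf i}([0,1]^2)$. If $S_{\mathbf i}$ maps horizontal lines to horizontal lines, put $\tau_{\mathbf i}=\tau_1$ if $b(\mathbf i)\ge h(\mathbf i)$ and $\tau_{\mathbf i}=\tau_2$ if $b(\mathbf i)<h(\mathbf i)$; if $S_{\mathbf i}$ maps horizontal lines to vertical lines, put $\tau_{\mathbf i}=\tau_1$ if $b(\mathbf i)<h(\mathbf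 i)$ and $\tau_{\mathbf i}=\tau_2$ if $b(\mathbf i)\ge h(\mathbf i)$. For $s\in\mathbb{R}$, $q\ge0$: $\psi^{s,q}(\mathbf i)=p(\mathbf i)^q\alpha_1(\mathbf i)^{\tau_{\mathbf i}(q)}\alpha_2(\mathbf i)^{s-\tau_{\mathbf i}(q)}$, $\Psi_k^{s,q}=\sum_{\mathbf i\in\mathcal I^k}\psi^{s,q}(\mathbf i)$, $P(s,q)=\lim_{k\to\infty}(\Psi_k^{s,q})^{1/k}$ (the limit exists). For each $q\ge0$, $\gamma(q)$ is the unique real number with $P(\gamma(q),q)=1$. *)

theory Defs
  imports "HOL-Probability.Probability"
begin

section \<open>Hausdorff and packing dimension\<close>

text \<open>The contribution \<open>|U|\<^sup>s\<close> of a covering set, with \<open>|U|\<^sup>0 = 1\<close> for every non-empty \<open>U\<close>,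
  singletons included (whereas \<open>0 powr 0 = 0\<close>).\<close>
definition diam_pow :: "real \<Rightarrow> 'a::metric_space set \<Rightarrow> ennreal" where
  "diam_pow s U = (if U = {} then 0 else if s = 0 then 1 else ennreal (diameter U powr s))"

text \<open>Finite covers are included, as the sets \<open>U n\<close> may be empty. Boundedness is required
  because \<^const>\<open>diameter\<close> is unspecified on unbounded sets.\<close>
definition hausdorff_premeasure :: "real \<Rightarrow> real \<Rightarrow> 'a::metric_space set \<Rightarrow> ennreal" where
  "hausdorff_premeasure s \<delta> A =
     (INF U \<in> {U :: nat \<Rightarrow> 'a set. A \<subseteq> (\<Union>n. U n) \<and>
                 (\<forall>n. bounded (U n) \<and> diameter (U n) \<le> \<delta>)}. \<Sum>n. diam_pow s (U n))"

definition hausdorff_measure :: "real \<Rightarrow> 'a::metric_space set \<Rightarrow> ennreal" where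
  "hausdorff_measure s A = (SUP \<delta> \<in> {0<..}. hausdorff_premeasure s \<delta> A)"

definition hausdorff_dim :: "'a::metric_space set \<Rightarrow> ereal" where
  "hausdorff_dim A =
     (if A = {} then -\<infinity> else Inf (ereal ` {s. 0 \<le> s \<and> hausdorff_measure s A = 0}))"

text \<open>A \<open>\<delta>\<close>-packing of \<open>A\<close>: countably many pairwise disjoint closed balls with centres in \<open>A\<close>
  and radii at most \<open>\<delta>\<close>, given as a set of pairs (centre, radius).\<close>
definition packings :: "real \<Rightarrow> 'a::euclidean_space set \<Rightarrow> ('a \<times> real) set set" where
  "packings \<delta> A =
     {D. countable D \<and> (\<forall>(x, r) \<in> D. x \<in> A \<and> 0 < r \<and> r \<le> \<delta>) \<and>
         disjoint_family_on (\<lambda>(x, r). cball x r) D}"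

definition packing_premeasure :: "real \<Rightarrow> 'a::euclidean_space set \<Rightarrow> ennreal" where
  "packing_premeasure s A =
     (INF \<delta> \<in> {0<..}. SUP D \<in> packings \<delta> A. \<Sum>\<^sub>\<infinity>(x, r) \<in> D. diam_pow s (cball x r))"

definition packing_measure :: "real \<Rightarrow> 'a::euclidean_space set \<Rightarrow> ennreal" where
  "packing_measure s A =
     (INF E \<in> {E :: nat \<Rightarrow> 'a set. A \<subseteq> (\<Union>n. E n)}. \<Sum>n. packing_premeasure s (E n))"

definition packing_dim :: "'a::euclidean_space set \<Rightarrow> ereal" where
  "packing_dim A =
     (if A = {} then -\<infinity> else Inf (ereal ` {s. 0 \<le> s \<and> packing_measure s A = 0}))"

section \<open>Multifractal spectra\<close>

definition measure_support :: "'a::topological_space measure \<Rightarrow> 'a set" where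
  "measure_support \<nu> = {x. \<forall>U. open U \<and> x \<in> U \<longrightarrow> 0 < emeasure \<nu> U}"

definition has_local_dim :: "'a::metric_space measure \<Rightarrow> 'a \<Rightarrow> real \<Rightarrow> bool" where
  "has_local_dim \<nu> x \<alpha> \<longleftrightarrow>
     ((\<lambda>r. ln (measure \<nu> (cball x r)) / ln r) \<longlongrightarrow> \<alpha>) (at_right 0)"

definition level_set :: "'a::metric_space measure \<Rightarrow> real \<Rightarrow> 'a set" where
  "level_set \<nu> \<alpha> = {x \<in> measure_support \<nu>. has_local_dim \<nu> x \<alpha>}"

definition hausdorff_spectrum :: "'a::metric_space measure \<Rightarrow> real \<Rightarrow> ereal" where
  "hausdorff_spectrum \<nu> \<alpha> = hausdorff_dim (level_set \<nu> \<alpha>)"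

definition packing_spectrum :: "'a::euclidean_space measure \<Rightarrow> real \<Rightarrow> ereal" where
  "packing_spectrum \<nu> \<alpha> = packing_dim (level_set \<nu> \<alpha>)"

text \<open>Extended-real valued, as the infimum may be \<open>-\<infinity>\<close>.\<close>
definition legendre_transform :: "(real \<Rightarrow> real) \<Rightarrow> real \<Rightarrow> ereal" where
  "legendre_transform g \<alpha> = (INF q \<in> {0..}. ereal (\<alpha> * q + g q))"

definition moment_scaling :: "'a::metric_space measure \<Rightarrow> real \<Rightarrow> real" where
  "moment_scaling \<nu> q =
     Lim (at_right 0)
       (\<lambda>\<delta>. ln (LINT x:measure_support \<nu>|\<nu>. measure \<nu> (cball x \<delta>) powr (q - 1)) / (- ln \<delta>))"

section \<open>Box-like self-affine measures\<close>

text \<open>The plane is \<^typ>\<open>real \<times> real\<close>, whose norm and metric are the Euclidean ones.\<close>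

definition box_like_map :: "(real \<times> real \<Rightarrow> real \<times> real) \<Rightarrow> bool" where
  "box_like_map f \<longleftrightarrow>
     (\<exists>c d L t. 0 < c \<and> c < 1 \<and> 0 < d \<and> d < 1 \<and>
        orthogonal_transformation L \<and>
        L ` ({-1..1} \<times> {-1..1}) = {-1..1} \<times> {-1..1} \<and>
        f = (\<lambda>x. (c * fst (L x), d * snd (L x)) + t)) \<and>
     f ` ({0..1} \<times> {0..1}) \<subseteq> {0..1} \<times> {0..1}"

definition box_like_ifs :: "'i set \<Rightarrow> ('i \<Rightarrow> real \<times> real \<Rightarrow> real \<times> real) \<Rightarrow> bool" where
  "box_like_ifs I S \<longleftrightarrow> finite I \<and> 2 \<le> card I \<and> (\<forall>i\<in>I. box_like_map (S i))"

definition prob_vector :: "'i set \<Rightarrow> ('i \<Rightarrow> real) \<Rightarrow> bool" where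
  "prob_vector I p \<longleftrightarrow> (\<forall>i\<in>I. 0 < p i \<and> p i < 1) \<and> (\<Sum>i\<in>I. p i) = 1"

definition box_like_measure ::
  "'i set \<Rightarrow> ('i \<Rightarrow> real \<times> real \<Rightarrow> real \<times> real) \<Rightarrow> ('i \<Rightarrow> real) \<Rightarrow> (real \<times> real) measure \<Rightarrow> bool"
  where
  "box_like_measure I S p \<mu> \<longleftrightarrow>
     box_like_ifs I S \<and> prob_vector I p \<and> prob_space \<mu> \<and> sets \<mu> = sets borel \<and>
     (\<forall>A \<in> sets borel. measure \<mu> A = (\<Sum>i\<in>I. p i * measure \<mu> (S i -` A)))"

definition rect_open_set_condition ::
  "'i set \<Rightarrow> ('i \<Rightarrow> real \<times> real \<Rightarrow> real \<times> real) \<Rightarrow> bool" where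
  "rect_open_set_condition I S \<longleftrightarrow>
     (\<exists>a b c d. a < b \<and> c < d \<and>
        (let R = {a<..<b} \<times> {c<..<d} in
           (\<forall>i\<in>I. S i ` R \<subseteq> R) \<and> disjoint_family_on (\<lambda>i. S i ` R) I))"

section \<open>The moment scaling function of a box-like self-affine measure\<close>

definition words :: "'i set \<Rightarrow> nat \<Rightarrow> 'i list set" where
  "words I k = {w. set w \<subseteq> I \<and> length w = k}"

definition word_map :: "('i \<Rightarrow> 'a \<Rightarrow> 'a) \<Rightarrow> 'i list \<Rightarrow> 'a \<Rightarrow> 'a" where
  "word_map S w = foldr (\<lambda>i f. S i \<circ> f) w id"

definition word_prob :: "('i \<Rightarrow> real) \<Rightarrow> 'i list \<Rightarrow> real" where
  "word_prob p w = prod_list (map p w)"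

definition linear_part :: "('a::real_vector \<Rightarrow> 'a) \<Rightarrow> 'a \<Rightarrow> 'a" where
  "linear_part f = (\<lambda>x. f x - f 0)"

definition singular_values :: "('a::euclidean_space \<Rightarrow> 'a) \<Rightarrow> real set" where
  "singular_values A = {\<sigma>. 0 \<le> \<sigma> \<and> (\<exists>v. v \<noteq> 0 \<and> adjoint A (A v) = \<sigma>\<^sup>2 *\<^sub>R v)}"

text \<open>In the plane there are two singular values counted with multiplicity, so these are the
  larger and the smaller one, also when they coincide.\<close>
definition sv1 :: "(real \<times> real \<Rightarrow> real \<times> real) \<Rightarrow> real" where
  "sv1 f = Max (singular_values (linear_part f))"

definition sv2 :: "(real \<times> real \<Rightarrow> real \<times> real) \<Rightarrow> real" where
  "sv2 f = Min (singular_values (linear_part f))"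

text \<open>The side lengths of the rectangle \<open>f([0,1]\<^sup>2)\<close> (whose sides are parallel to the axes).\<close>
definition base_length :: "(real \<times> real \<Rightarrow> real \<times> real) \<Rightarrow> real" where
  "base_length f = diameter (fst ` f ` ({0..1} \<times> {0..1}))"

definition height_length :: "(real \<times> real \<Rightarrow> real \<times> real) \<Rightarrow> real" where
  "height_length f = diameter (snd ` f ` ({0..1} \<times> {0..1}))"

definition preserves_horizontal :: "(real \<times> real \<Rightarrow> real \<times> real) \<Rightarrow> bool" where
  "preserves_horizontal f \<longleftrightarrow> (\<forall>y. \<exists>y'. f ` (UNIV \<times> {y}) = UNIV \<times> {y'})"

text \<open>A composition of box-like maps which does not preserve horizontal lines maps them to
  vertical lines, so the outer \<open>else\<close> branch is the second case of the definition.\<close>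
definition word_tau ::
  "('i \<Rightarrow> real \<times> real \<Rightarrow> real \<times> real) \<Rightarrow> (real \<times> real) measure \<Rightarrow> 'i list \<Rightarrow> real \<Rightarrow> real" where
  "word_tau S \<mu> w =
     (let f = word_map S w;
          \<tau>1 = moment_scaling (distr \<mu> borel fst);
          \<tau>2 = moment_scaling (distr \<mu> borel snd)
      in if preserves_horizontal f
         then (if base_length f \<ge> height_length f then \<tau>1 else \<tau>2)
         else (if base_length f < height_length f then \<tau>1 else \<tau>2))"

definition psi ::
  "('i \<Rightarrow> real \<times> real \<Rightarrow> real \<times> real) \<Rightarrow> ('i \<Rightarrow> real) \<Rightarrow> (real \<times> real) measure
     \<Rightarrow> real \<Rightarrow> real \<Rightarrow> 'i list \<Rightarrow> real" where
  "psi S p \<mu> s q w =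
     word_prob p w powr q
       * sv1 (word_map S w) powr word_tau S \<mu> w q
       * sv2 (word_map S w) powr (s - word_tau S \<mu> w q)"

definition Psi ::
  "'i set \<Rightarrow> ('i \<Rightarrow> real \<times> real \<Rightarrow> real \<times> real) \<Rightarrow> ('i \<Rightarrow> real) \<Rightarrow> (real \<times> real) measure
     \<Rightarrow> nat \<Rightarrow> real \<Rightarrow> real \<Rightarrow> real" where
  "Psi I S p \<mu> k s q = (\<Sum>w \<in> words I k. psi S p \<mu> s q w)"

definition pressure ::
  "'i set \<Rightarrow> ('i \<Rightarrow> real \<times> real \<Rightarrow> real \<times> real) \<Rightarrow> ('i \<Rightarrow> real) \<Rightarrow> (real \<times> real) measure
     \<Rightarrow> real \<Rightarrow> real \<Rightarrow> real" where
  "pressure I S p \<mu> s q = lim (\<lambda>k. root k (Psi I S p \<mu> k s q))"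

definition moment_scaling_gamma ::
  "'i set \<Rightarrow> ('i \<Rightarrow> real \<times> real \<Rightarrow> real \<times> real) \<Rightarrow> ('i \<Rightarrow> real) \<Rightarrow> (real \<times> real) measure
     \<Rightarrow> real \<Rightarrow> real" where
  "moment_scaling_gamma I S p \<mu> q = (THE s. pressure I S p \<mu> s q = 1)"

end

theory Submission
  imports Defs
begin

text \<open>Put \<open>G(\<delta>)\<close> for the sum of \<open>\<mu>(Q)\<^sup>q\<close> over a grid of squares of side \<open>\<delta>\<close>. If \<open>G(\<delta>) = O(\<delta>\<^bsup>-s\<^esup>)\<close>,
  then a packing by balls centred at points where \<open>r\<^bsup>\<alpha>+\<epsilon>\<^esup> \<le> \<mu>(B(x,r))\<close> satisfies
  \<open>\<Sum> r\<^sup>t \<le> \<Sum> r\<^bsup>t-(\<alpha>+\<epsilon>)q\<^esup> \<mu>(B(x,r))\<^sup>q\<close>, which is summable over dyadic scales once \<open>t > \<alpha>q + s\<close>; hence the packing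
  dimension of the level set is at most \<open>\<alpha>q + s\<close>.

  To bound \<open>G\<close> for \<open>s > \<gamma>(q)\<close>, cut the symbolic tree where the smaller singular value of \<open>S\<^sub>w\<close> drops
  below \<open>\<delta>\<close>. By the rectangular open set condition boundedly many of these cylinders meet a given square,
  and inside one cylinder the squares see \<open>\<mu>\<close> only through its projection to the longer side, so that
  \<open>G(\<delta>)\<close> is dominated by \<open>\<delta>\<^bsup>-s\<^esup>\<close> times a part of the convergent series \<open>\<Sum>\<^sub>w \<psi>\<^bsup>s,q\<^esup>(w)\<close>. The
  exponents \<open>\<tau>\<^sub>1\<close>, \<open>\<tau>\<^sub>2\<close> of the overlapping projections exist because their grid sums are, by Jensen's
  inequality, almost submultiplicative in \<open>\<delta>\<close> for \<open>q \<ge> 1\<close> and almost supermultiplicative for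
  \<open>q < 1\<close>.\<close>

section \<open>Power sums and growth exponents\<close>

text \<open>Much of the work is existence: \<open>moment_scaling\<close> is a \<open>Lim\<close>,
  \<open>pressure\<close> a \<open>lim\<close> and \<open>moment_scaling_gamma\<close> a
  \<open>THE\<close>, and nothing can be said about them before the limits and the zero are known to
  exist. The obstacle on the line is that the projections of \<mu> are mixtures of overlapping
  affine copies of each other, so that the copies cannot be told apart. They are collected by the
  grid cell in which they start, and only the weight of such a group is comparable with the mass of
  a cell; that is where an inequality for weighted means enters, and why it is one-sided. The
  pressure shows the same pattern: \<psi> is exactly multiplicative as long as a fixed axis plays
  the longer side, and choosing the true longer side spoils this in a direction decided by the sign
  of s - \<tau>1(q) - \<tau>2(q). Fekete's lemma needs only one side. Maps that exchange the axes
  are the second obstacle. If there is one, the two projections have the same exponents, and this is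
  what keeps \<psi> multiplicative across an exchange.\<close>

lemma powr_diff_one_mult: "0 \<le> y \<Longrightarrow> y powr (q - 1) * y = y powr (q :: real)"
  using powr_mult_base[of y "q - 1"] by (simp add: mult.commute)

lemma card_int_near_le:
  fixes m :: int
  shows "real (card {k\<in>B. \<bar>m - k\<bar> \<le> 2}) \<le> 5" "real (card {k\<in>B. \<bar>k - m\<bar> \<le> 2}) \<le> 5"
proof -
  have "card {k\<in>B. \<bar>m - k\<bar> \<le> 2} \<le> card {m - 2..m + 2}" "card {k\<in>B. \<bar>k - m\<bar> \<le> 2} \<le> card {m - 2..m + 2}"
    by (intro card_mono; auto)+
  then show "real (card {k\<in>B. \<bar>m - k\<bar> \<le> 2}) \<le> 5" "real (card {k\<in>B. \<bar>k - m\<bar> \<le> 2}) \<le> 5"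
    by auto
qed

text \<open>Comparing with the largest term treats the concave range q < 1 and the convex range q >
  1 at once: the sum is at most m times its maximum, and the q-th power of the maximum is a summand
  on the right.\<close>

lemma powr_sum_le:
  fixes y :: "'k \<Rightarrow> real"
  assumes "finite B" "\<And>k. k \<in> B \<Longrightarrow> 0 \<le> y k" "real (card B) \<le> m" "0 \<le> q"
  shows "(\<Sum>k\<in>B. y k) powr q \<le> m powr q * (\<Sum>k\<in>B. y k powr q)"
proof (cases "B = {}")
  case False
  define z where "z = Max (y ` B)"
  have "z \<in> y ` B" unfolding z_def using False assms(1) by (intro Max_in) auto
  then obtain k where k: "k \<in> B" "y k = z" by auto
  have "(\<Sum>k\<in>B. y k) \<le> (\<Sum>k\<in>B. z)"
    by (rule sum_mono) (simp add: z_def assms(1))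
  also have "\<dots> \<le> m * z"
    using assms(3) assms(2)[OF k(1)] k(2) by (simp add: mult_right_mono)
  finally have le: "(\<Sum>k\<in>B. y k) \<le> m * z" .
  have "(\<Sum>k\<in>B. y k) powr q \<le> (m * z) powr q"
    by (intro powr_mono2 le assms sum_nonneg)
  also have "\<dots> = m powr q * y k powr q"
    using assms(3) assms(2)[OF k(1)] k(2) by (simp add: powr_mult)
  also have "\<dots> \<le> m powr q * (\<Sum>k\<in>B. y k powr q)"
    by (intro mult_left_mono member_le_sum k assms) auto
  finally show ?thesis .
qed simp

text \<open>The tool for every change of covering: \<open>m\<close> bounds how many pieces
  \<open>y k\<close> cover one \<open>x i\<close>, \<open>n\<close> how many \<open>x i\<close>
  share one piece. The first enters through \<open>powr_sum_le\<close>, the second by exchanging the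
  sums.\<close>

lemma powr_sum_overlap:
  fixes x :: "'i \<Rightarrow> real" and y :: "'k \<Rightarrow> real"
  assumes "finite A" "finite B" "0 \<le> q"
    and x: "\<And>i. i \<in> A \<Longrightarrow> 0 \<le> x i" and y: "\<And>k. k \<in> B \<Longrightarrow> 0 \<le> y k"
    and le: "\<And>i. i \<in> A \<Longrightarrow> x i \<le> (\<Sum>k\<in>{k\<in>B. R i k}. y k)"
    and m: "\<And>i. i \<in> A \<Longrightarrow> real (card {k\<in>B. R i k}) \<le> m"
    and n: "\<And>k. k \<in> B \<Longrightarrow> real (card {i\<in>A. R i k}) \<le> n"
  shows "(\<Sum>i\<in>A. x i powr q) \<le> m powr q * n * (\<Sum>k\<in>B. y k powr q)"
proof -
  have "(\<Sum>i\<in>A. x i powr q) \<le> (\<Sum>i\<in>A. m powr q * (\<Sum>k\<in>{k\<in>B. R i k}. y k powr q))"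
  proof (rule sum_mono)
    fix i assume i: "i \<in> A"
    have "x i powr q \<le> (\<Sum>k\<in>{k\<in>B. R i k}. y k) powr q"
      by (intro powr_mono2 assms i)
    also have "\<dots> \<le> m powr q * (\<Sum>k\<in>{k\<in>B. R i k}. y k powr q)"
      using assms i by (intro powr_sum_le) auto
    finally show "x i powr q \<le> \<dots>" .
  qed
  also have "\<dots> = m powr q * (\<Sum>i\<in>A. \<Sum>k\<in>{k\<in>B. R i k}. y k powr q)"
    by (simp add: sum_distrib_left)
  also have "(\<Sum>i\<in>A. \<Sum>k\<in>{k\<in>B. R i k}. y k powr q) = (\<Sum>k\<in>B. \<Sum>i\<in>{i\<in>A. R i k}. y k powr q)"
    by (rule sum.swap_restrict) (use assms in auto)
  also have "\<dots> = (\<Sum>k\<in>B. real (card {i\<in>A. R i k}) * y k powr q)"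
    by simp
  also have "\<dots> \<le> (\<Sum>k\<in>B. n * y k powr q)"
    by (intro sum_mono mult_right_mono n) auto
  finally show ?thesis
    by (simp add: sum_distrib_left mult_left_mono mult.assoc)
qed

text \<open>Concavity, with the tangent taken at 1; for u > 0 this is Young's inequality with second
  factor 1.\<close>

lemma powr_le_tangent:
  fixes u q :: real
  assumes "0 \<le> u" "0 \<le> q" "q < 1"
  shows "u powr q \<le> 1 + q * (u - 1)"
proof (cases "u = 0")
  case False
  then show ?thesis
    using Youngs_inequality_0[of q "1 - q" u 1] assms by (simp add: algebra_simps)
qed (use assms in auto)

lemma powr_ge_tangent:
  fixes u q :: real
  assumes "0 \<le> u" "1 \<le> q"
  shows "1 + q * (u - 1) \<le> u powr q"
proof (cases "q = 1")
  case False
  \<comment> \<open>The convex case is the concave one for the exponent 1/q, applied to u powr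
    q.\<close>
  have "(u powr q) powr (1/q) \<le> 1 + (1/q) * (u powr q - 1)"
    using False assms by (intro powr_le_tangent) auto
  then have "u \<le> 1 + (1/q) * (u powr q - 1)"
    using assms by (simp add: powr_powr)
  then have "q * u \<le> q * (1 + (1/q) * (u powr q - 1))"
    using assms by (intro mult_left_mono) auto
  also have "\<dots> = q + u powr q - 1"
    using assms by (simp add: distrib_left)
  finally show ?thesis
    by (simp add: algebra_simps)
qed (use assms in auto)

text \<open>Jensen's inequality for weights whose total P need not be 1. The tangent is taken at the
  weighted mean s / P, where the linear terms cancel on summation.\<close>

lemma
  fixes w y :: "'k \<Rightarrow> real"
  assumes "finite B" and w: "\<And>k. k \<in> B \<Longrightarrow> 0 < w k" and y: "\<And>k. k \<in> B \<Longrightarrow> 0 \<le> y k"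
  shows powr_weighted_sum_le: "1 \<le> q \<Longrightarrow>
      (\<Sum>k\<in>B. w k * y k) powr q \<le> (\<Sum>k\<in>B. w k) powr (q - 1) * (\<Sum>k\<in>B. w k * y k powr q)"
    and powr_weighted_sum_ge: "0 \<le> q \<Longrightarrow> q < 1 \<Longrightarrow>
      (\<Sum>k\<in>B. w k) powr (q - 1) * (\<Sum>k\<in>B. w k * y k powr q) \<le> (\<Sum>k\<in>B. w k * y k) powr q"
proof -
  define P where "P = (\<Sum>k\<in>B. w k)"
  define s where "s = (\<Sum>k\<in>B. w k * y k)"
  have s0: "0 \<le> s" unfolding s_def by (intro sum_nonneg mult_nonneg_nonneg) (auto simp: w y less_imp_le)
  \<comment> \<open>The mean is a divisor below. If it is 0, every \<open>y k\<close> is 0 and both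
    sides vanish.\<close>
  have zero: "s = 0 \<Longrightarrow> (\<Sum>k\<in>B. w k * y k powr q) = 0" for q
  proof -
    assume "s = 0"
    then have "\<And>k. k \<in> B \<Longrightarrow> w k * y k = 0"
      unfolding s_def using sum_nonneg_eq_0_iff[of B "\<lambda>k. w k * y k"] assms(1)
      by (auto simp: w y less_imp_le)
    then show ?thesis using w by (intro sum.neutral) fastforce
  qed
  have key: "0 < P \<and> (\<Sum>k\<in>B. w k * (1 + q * (y k / (s / P) - 1))) = P" if "s > 0" for q
  proof -
    have "B \<noteq> {}" using that by (auto simp: s_def)
    then have P: "P > 0" unfolding P_def using assms(1) w by (intro sum_pos) auto
    have "(\<Sum>k\<in>B. w k * (1 + q * (y k / (s / P) - 1)))
        = (\<Sum>k\<in>B. (1 - q) * w k + q * P / s * (w k * y k))"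
      using P that by (intro sum.cong) (auto simp: field_simps)
    also have "\<dots> = (1 - q) * P + q * P / s * s"
      unfolding sum.distrib sum_distrib_left[symmetric] P_def s_def by simp
    finally show ?thesis using P that by (simp add: field_simps)
  qed
  have split: "(s / P) powr q * (\<Sum>k\<in>B. w k * (y k / (s / P)) powr q) = (\<Sum>k\<in>B. w k * y k powr q)"
    if "s > 0" for q
  proof -
    have P: "P > 0" using key[OF that] by simp
    then show ?thesis unfolding sum_distrib_left
      using that y by (intro sum.cong refl) (simp add: powr_divide powr_mult)
  qed
  have PP: "s powr q = P powr (q - 1) * ((s / P) powr q * P)" if "s > 0" for q
    using conjunct1[OF key[OF that]] that by (simp add: powr_divide powr_diff)
  show "s powr q \<le> P powr (q - 1) * (\<Sum>k\<in>B. w k * y k powr q)" if "1 \<le> q" for q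
  proof (cases "s = 0")
    case False
    then have s: "s > 0" using s0 by simp
    have "P = (\<Sum>k\<in>B. w k * (1 + q * (y k / (s / P) - 1)))" using key[OF s] by metis
    also have "\<dots> \<le> (\<Sum>k\<in>B. w k * (y k / (s / P)) powr q)"
      using conjunct1[OF key[OF s]] s w y that
      by (intro sum_mono mult_left_mono powr_ge_tangent) (simp_all add: less_imp_le)
    finally have "P \<le> (\<Sum>k\<in>B. w k * (y k / (s / P)) powr q)" .
    then show ?thesis unfolding PP[OF s, of q] split[OF s, of q, symmetric]
      by (intro mult_left_mono) auto
  qed (use zero in auto)
  show "P powr (q - 1) * (\<Sum>k\<in>B. w k * y k powr q) \<le> s powr q" if "0 \<le> q" "q < 1" for q
  proof (cases "s = 0")
    case False
    then have s: "s > 0" using s0 by simp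
    have "(\<Sum>k\<in>B. w k * (y k / (s / P)) powr q)
        \<le> (\<Sum>k\<in>B. w k * (1 + q * (y k / (s / P) - 1)))"
      using conjunct1[OF key[OF s]] s w y that
      by (intro sum_mono mult_left_mono powr_le_tangent) (simp_all add: less_imp_le)
    also have "\<dots> = P" using key[OF s] by blast
    finally have "(\<Sum>k\<in>B. w k * (y k / (s / P)) powr q) \<le> P" .
    then show ?thesis unfolding PP[OF s, of q] split[OF s, of q, symmetric]
      by (intro mult_left_mono) auto
  qed (use zero in auto)
qed

section \<open>Fekete's lemma with bounded defect\<close>

lemma subadditive_mult_le:
  fixes a :: "nat \<Rightarrow> real"
  assumes "\<And>m n. a (m + n) \<le> a m + a n"
  shows "a (k * m + r) \<le> real k * a m + a r"
proof (induction k)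
  case (Suc k)
  have "a (Suc k * m + r) \<le> a m + a (k * m + r)"
    using assms[of m "k * m + r"] by (simp add: add.assoc)
  with Suc show ?case by (simp add: algebra_simps)
qed simp

text \<open>Adding C to the sequence absorbs the defect. The linear lower bound keeps the infimum of
  b n / n finite, and the limit is that infimum.\<close>

lemma Fekete_subadditive:
  fixes a :: "nat \<Rightarrow> real"
  assumes sub: "\<And>m n. a (m + n) \<le> a m + a n + C" and lb: "\<And>n. - B * real n - B \<le> a n"
  shows "convergent (\<lambda>n. a n / real n)"
proof -
  define b where "b n = a n + C" for n
  have sub': "b (m + n) \<le> b m + b n" for m n using sub[of m n] by (simp add: b_def)
  have lb': "b n / real n \<ge> - 2 * \<bar>B\<bar> - \<bar>C\<bar>" if "n > 0" for n
  proof -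
    have "- (2 * \<bar>B\<bar> + \<bar>C\<bar>) * real n \<le> - B * real n - B - \<bar>C\<bar>"
    proof -
      have "\<bar>B\<bar> + \<bar>C\<bar> \<le> (\<bar>B\<bar> + \<bar>C\<bar>) * real n"
        using that mult_left_mono[of 1 "real n" "\<bar>B\<bar> + \<bar>C\<bar>"] by simp
      moreover have "- \<bar>B\<bar> * real n \<le> - B * real n"
        by (intro mult_right_mono) auto
      moreover have "B \<le> \<bar>B\<bar>" by simp
      ultimately show ?thesis unfolding distrib_right minus_mult_left[symmetric] by linarith
    qed
    also have "\<dots> \<le> b n" using lb[of n] by (simp add: b_def)
    finally show ?thesis using that by (simp add: field_simps)
  qed
  define L where "L = (INF n\<in>{1..}. b n / real n)"
  have bdd: "bdd_below ((\<lambda>n. b n / real n) ` {1..})"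
    using lb' by (intro bdd_belowI2[of _ "- 2 * \<bar>B\<bar> - \<bar>C\<bar>"]) auto
  have Lle: "L \<le> b n / real n" if "n > 0" for n
    unfolding L_def using that by (intro cINF_lower bdd) auto
  have "(\<lambda>n. b n / real n) \<longlonglongrightarrow> L"
  proof (rule LIMSEQ_I)
    fix e :: real assume e: "e > 0"
    \<comment> \<open>m nearly attains the infimum. Each large n is divided by m, and D bounds what
      the remainder contributes.\<close>
    obtain m where m: "m \<ge> 1" "b m / real m < L + e/2"
      using e cINF_less_iff[OF _ bdd, of "L + e/2"] by (auto simp: L_def)
    define D where "D = Max ((\<lambda>r. \<bar>b r\<bar>) ` {..<m}) + \<bar>b m\<bar>"
    have D: "\<bar>b r\<bar> + \<bar>b m\<bar> \<le> D" if "r < m" for r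
      unfolding D_def using that by (intro add_right_mono Max_ge) auto
    obtain N :: nat where N: "real N > 2 * D / e" using reals_Archimedean2 by blast
    show "\<exists>no. \<forall>n\<ge>no. norm (b n / real n - L) < e"
    proof (intro exI[of _ "N + 1"] allI impI)
      fix n assume n: "N + 1 \<le> n"
      define k r where "k = n div m" and "r = n mod m"
      have nk: "n = k * m + r" by (simp add: k_def r_def)
      have r: "r < m" using m by (simp add: r_def)
      have "b n \<le> real k * b m + b r"
        using subadditive_mult_le[of b k m r] sub' nk by simp
      also have "real k * b m = (real n - real r) * (b m / real m)"
        using m nk by (simp add: field_simps)
      also have "\<dots> = real n * (b m / real m) - real r / real m * b m"
          by (simp add: left_diff_distrib diff_divide_distrib)
      also have "\<dots> \<le> real n * (b m / real m) + \<bar>b m\<bar>"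
      proof -
        have "\<bar>real r / real m * b m\<bar> \<le> 1 * \<bar>b m\<bar>"
          unfolding abs_mult using r by (intro mult_right_mono) auto
        then show ?thesis by linarith
      qed
      finally have "b n \<le> real n * (b m / real m) + D"
        using D[OF r] by linarith
      also have "\<dots> < real n * (L + e/2) + real n * (e/2)"
      proof -
        have "real n * (b m / real m) \<le> real n * (L + e/2)"
          using m by (intro mult_left_mono) auto
        moreover have "D < real n * (e/2)"
        proof -
          have "2 * D / e < real n" using N n by linarith
          then show ?thesis using e by (simp add: field_simps)
        qed
        ultimately show ?thesis by simp
      qed
      finally have "b n < real n * (L + e)" by (simp add: algebra_simps)
      then have "b n / real n < L + e" using n by (simp add: field_simps)
      then show "norm (b n / real n - L) < e" using Lle[of n] n by auto
    qed
  qed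
  moreover have "(\<lambda>n. C / real n) \<longlonglongrightarrow> 0" by (rule lim_const_over_n)
  ultimately have "(\<lambda>n. b n / real n - C / real n) \<longlonglongrightarrow> L - 0"
    by (rule tendsto_diff)
  then show ?thesis by (auto simp: b_def convergent_def diff_divide_distrib[symmetric])
qed

lemma Fekete_superadditive:
  fixes a :: "nat \<Rightarrow> real"
  assumes "\<And>m n. a m + a n - C \<le> a (m + n)" and "\<And>n. a n \<le> B * real n + B"
  shows "convergent (\<lambda>n. a n / real n)"
proof -
  have "convergent (\<lambda>n. - a n / real n)"
    using assms by (intro Fekete_subadditive[of _ C B]) (force simp: algebra_simps)+
  then show ?thesis using convergent_minus_iff[of "\<lambda>n. a n / real n"] by simp
qed

text \<open>f(\<delta>) = \<delta>^(-T + o(1)), stated as an estimate uniform on (0, 1] instead of a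
  limit. It thus gives power bounds at every scale, also where the scale is a ratio of side lengths
  that need not be small.\<close>

definition growth_exponent :: "(real \<Rightarrow> real) \<Rightarrow> real \<Rightarrow> bool" where
  "growth_exponent f T \<longleftrightarrow> (\<forall>\<epsilon>>0. \<exists>c. \<forall>\<delta>\<in>{0<..1}. 0 < f \<delta> \<and> \<bar>ln (f \<delta>) + T * ln \<delta>\<bar> \<le> c - \<epsilon> * ln \<delta>)"

lemma growth_exponentE:
  assumes "growth_exponent f T" "0 < \<epsilon>"
  obtains c where "\<And>\<delta>. 0 < \<delta> \<Longrightarrow> \<delta> \<le> 1 \<Longrightarrow> 0 < f \<delta> \<and> \<bar>ln (f \<delta>) + T * ln \<delta>\<bar> \<le> c - \<epsilon> * ln \<delta>"
proof -
  obtain c where "\<forall>\<delta>\<in>{0<..1}. 0 < f \<delta> \<and> \<bar>ln (f \<delta>) + T * ln \<delta>\<bar> \<le> c - \<epsilon> * ln \<delta>"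
    using assms unfolding growth_exponent_def by blast
  then show ?thesis by (intro that[of c]) auto
qed

lemma growth_exponent_upper:
  assumes "growth_exponent f T" "0 < \<epsilon>"
  obtains C where "0 < C" "\<And>\<delta>. 0 < \<delta> \<Longrightarrow> \<delta> \<le> 1 \<Longrightarrow> f \<delta> \<le> C * \<delta> powr (- (T + \<epsilon>))"
proof -
  obtain c where c: "\<And>\<delta>. 0 < \<delta> \<Longrightarrow> \<delta> \<le> 1 \<Longrightarrow> 0 < f \<delta> \<and> \<bar>ln (f \<delta>) + T * ln \<delta>\<bar> \<le> c - \<epsilon> * ln \<delta>"
    using growth_exponentE[OF assms] by blast
  have "f \<delta> \<le> exp c * \<delta> powr (- (T + \<epsilon>))" if "0 < \<delta>" "\<delta> \<le> 1" for \<delta>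
  proof -
    have "ln (f \<delta>) \<le> c + - (T + \<epsilon>) * ln \<delta>"
      using c[OF that] unfolding abs_le_iff by (simp add: algebra_simps)
    then have "exp (ln (f \<delta>)) \<le> exp (c + - (T + \<epsilon>) * ln \<delta>)" by simp
    then show ?thesis using c[OF that] that by (simp add: powr_def exp_add)
  qed
  then show ?thesis using that[of "exp c"] by simp
qed

lemma growth_exponent_tendsto:
  assumes "growth_exponent f T"
  shows "((\<lambda>\<delta>. ln (f \<delta>) / (- ln \<delta>)) \<longlongrightarrow> T) (at_right 0)"
proof (rule tendstoI)
  fix e :: real assume e: "0 < e"
  have e2: "0 < e / 2" using e by simp
  obtain c where c: "\<And>\<delta>. 0 < \<delta> \<Longrightarrow> \<delta> \<le> 1 \<Longrightarrow>
      0 < f \<delta> \<and> \<bar>ln (f \<delta>) + T * ln \<delta>\<bar> \<le> c - e / 2 * ln \<delta>"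
    using growth_exponentE[OF assms e2] by blast
  \<comment> \<open>The threshold is chosen so that c < -(e / 2) * ln \<delta>, which leaves a total
    error below -e * ln \<delta>.\<close>
  have "eventually (\<lambda>\<delta>::real. \<delta> \<in> {0<..<min 1 (exp (- 2 * \<bar>c\<bar> / e))}) (at_right 0)"
    by (rule eventually_at_rightI[of 0 "min 1 (exp (- 2 * \<bar>c\<bar> / e))"]) auto
  then show "eventually (\<lambda>\<delta>. dist (ln (f \<delta>) / (- ln \<delta>)) T < e) (at_right 0)"
  proof eventually_elim
    case (elim \<delta>)
    then have d: "0 < \<delta>" "\<delta> < 1" "\<delta> < exp (- 2 * \<bar>c\<bar> / e)" by auto
    have l: "ln \<delta> < 0" using d by simp
    have "ln \<delta> < - 2 * \<bar>c\<bar> / e"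
      using d(1,3) by (metis exp_less_cancel_iff exp_ln)
    then have "ln \<delta> * e < - 2 * \<bar>c\<bar>" using e pos_less_divide_eq by blast
    then have "c - e / 2 * ln \<delta> < e * (- ln \<delta>)" by (simp add: algebra_simps)
    with c[of \<delta>] d have "\<bar>ln (f \<delta>) + T * ln \<delta>\<bar> < e * (- ln \<delta>)" by linarith
    then have "\<bar>ln (f \<delta>) + T * ln \<delta>\<bar> / (- ln \<delta>) < e"
      using l by (subst pos_divide_less_eq) auto
    moreover have "ln (f \<delta>) / (- ln \<delta>) - T = (ln (f \<delta>) + T * ln \<delta>) / (- ln \<delta>)"
      using l by (simp add: field_simps)
    ultimately show ?case using l by (simp add: dist_real_def abs_divide)
  qed
qed

lemma growth_exponent_unique:
  assumes "growth_exponent f T" "growth_exponent f T'"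
  shows "T = T'"
  using tendsto_unique[OF _ growth_exponent_tendsto[OF assms(1)] growth_exponent_tendsto[OF assms(2)]]
  by simp

lemma growth_exponent_cong:
  assumes f: "growth_exponent f T"
    and up: "\<And>\<epsilon>. 0 < \<epsilon> \<Longrightarrow> \<exists>C>0. \<forall>\<delta>\<in>{0<..1}. g \<delta> \<le> C * \<delta> powr (- \<epsilon>) * f \<delta>"
    and low: "\<And>\<epsilon>. 0 < \<epsilon> \<Longrightarrow> \<exists>C>0. \<forall>\<delta>\<in>{0<..1}. f \<delta> \<le> C * \<delta> powr (- \<epsilon>) * g \<delta>"
  shows "growth_exponent g T"
  unfolding growth_exponent_def
proof (intro allI impI)
  fix \<epsilon> :: real assume "0 < \<epsilon>"
  then have e: "0 < \<epsilon> / 2" by simp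
  obtain c where c: "\<And>\<delta>. 0 < \<delta> \<Longrightarrow> \<delta> \<le> 1 \<Longrightarrow> 0 < f \<delta> \<and> \<bar>ln (f \<delta>) + T * ln \<delta>\<bar> \<le> c - \<epsilon> / 2 * ln \<delta>"
    using growth_exponentE[OF f e] by blast
  obtain C1 where C1: "C1 > 0" "\<And>\<delta>. 0 < \<delta> \<Longrightarrow> \<delta> \<le> 1 \<Longrightarrow> g \<delta> \<le> C1 * \<delta> powr (- (\<epsilon>/2)) * f \<delta>"
    using up[OF e] by auto
  obtain C2 where C2: "C2 > 0" "\<And>\<delta>. 0 < \<delta> \<Longrightarrow> \<delta> \<le> 1 \<Longrightarrow> f \<delta> \<le> C2 * \<delta> powr (- (\<epsilon>/2)) * g \<delta>"
    using low[OF e] by auto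
  show "\<exists>c. \<forall>\<delta>\<in>{0<..1}. 0 < g \<delta> \<and> \<bar>ln (g \<delta>) + T * ln \<delta>\<bar> \<le> c - \<epsilon> * ln \<delta>"
  proof (intro exI ballI)
    fix \<delta> :: real assume "\<delta> \<in> {0<..1}"
    then have d: "0 < \<delta>" "\<delta> \<le> 1" by auto
    have fp: "0 < f \<delta>" using c d by blast
    have gp: "0 < g \<delta>"
    proof (rule ccontr)
      assume "\<not> 0 < g \<delta>"
      then have "C2 * \<delta> powr (- (\<epsilon>/2)) * g \<delta> \<le> 0"
        using C2(1) by (intro mult_nonneg_nonpos) auto
      with C2(2)[OF d] fp show False by simp
    qed
    have "ln (g \<delta>) \<le> ln (C1 * \<delta> powr (- (\<epsilon>/2)) * f \<delta>)"
      using C1(2)[OF d] gp by simp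
    also have "\<dots> = ln C1 - \<epsilon>/2 * ln \<delta> + ln (f \<delta>)"
      using C1(1) d fp by (simp add: ln_mult ln_powr)
    finally have 1: "ln (g \<delta>) \<le> \<bar>ln C1\<bar> + \<bar>ln C2\<bar> - \<epsilon>/2 * ln \<delta> + ln (f \<delta>)" by linarith
    have "ln (f \<delta>) \<le> ln (C2 * \<delta> powr (- (\<epsilon>/2)) * g \<delta>)"
      using C2(2)[OF d] fp by simp
    also have "\<dots> = ln C2 - \<epsilon>/2 * ln \<delta> + ln (g \<delta>)"
      using C2(1) d gp by (simp add: ln_mult ln_powr)
    finally have 2: "ln (f \<delta>) \<le> \<bar>ln C1\<bar> + \<bar>ln C2\<bar> - \<epsilon>/2 * ln \<delta> + ln (g \<delta>)" by linarith
    show "0 < g \<delta> \<and> \<bar>ln (g \<delta>) + T * ln \<delta>\<bar> \<le> (\<bar>ln C1\<bar> + \<bar>ln C2\<bar> + c) - \<epsilon> * ln \<delta>"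
      using 1 2 gp c[OF d] by (auto simp: abs_le_iff)
  qed
qed

lemma ex_half_power_bracket:
  fixes \<delta> :: real
  assumes "0 < \<delta>" "\<delta> \<le> 1"
  obtains n :: nat where "(1/2) ^ n / 2 < \<delta>" "\<delta> \<le> (1/2) ^ n"
proof -
  obtain N where N: "(1/2) ^ N < \<delta>" using real_arch_pow_inv[of \<delta> "1/2"] assms by auto
  define M where "M = (LEAST n. (1/2::real) ^ n < \<delta>)"
  have M: "(1/2) ^ M < \<delta>" unfolding M_def by (rule LeastI[of _ N]) (rule N)
  then obtain n where n: "M = Suc n" using assms by (cases M) auto
  have "\<not> (1/2) ^ n < \<delta>" using not_less_Least[of n "\<lambda>n. (1/2::real) ^ n < \<delta>"] n by (simp add: M_def)
  then show ?thesis using that[of n] M n by simp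
qed

text \<open>On the scales 2^-n either alternative of \<open>mult\<close> makes ln f almost sub- or
  superadditive. The doubling bound supplies the linear bound for Fekete's lemma and carries the
  result to the scales in between.\<close>

lemma growth_exponent_exists:
  assumes pos: "\<And>\<delta>. 0 < \<delta> \<Longrightarrow> \<delta> \<le> 1 \<Longrightarrow> 0 < f \<delta>" and K: "1 \<le> K"
    and dbl: "\<And>\<delta> \<delta>'. 0 < \<delta> \<Longrightarrow> \<delta> \<le> 1 \<Longrightarrow> 0 < \<delta>' \<Longrightarrow> \<delta>' \<le> 1 \<Longrightarrow> \<delta> \<le> 2 * \<delta>' \<Longrightarrow> \<delta>' \<le> 2 * \<delta> \<Longrightarrow>
               f \<delta> \<le> K * f \<delta>'"
    and mult: "(\<forall>\<delta>\<in>{0<..1}. \<forall>\<eta>\<in>{0<..1}. f (\<delta> * \<eta>) \<le> K * (f \<delta> * f \<eta>)) \<or>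
               (\<forall>\<delta>\<in>{0<..1}. \<forall>\<eta>\<in>{0<..1}. f \<delta> * f \<eta> \<le> K * f (\<delta> * \<eta>))"
  shows "\<exists>T. growth_exponent f T"
proof -
  define h where "h n = (1/2::real) ^ n" for n :: nat
  define a where "a n = ln (f (h n))" for n
  have h: "0 < h n" "h n \<le> 1" for n by (auto simp: h_def power_le_one)
  have fh: "0 < f (h n)" for n using pos h by simp
  have hadd: "h (m + n) = h m * h n" for m n by (simp add: h_def power_add)
  have lnK: "0 \<le> ln K" using K by simp
  have step: "\<bar>ln (f \<delta>) - ln (f \<delta>')\<bar> \<le> ln K"
    if "0 < \<delta>" "\<delta> \<le> 1" "0 < \<delta>'" "\<delta>' \<le> 1" "\<delta> \<le> 2 * \<delta>'" "\<delta>' \<le> 2 * \<delta>" for \<delta> \<delta>'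
  proof -
    have p: "0 < f \<delta>" "0 < f \<delta>'" using that pos by auto
    have "ln (f \<delta>) \<le> ln (K * f \<delta>')" "ln (f \<delta>') \<le> ln (K * f \<delta>)"
      using that dbl p K by simp_all
    then show ?thesis using p K by (simp add: ln_mult abs_le_iff)
  qed
  have abound: "\<bar>a n\<bar> \<le> \<bar>a 0\<bar> + ln K * real n" for n
  proof (induction n)
    case (Suc n)
    have "\<bar>a (Suc n) - a n\<bar> \<le> ln K"
      unfolding a_def using h[of n] h[of "Suc n"] by (intro step) (simp_all add: h_def)
    with Suc show ?case by (simp add: algebra_simps abs_le_iff)
  qed simp
  define B where "B = \<bar>a 0\<bar> + ln K"
  have aB: "\<bar>a n\<bar> \<le> B * real n + B" for n
  proof -
    have "0 \<le> \<bar>a 0\<bar> * real n" by simp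
    then show ?thesis using abound[of n] lnK unfolding B_def distrib_right by linarith
  qed
  have "convergent (\<lambda>n. a n / real n)"
    using mult
  proof
    assume *: "\<forall>\<delta>\<in>{0<..1}. \<forall>\<eta>\<in>{0<..1}. f (\<delta> * \<eta>) \<le> K * (f \<delta> * f \<eta>)"
    have "a (m + n) \<le> a m + a n + ln K" for m n
    proof -
      have "ln (f (h m * h n)) \<le> ln (K * (f (h m) * f (h n)))"
        using *[rule_format, of "h m" "h n"] h fh[of "m + n"] hadd by (intro ln_mono) simp_all
      then show ?thesis using fh[of m] fh[of n] K by (simp add: a_def hadd ln_mult_pos)
    qed
    moreover have "- B * real n - B \<le> a n" for n using aB[of n] by (simp add: abs_le_iff)
    ultimately show ?thesis by (rule Fekete_subadditive)
  next
    assume *: "\<forall>\<delta>\<in>{0<..1}. \<forall>\<eta>\<in>{0<..1}. f \<delta> * f \<eta> \<le> K * f (\<delta> * \<eta>)"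
    have "a m + a n - ln K \<le> a (m + n)" for m n
    proof -
      have "ln (f (h m) * f (h n)) \<le> ln (K * f (h m * h n))"
        using *[rule_format, of "h m" "h n"] h fh by (intro ln_mono) simp_all
      then show ?thesis using fh[of "m+n"] fh[of m] fh[of n] K by (simp add: a_def hadd ln_mult_pos)
    qed
    moreover have "a n \<le> B * real n + B" for n using aB[of n] by (simp add: abs_le_iff)
    ultimately show ?thesis by (rule Fekete_superadditive)
  qed
  then obtain L where L: "(\<lambda>n. a n / real n) \<longlonglongrightarrow> L" by (auto simp: convergent_def)
  \<comment> \<open>a n behaves like L * n while ln (h n) = -n * ln 2, so the exponent with respect
    to \<delta> is L / ln 2.\<close>
  define T where "T = L / ln 2"
  have "growth_exponent f T"
    unfolding growth_exponent_def
  proof (intro allI impI)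
    fix \<epsilon> :: real assume e: "0 < \<epsilon>"
    have "\<forall>\<^sub>F n in sequentially. \<bar>a n / real n - L\<bar> < \<epsilon> * ln 2"
      using tendstoD[OF L, of "\<epsilon> * ln 2"] e by (simp add: dist_real_def)
    then obtain N where N: "\<And>n. n \<ge> N \<Longrightarrow> \<bar>a n / real n - L\<bar> < \<epsilon> * ln 2"
      by (auto simp: eventually_sequentially)
    \<comment> \<open>The finitely many n up to N, about which the limit says nothing, go into the
      constant.\<close>
    define c0 where "c0 = Max ((\<lambda>n. \<bar>a n - L * real n\<bar>) ` {..N})"
    have c0: "\<bar>a n - L * real n\<bar> \<le> c0" if "n \<le> N" for n
      unfolding c0_def using that by (intro Max_ge) auto
    then have c00: "0 \<le> c0" by (meson abs_ge_zero order_trans le_refl)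
    have bound: "\<bar>a n - L * real n\<bar> \<le> c0 + \<epsilon> * ln 2 * real n" for n
    proof (cases "n \<le> N")
      case True
      moreover have "0 \<le> \<epsilon> * ln 2 * real n" using e by simp
      ultimately show ?thesis using c0[of n] by linarith
    next
      case False
      then have "\<bar>a n / real n - L\<bar> * real n \<le> \<epsilon> * ln 2 * real n"
        using N[of n] by (intro mult_right_mono) auto
      moreover have "\<bar>a n / real n - L\<bar> * real n = \<bar>(a n / real n - L) * real n\<bar>"
        by (simp add: abs_mult)
      moreover have "(a n / real n - L) * real n = a n - L * real n"
        using False by (simp add: field_simps)
      ultimately show ?thesis using c00 by simp
    qed
    show "\<exists>c. \<forall>\<delta>\<in>{0<..1}. 0 < f \<delta> \<and> \<bar>ln (f \<delta>) + T * ln \<delta>\<bar> \<le> c - \<epsilon> * ln \<delta>"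
    proof (intro exI ballI)
      fix \<delta> :: real assume "\<delta> \<in> {0<..1}"
      then have d: "0 < \<delta>" "\<delta> \<le> 1" by auto
      obtain n where n: "h n / 2 < \<delta>" "\<delta> \<le> h n"
        using ex_half_power_bracket[OF d] by (auto simp: h_def)
      have 1: "\<bar>ln (f \<delta>) - a n\<bar> \<le> ln K"
        unfolding a_def using n d h[of n] by (intro step) auto
      have lnh: "ln (h n) = - real n * ln 2"
        by (simp add: h_def ln_realpow ln_div)
      have "ln \<delta> \<le> - real n * ln 2" using n d h[of n] unfolding lnh[symmetric] by simp
      moreover have "ln (h n / 2) \<le> ln \<delta>" using n d h[of n] by simp
      then have "- real n * ln 2 - ln 2 \<le> ln \<delta>" using h[of n] lnh by (simp add: ln_div)
      ultimately have 2: "\<bar>real n * ln 2 + ln \<delta>\<bar> \<le> ln 2" "real n * ln 2 \<le> - ln \<delta>"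
        by linarith+
      have "L * real n + T * ln \<delta> = T * (real n * ln 2 + ln \<delta>)"
        by (simp add: T_def field_simps)
      then have 3: "\<bar>L * real n + T * ln \<delta>\<bar> \<le> \<bar>T\<bar> * ln 2"
        using 2(1) by (simp add: abs_mult mult_left_mono)
      have "\<epsilon> * ln 2 * real n \<le> \<epsilon> * (- ln \<delta>)"
        using mult_left_mono[OF 2(2), of \<epsilon>] e by (simp add: mult_ac)
      with bound[of n] 1 3 show "0 < f \<delta> \<and> \<bar>ln (f \<delta>) + T * ln \<delta>\<bar> \<le> (ln K + c0 + \<bar>T\<bar> * ln 2) - \<epsilon> * ln \<delta>"
        using pos[OF d] by (auto simp: abs_le_iff)
    qed
  qed
  then show ?thesis ..
qed

section \<open>Hausdorff and packing dimension\<close>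

lemma diam_pow_cball_double:
  fixes x y :: "'a::euclidean_space"
  assumes "0 < r"
  shows "diam_pow s (cball y (2 * r)) = ennreal (2 powr s) * diam_pow s (cball x r)"
    and "0 < diam_pow s (cball x r)" and "diam_pow s (cball x r) < \<top>"
    and "diam_pow s (cball x r) = diam_pow s (cball y r)"
proof -
  have ne: "cball x r \<noteq> {}" "cball y (2 * r) \<noteq> {}" "cball y r \<noteq> {}" using assms by auto
  have "diameter (cball y (2 * r)) = 2 * diameter (cball x r)" "0 \<le> diameter (cball x r)"
    using assms by auto
  then show "diam_pow s (cball y (2 * r)) = ennreal (2 powr s) * diam_pow s (cball x r)"
    using ne by (simp add: diam_pow_def powr_mult del: diameter_cball flip: ennreal_mult)
  show "0 < diam_pow s (cball x r)" "diam_pow s (cball x r) < \<top>"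
    "diam_pow s (cball x r) = diam_pow s (cball y r)"
    using ne assms by (auto simp: diam_pow_def)
qed

text \<open>A maximal 2r-separated subset of E gives both families: balls of radius r about it form
  a packing, and by maximality balls of radius 2r cover E. Doubling costs the factor 2 powr
  s.\<close>

lemma ex_cover_of_packing_premeasure:
  fixes E :: "'a::euclidean_space set"
  assumes c: "packing_premeasure s E < c" "c < \<top>" and \<delta>: "0 < \<delta>"
  shows "\<exists>U. E \<subseteq> (\<Union>n. U n) \<and> (\<forall>n::nat. bounded (U n) \<and> diameter (U n) \<le> \<delta>) \<and>
             (\<Sum>n. diam_pow s (U n)) \<le> ennreal (2 powr s) * c"
proof -
  obtain d where d: "d > 0" "(SUP D \<in> packings d E. \<Sum>\<^sub>\<infinity>(x, r) \<in> D. diam_pow s (cball x r)) < c"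
    using c unfolding packing_premeasure_def by (auto simp: INF_less_iff)
  \<comment> \<open>A doubled ball has diameter 4 * r, hence \<delta> / 4.\<close>
  define r where "r = min d (\<delta> / 4)"
  have r: "0 < r" "r \<le> d" "4 * r \<le> \<delta>" using d \<delta> by (auto simp: r_def)
  define v where "v = diam_pow s (cball (0::'a) r)"
  note dp = diam_pow_cball_double[OF r(1)]
  have v: "0 < v" "v < \<top>" unfolding v_def using dp(2,3)[where s=s and x=0] by auto
  define sep where "sep X \<longleftrightarrow> finite X \<and> X \<subseteq> E \<and> (\<forall>x\<in>X. \<forall>y\<in>X. x \<noteq> y \<longrightarrow> 2 * r < dist x y)" for X
  have le: "of_nat (card X) * v \<le> c" if "sep X" for X
  proof -
    have fin: "finite X" using that by (simp add: sep_def)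
    have disj: "disjoint_family_on (\<lambda>(x, r). cball x r) ((\<lambda>x. (x, r)) ` X)"
      unfolding disjoint_family_on_def
    proof (intro ballI impI)
      fix u w assume "u \<in> (\<lambda>x. (x, r)) ` X" "w \<in> (\<lambda>x. (x, r)) ` X" "u \<noteq> w"
      then obtain x y where xy: "x \<in> X" "y \<in> X" "x \<noteq> y" "u = (x, r)" "w = (y, r)" by auto
      then have "2 * r < dist x y" using that by (auto simp: sep_def)
      then have "cball x r \<inter> cball y r = {}"
        by (intro disjoint_cballI) simp
      then show "(case u of (x, r) \<Rightarrow> cball x r) \<inter> (case w of (x, r) \<Rightarrow> cball x r) = {}"
        using xy by simp
    qed
    have "(\<lambda>x. (x, r)) ` X \<in> packings d E"
      using that disj fin r by (auto simp: packings_def sep_def intro!: countable_finite)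
    then have "(\<Sum>\<^sub>\<infinity>(x, r) \<in> (\<lambda>x. (x, r)) ` X. diam_pow s (cball x r)) \<le> c"
      using d(2) by (meson SUP_upper less_imp_le order_trans)
    also have "(\<Sum>\<^sub>\<infinity>(x, r) \<in> (\<lambda>x. (x, r)) ` X. diam_pow s (cball x r))
        = (\<Sum>x\<in>X. diam_pow s (cball x r))"
      using fin by (simp add: sum.reindex inj_on_def)
    also have "\<dots> = (\<Sum>x\<in>X. v)"
      unfolding v_def by (intro sum.cong refl dp(4))
    finally show ?thesis by simp
  qed
  \<comment> \<open>The packing bound limits the size of separated sets, so that one of maximal
    cardinality exists.\<close>
  obtain M :: nat where M: "c / v < of_nat M"
  proof -
    have "c / v < \<top>" using c(2) v by (auto simp: ennreal_divide_eq_top_iff less_top[symmetric])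
    then show ?thesis using that ennreal_Ex_less_of_nat by blast
  qed
  have bound: "card X \<le> M" if "sep X" for X
  proof -
    have "c < of_nat M * v"
      using M v by (subst (asm) divide_less_ennreal) auto
    with le[OF that] have "of_nat (card X) * v < of_nat M * v" by (rule order_le_less_trans)
    then have "of_nat (card X) < (of_nat M :: ennreal)"
      by (meson mult_right_mono not_le zero_le)
    then show ?thesis by simp
  qed
  have "sep {}" by (simp add: sep_def)
  then obtain X where X: "sep X" "\<And>Y. sep Y \<Longrightarrow> card Y \<le> card X"
    using ex_has_greatest_nat[of sep "{}" card "Suc M"] bound by (metis le_imp_less_Suc)
  have fin: "finite X" using X by (simp add: sep_def)
  have cov: "E \<subseteq> (\<Union>x\<in>X. cball x (2 * r))"
  proof
    fix e assume e: "e \<in> E"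
    show "e \<in> (\<Union>x\<in>X. cball x (2 * r))"
    proof (rule ccontr)
      assume "e \<notin> (\<Union>x\<in>X. cball x (2 * r))"
      then have far: "\<And>x. x \<in> X \<Longrightarrow> 2 * r < dist x e" by auto
      then have "e \<notin> X" using r by force
      moreover have "sep (insert e X)"
        using X(1) e far by (auto simp: sep_def dist_commute)
      ultimately show False using X(2)[of "insert e X"] fin by simp
    qed
  qed
  obtain g where g: "bij_betw g {0..<card X} X" using ex_bij_betw_nat_finite[OF fin] by blast
  define U where "U n = (if n < card X then cball (g n) (2 * r) else {})" for n
  have "E \<subseteq> (\<Union>n. U n)"
  proof
    fix e assume "e \<in> E"
    then obtain x where "x \<in> X" "e \<in> cball x (2 * r)" using cov by auto
    moreover then obtain n where "n < card X" "g n = x"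
      using bij_betw_imp_surj_on[OF g] by (metis atLeastLessThan_iff imageE)
    ultimately show "e \<in> (\<Union>n. U n)" by (auto simp: U_def intro!: exI[of _ n])
  qed
  moreover have "bounded (U n) \<and> diameter (U n) \<le> \<delta>" for n
    using r \<delta> by (simp add: U_def)
  moreover have "(\<Sum>n. diam_pow s (U n)) \<le> ennreal (2 powr s) * c"
  proof -
    have "(\<Sum>n. diam_pow s (U n)) = (\<Sum>n<card X. diam_pow s (U n))"
      by (intro suminf_finite) (auto simp: U_def diam_pow_def)
    also have "\<dots> = (\<Sum>n<card X. ennreal (2 powr s) * v)"
      by (intro sum.cong refl) (simp add: U_def dp(1)[where x=0] v_def)
    also have "\<dots> = ennreal (2 powr s) * (of_nat (card X) * v)"
      by (simp add: mult_ac)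
    also have "\<dots> \<le> ennreal (2 powr s) * c"
      by (intro mult_left_mono le X) auto
    finally show ?thesis .
  qed
  ultimately show ?thesis by blast
qed

text \<open>Each set of a countable cover with small packing premeasures is itself covered by balls
  of comparable total weight, at every scale \<delta>. All these balls together are admissible for
  the Hausdorff premeasure.\<close>

lemma hausdorff_measure_eq_0_of_packing:
  fixes A :: "'a::euclidean_space set"
  assumes "packing_measure s A = 0"
  shows "hausdorff_measure s A = 0"
proof -
  have bound: "hausdorff_premeasure s \<delta> A \<le> ennreal (2 powr s) * ennreal e" if "0 < \<delta>" "0 < e" for \<delta> e
  proof -
    have "packing_measure s A < ennreal (e / 2)" using assms that by simp
    then obtain E :: "nat \<Rightarrow> 'a set" where E: "A \<subseteq> (\<Union>n. E n)"
      "(\<Sum>n. packing_premeasure s (E n)) < ennreal (e / 2)"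
      unfolding packing_measure_def by (auto simp: INF_less_iff)
    \<comment> \<open>The summable surplus makes \<open>packing_premeasure s (E n) < c n\<close>
      strict even where the premeasure is 0.\<close>
    define c where "c n = packing_premeasure s (E n) + ennreal (e / 2 * (1/2) ^ Suc n)" for n
    have fin: "packing_premeasure s (E n) < \<top>" for n
    proof -
      have "packing_premeasure s (E n) \<le> (\<Sum>n. packing_premeasure s (E n))"
        using sum_le_suminf[of "\<lambda>n. packing_premeasure s (E n)" "{n}"] by simp
      then show ?thesis using E(2) by (meson ennreal_less_top less_trans order_le_less_trans)
    qed
    have "\<forall>n. \<exists>U. E n \<subseteq> (\<Union>k. U k) \<and> (\<forall>k::nat. bounded (U k) \<and> diameter (U k) \<le> \<delta>) \<and>
             (\<Sum>k. diam_pow s (U k)) \<le> ennreal (2 powr s) * c n"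
    proof (intro allI ex_cover_of_packing_premeasure)
      fix n
      show "packing_premeasure s (E n) < c n"
        unfolding c_def using fin[of n] that
        by (cases "packing_premeasure s (E n)") (auto simp flip: ennreal_plus simp: ennreal_less_iff)
      show "c n < \<top>" unfolding c_def using fin[of n] by simp
    qed (use that in auto)
    from choice[OF this] obtain U where U: "\<And>n. E n \<subseteq> (\<Union>k. U n k)" "\<And>n k. bounded (U n k)"
      "\<And>n k. diameter (U n k) \<le> \<delta>" "\<And>n. (\<Sum>k. diam_pow s (U n (k::nat))) \<le> ennreal (2 powr s) * c n"
      by blast
    define V where "V n = (case prod_decode n of (i, j) \<Rightarrow> U i j)" for n
    have "A \<subseteq> (\<Union>n. V n)"
    proof
      fix a assume "a \<in> A"
      then obtain n k where "a \<in> U n k" using E(1) U(1) by blast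
      then have "a \<in> V (prod_encode (n, k))" by (simp add: V_def)
      then show "a \<in> (\<Union>n. V n)" by blast
    qed
    moreover have "bounded (V n) \<and> diameter (V n) \<le> \<delta>" for n
      using U by (simp add: V_def split: prod.split)
    ultimately have "hausdorff_premeasure s \<delta> A \<le> (\<Sum>n. diam_pow s (V n))"
      unfolding hausdorff_premeasure_def by (intro INF_lower) auto
    also have "\<dots> = (\<Sum>n. \<Sum>k. diam_pow s (U n k))"
    proof -
      have "(\<lambda>n. diam_pow s (V n)) = (\<lambda>(i, j). diam_pow s (U i j)) \<circ> prod_decode"
        by (auto simp: V_def fun_eq_iff split: prod.split)
      then show ?thesis using suminf_ennreal_2dimen[of "\<lambda>i. \<Sum>j. diam_pow s (U i j)" "\<lambda>(i, j). diam_pow s (U i j)"]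
        by (simp add: comp_def)
    qed
    also have "\<dots> \<le> (\<Sum>n. ennreal (2 powr s) * c n)"
      by (intro suminf_le U) auto
    also have "\<dots> = ennreal (2 powr s) * (\<Sum>n. c n)" by simp
    also have "(\<Sum>n. c n) = (\<Sum>n. packing_premeasure s (E n)) + ennreal (e / 2)"
    proof -
      have "(\<Sum>n. ennreal (e / 2 * (1/2) ^ Suc n)) = ennreal (e / 2)"
        using sums_mult[OF power_half_series, of "e / 2"] that by (intro suminf_ennreal_eq) auto
      then show ?thesis unfolding c_def by (subst suminf_add[symmetric]) auto
    qed
    also have "\<dots> \<le> ennreal (e / 2) + ennreal (e / 2)"
      using E(2) by (intro add_right_mono) simp
    also have "\<dots> = ennreal e" using that by (simp flip: ennreal_plus)
    finally show ?thesis by (simp add: mult_left_mono)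
  qed
  have "hausdorff_premeasure s \<delta> A \<le> 0" if "0 < \<delta>" for \<delta>
  proof (rule ennreal_le_epsilon)
    fix e :: real assume e: "0 < e"
    have "hausdorff_premeasure s \<delta> A \<le> ennreal (2 powr s) * ennreal (e / 2 powr s)"
      using that e by (intro bound) auto
    then show "hausdorff_premeasure s \<delta> A \<le> 0 + ennreal e"
      using e by (simp flip: ennreal_mult)
  qed
  then show ?thesis by (auto simp: hausdorff_measure_def)
qed

lemma hausdorff_dim_le_packing_dim:
  fixes A :: "'a::euclidean_space set"
  shows "hausdorff_dim A \<le> packing_dim A"
  unfolding hausdorff_dim_def packing_dim_def
  by (auto intro!: Inf_superset_mono image_mono dest: hausdorff_measure_eq_0_of_packing)

section \<open>Grid sums on the line\<close>

text \<open>Closed, so neighbouring cells share an endpoint: coverings with bounded overlap replace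
  partitions throughout.\<close>

definition cell :: "real \<Rightarrow> int \<Rightarrow> real set" where
  "cell a m = {a * of_int m .. a * (of_int m + 1)}"

definition grid :: "real \<Rightarrow> int set" where
  "grid a = {m. cell a m \<inter> {0..1} \<noteq> {}}"

definition grid_sum :: "real measure \<Rightarrow> real \<Rightarrow> real \<Rightarrow> real" where
  "grid_sum \<nu> q a = (\<Sum>m\<in>grid a. measure \<nu> (cell a m) powr q)"

lemma cell_borel [measurable]: "cell a m \<in> sets borel"
  by (simp add: cell_def)

lemma mem_cell_floor: "0 < a \<Longrightarrow> x \<in> cell a \<lfloor>x / a\<rfloor>"
  by (simp add: cell_def mult.commute[of a] pos_le_divide_eq[symmetric] pos_divide_le_eq[symmetric])

lemma floor_mem_grid: "0 < a \<Longrightarrow> x \<in> {0..1} \<Longrightarrow> \<lfloor>x / a\<rfloor> \<in> grid a"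
  unfolding grid_def using mem_cell_floor[of a x] by blast

lemma cell_diam: "x \<in> cell a m \<Longrightarrow> y \<in> cell a m \<Longrightarrow> \<bar>x - y\<bar> \<le> a"
  by (auto simp: cell_def algebra_simps)

text \<open>E lies within distance l of any of its points z, so the indices range between the
  roundings of (z - l) / a and (z + l) / a. The factor 2 is the price for allowing E to be an
  arbitrary set.\<close>

lemma cells_meeting:
  assumes a: "0 < a" and l: "0 \<le> l" and E: "\<And>x y. x \<in> E \<Longrightarrow> y \<in> E \<Longrightarrow> \<bar>x - y\<bar> \<le> l"
  shows "finite {m. cell a m \<inter> E \<noteq> {}}" (is "finite ?M")
    and "real (card {m. cell a m \<inter> E \<noteq> {}}) \<le> 2 * l / a + 2"
proof -
  have "finite ?M \<and> real (card ?M) \<le> 2 * l / a + 2"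
  proof (cases "E = {}")
    case False
    then obtain z where z: "z \<in> E" by blast
    define c f where "c = \<lceil>(z - l) / a\<rceil> - 1" and "f = \<lfloor>(z + l) / a\<rfloor>"
    have sub: "?M \<subseteq> {c..f}"
    proof
      fix m assume "m \<in> ?M"
      then obtain x where x: "x \<in> cell a m" "x \<in> E" by blast
      have "z - l \<le> x" "x \<le> z + l" using E[OF x(2) z] by auto
      then have "of_int m \<le> (z + l) / a" "(z - l) / a \<le> of_int m + 1"
        using x(1) a by (auto simp: cell_def field_simps)
      then show "m \<in> {c..f}" unfolding c_def f_def atLeastAtMost_iff by linarith
    qed
    have "c \<le> f + 1" unfolding c_def f_def
    proof -
      have "(z - l) / a \<le> (z + l) / a" using a l by (intro divide_right_mono) auto
      then have "\<lceil>(z - l) / a\<rceil> \<le> \<lceil>(z + l) / a\<rceil>" by (rule ceiling_mono)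
      also have "\<dots> \<le> \<lfloor>(z + l) / a\<rfloor> + 1" by linarith
      finally show "\<lceil>(z - l) / a\<rceil> - 1 \<le> \<lfloor>(z + l) / a\<rfloor> + 1" by simp
    qed
    then have "real (card {c..f}) = of_int f - of_int c + 1" by simp
    also have "\<dots> \<le> (z + l) / a - (z - l) / a + 2" unfolding c_def f_def by linarith
    also have "\<dots> = 2 * l / a + 2" using a by (simp add: field_simps)
    finally have "real (card {c..f}) \<le> 2 * l / a + 2" .
    moreover have "card ?M \<le> card {c..f}" using sub by (intro card_mono) auto
    ultimately show ?thesis using finite_subset[OF sub] by auto
  qed (use a l in auto)
  then show "finite ?M" "real (card ?M) \<le> 2 * l / a + 2" by auto
qed

lemma finite_grid: "0 < a \<Longrightarrow> finite (grid a)"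
  unfolding grid_def by (rule cells_meeting[where l = 1]) auto

text \<open>The complement of the support is a union of null basic open sets, and a countable base
  keeps the union null.\<close>

lemma AE_measure_support:
  fixes \<nu> :: "'a::second_countable_topology measure"
  assumes "sets \<nu> = sets borel"
  shows "AE x in \<nu>. x \<in> measure_support \<nu>"
proof -
  obtain B :: "'a set set" where B: "countable B" "topological_basis B"
    using ex_countable_basis by blast
  have "\<Union>{U\<in>B. emeasure \<nu> U = 0} \<in> null_sets \<nu>"
  proof -
    have "(\<Union>U\<in>{U\<in>B. emeasure \<nu> U = 0}. U) \<in> null_sets \<nu>"
      using countable_subset[OF _ B(1), of "{U\<in>B. emeasure \<nu> U = 0}"] assms topological_basis_open[OF B(2)]
      by (intro null_sets_UN') (auto intro!: null_setsI)
    then show ?thesis by simp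
  qed
  moreover have "{x \<in> space \<nu>. x \<notin> measure_support \<nu>} \<subseteq> \<Union>{U\<in>B. emeasure \<nu> U = 0}"
  proof
    fix x assume "x \<in> {x \<in> space \<nu>. x \<notin> measure_support \<nu>}"
    then obtain U where U: "open U" "x \<in> U" "emeasure \<nu> U = 0"
      by (auto simp: measure_support_def)
    then obtain V where V: "V \<in> B" "x \<in> V" "V \<subseteq> U" using topological_basisE[OF B(2)] by metis
    have "emeasure \<nu> V \<le> emeasure \<nu> U" using V U assms by (intro emeasure_mono) auto
    then show "x \<in> \<Union>{U\<in>B. emeasure \<nu> U = 0}" using V U by auto
  qed
  ultimately show ?thesis by (rule AE_I')
qed

lemma closed_measure_support:
  fixes \<nu> :: "'a::topological_space measure"
  shows "closed (measure_support \<nu>)"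
proof -
  have "- measure_support \<nu> = \<Union>{U. open U \<and> emeasure \<nu> U = 0}"
    by (auto simp: measure_support_def not_less)
  then show ?thesis unfolding closed_def by auto
qed

section \<open>Probability measures on the unit interval\<close>

locale unit_interval_measure = prob_space \<nu> for \<nu> :: "real measure" +
  assumes sets_eq [measurable_cong]: "sets \<nu> = sets borel"
    and prob_unit: "prob {0..1} = 1"
begin

lemma AE_unit: "AE x in \<nu>. x \<in> {0..1}"
  using prob_eq_1[of "{0..1}"] prob_unit sets_eq by simp

lemma borel_events: "E \<in> sets borel \<Longrightarrow> E \<in> events"
  using sets_eq by simp

lemma space_eq: "space \<nu> = UNIV"
  using sets_eq_imp_space_eq[OF sets_eq] by simp

text \<open>Only points of [0, 1] must be covered, since the measure lives there. E is arbitrary: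
  \<open>measure\<close> is 0 on sets that are not events.\<close>

lemma prob_le_sum_cover:
  assumes "finite B" "\<And>k. k \<in> B \<Longrightarrow> J k \<in> sets borel"
    and "\<And>x. x \<in> E \<Longrightarrow> x \<in> {0..1} \<Longrightarrow> \<exists>k\<in>B. x \<in> J k"
  shows "prob E \<le> (\<Sum>k\<in>B. prob (J k))"
proof (cases "E \<in> events")
  case True
  have "prob E \<le> prob (\<Union>k\<in>B. J k)"
    using AE_unit True assms by (intro finite_measure_mono_AE) (auto intro!: borel_events sets.finite_UN)
  also have "\<dots> \<le> (\<Sum>k\<in>B. prob (J k))"
    using assms sets_eq by (intro finite_measure_subadditive_finite) auto
  finally show ?thesis .
qed (simp add: measure_notin_sets sum_nonneg)

lemma prob_le_sum_cells:
  assumes "0 < a"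
  shows "prob E \<le> (\<Sum>k\<in>{k\<in>grid a. cell a k \<inter> E \<noteq> {}}. prob (cell a k))"
proof (rule prob_le_sum_cover)
  fix x assume "x \<in> E" "x \<in> {0..1}"
  then show "\<exists>k\<in>{k\<in>grid a. cell a k \<inter> E \<noteq> {}}. x \<in> cell a k"
    using floor_mem_grid[OF assms, of x] mem_cell_floor[OF assms, of x] by blast
qed (use finite_grid[OF assms] in auto)

lemma ex_cell_pos:
  assumes "0 < a"
  shows "\<exists>m\<in>grid a. 0 < prob (cell a m)"
proof (rule ccontr)
  assume "\<not> ?thesis"
  then have "\<And>m. m \<in> grid a \<Longrightarrow> prob (cell a m) = 0"
    by (meson measure_nonneg not_less order_antisym_conv)
  then have "prob UNIV \<le> 0"
    using prob_le_sum_cells[OF assms, of UNIV] by simp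
  then show False using prob_space space_eq by simp
qed

lemma grid_sum_pos: "0 < a \<Longrightarrow> 0 < grid_sum \<nu> q a"
  unfolding grid_sum_def using ex_cell_pos[of a] finite_grid[of a]
  by (auto intro!: sum_pos2)

text \<open>Preimages of cells under the affine map are intervals of length a / |A|, comparable with
  b by the factor \<kappa>, so cells and preimages overlap at most 2 * \<kappa> + 2 times both ways.
  In the exponent q + 1, q comes from splitting a mass into that many parts and 1 from the
  multiplicity. For the second bound \<open>grid a\<close> is large enough because [0, 1] is mapped
  into itself.\<close>

lemma
  assumes A: "A \<noteq> 0" and ab: "0 < a" "0 < b" and q: "0 \<le> q"
    and k: "a \<le> \<kappa> * (\<bar>A\<bar> * b)" "\<bar>A\<bar> * b \<le> \<kappa> * a"
  shows grid_sum_affine_le: "finite M \<Longrightarrow>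
      (\<Sum>m\<in>M. prob {z. A * z + t \<in> cell a m} powr q) \<le> (2 * \<kappa> + 2) powr (q + 1) * grid_sum \<nu> q b"
    and grid_sum_affine_ge: "(\<And>z. z \<in> {0..1} \<Longrightarrow> A * z + t \<in> {0..1}) \<Longrightarrow>
      grid_sum \<nu> q b \<le> (2 * \<kappa> + 2) powr (q + 1) * (\<Sum>m\<in>grid a. prob {z. A * z + t \<in> cell a m} powr q)"
proof -
  define P where "P m = {z. A * z + t \<in> cell a m}" for m
  have Aab: "0 < \<bar>A\<bar> * b" "0 < \<bar>A\<bar>" using A ab by auto
  have P_borel: "P m \<in> sets borel" for m
    unfolding P_def by measurable
  have Pdiam: "\<bar>x - y\<bar> \<le> a / \<bar>A\<bar>" if "x \<in> P m" "y \<in> P m" for x y m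
  proof -
    have "\<bar>A * (x - y)\<bar> \<le> a"
      using cell_diam[of "A * x + t" a m "A * y + t"] that by (simp add: P_def algebra_simps)
    then have "\<bar>x - y\<bar> * \<bar>A\<bar> \<le> a" by (simp only: abs_mult mult.commute)
    then show ?thesis using Aab(2) by (simp only: pos_le_divide_eq)
  qed
  have r1: "2 * (a / \<bar>A\<bar>) / b + 2 \<le> 2 * \<kappa> + 2" and r2: "2 * (\<bar>A\<bar> * b) / a + 2 \<le> 2 * \<kappa> + 2"
    using k ab Aab by (auto simp: field_simps)
  have c1: "finite {k. cell b k \<inter> P m \<noteq> {}}" "real (card {k. cell b k \<inter> P m \<noteq> {}}) \<le> 2 * \<kappa> + 2" for m
    using cells_meeting[of b "a / \<bar>A\<bar>" "P m"] Pdiam[of _ m] ab Aab r1 by auto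
  have c2: "finite {m. cell b k \<inter> P m \<noteq> {}}" "real (card {m. cell b k \<inter> P m \<noteq> {}}) \<le> 2 * \<kappa> + 2" for k
  proof -
    have eq: "{m. cell b k \<inter> P m \<noteq> {}} = {m. cell a m \<inter> (\<lambda>z. A * z + t) ` cell b k \<noteq> {}}"
      by (auto simp: P_def)
    have d: "\<bar>x - y\<bar> \<le> \<bar>A\<bar> * b" if xy: "x \<in> (\<lambda>z. A * z + t) ` cell b k" "y \<in> (\<lambda>z. A * z + t) ` cell b k" for x y
    proof -
      obtain x' y' where *: "x' \<in> cell b k" "y' \<in> cell b k" "x = A * x' + t" "y = A * y' + t"
        using xy by auto
      have "\<bar>x - y\<bar> = \<bar>A\<bar> * \<bar>x' - y'\<bar>" using * by (simp flip: abs_mult add: algebra_simps)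
      also have "\<dots> \<le> \<bar>A\<bar> * b" using cell_diam[OF *(1,2)] by (intro mult_left_mono) auto
      finally show ?thesis .
    qed
    show "finite {m. cell b k \<inter> P m \<noteq> {}}" "real (card {m. cell b k \<inter> P m \<noteq> {}}) \<le> 2 * \<kappa> + 2"
      unfolding eq using cells_meeting[of a "\<bar>A\<bar> * b" "(\<lambda>z. A * z + t) ` cell b k"] d ab Aab r2 by auto
  qed
  have kp: "0 \<le> 2 * \<kappa> + 2" using c1(2) by (meson of_nat_0_le_iff order_trans)
  have const: "(2 * \<kappa> + 2) powr q * (2 * \<kappa> + 2) = (2 * \<kappa> + 2) powr (q + 1)"
    using kp by (simp add: powr_add)
  show "(\<Sum>m\<in>M. prob {z. A * z + t \<in> cell a m} powr q) \<le> (2 * \<kappa> + 2) powr (q + 1) * grid_sum \<nu> q b"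
    if M: "finite M"
    unfolding grid_sum_def P_def[symmetric] const[symmetric]
  proof (rule powr_sum_overlap[where R = "\<lambda>m k. cell b k \<inter> P m \<noteq> {}"])
    fix m
    show "real (card {k \<in> grid b. cell b k \<inter> P m \<noteq> {}}) \<le> 2 * \<kappa> + 2"
      by (rule order_trans[OF _ c1(2)[of m]]) (use c1(1)[of m] in \<open>auto intro!: card_mono\<close>)
  next
    fix k
    show "real (card {m \<in> M. cell b k \<inter> P m \<noteq> {}}) \<le> 2 * \<kappa> + 2"
      by (rule order_trans[OF _ c2(2)[of k]]) (use c2(1)[of k] in \<open>auto intro!: card_mono\<close>)
  qed (use M finite_grid ab q prob_le_sum_cells in auto)
  show "grid_sum \<nu> q b \<le> (2 * \<kappa> + 2) powr (q + 1) * (\<Sum>m\<in>grid a. prob {z. A * z + t \<in> cell a m} powr q)"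
    if unit: "\<And>z. z \<in> {0..1} \<Longrightarrow> A * z + t \<in> {0..1}"
    unfolding grid_sum_def P_def[symmetric] const[symmetric]
  proof (rule powr_sum_overlap[where R = "\<lambda>k m. cell b k \<inter> P m \<noteq> {}"])
    fix k
    show "real (card {m \<in> grid a. cell b k \<inter> P m \<noteq> {}}) \<le> 2 * \<kappa> + 2"
      by (rule order_trans[OF _ c2(2)[of k]]) (use c2(1)[of k] in \<open>auto intro!: card_mono\<close>)
    show "prob (cell b k) \<le> (\<Sum>m\<in>{m \<in> grid a. cell b k \<inter> P m \<noteq> {}}. prob (P m))"
    proof (rule prob_le_sum_cover)
      fix x assume x: "x \<in> cell b k" "x \<in> {0..1}"
      have "\<lfloor>(A * x + t) / a\<rfloor> \<in> grid a" using floor_mem_grid[OF ab(1)] unit[OF x(2)] by blast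
      moreover have "x \<in> P \<lfloor>(A * x + t) / a\<rfloor>"
        unfolding P_def using mem_cell_floor[OF ab(1)] by blast
      ultimately show "\<exists>m\<in>{m \<in> grid a. cell b k \<inter> P m \<noteq> {}}. x \<in> P m" using x by blast
    qed (use P_borel finite_grid ab in auto)
  next
    fix m
    show "real (card {k \<in> grid b. cell b k \<inter> P m \<noteq> {}}) \<le> 2 * \<kappa> + 2"
      by (rule order_trans[OF _ c1(2)[of m]]) (use c1(1)[of m] in \<open>auto intro!: card_mono\<close>)
  qed (use finite_grid ab q in auto)
qed

lemma grid_sum_mesh:
  assumes "0 < a" "0 < b" "0 \<le> q" "a \<le> \<kappa> * b" "b \<le> \<kappa> * a"
  shows "grid_sum \<nu> q a \<le> (2 * \<kappa> + 2) powr (q + 1) * grid_sum \<nu> q b"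
  using grid_sum_affine_le[of 1 a b q \<kappa> "grid a" 0] finite_grid[of a] assms
  by (simp add: grid_sum_def)

text \<open>The cell with both its neighbours. It contains every ball of radius \<open>a\<close>
  centred in the cell.\<close>

definition wide_cell :: "real \<Rightarrow> int \<Rightarrow> real set" where
  "wide_cell a m = {a * of_int m - a .. a * of_int m + 2 * a}"

lemma cell_subset_wide: "0 < a \<Longrightarrow> cell a m \<subseteq> wide_cell a m"
  by (auto simp: cell_def wide_cell_def algebra_simps)

lemma grid_sum_wide:
  assumes a: "0 < a" and q: "0 \<le> q"
  shows "(\<Sum>m\<in>grid a. prob (wide_cell a m) powr q) \<le> 5 powr q * 5 * grid_sum \<nu> q a"
  unfolding grid_sum_def
\<comment> \<open>A wide cell reaches the indices m - 1 to m + 2; the symmetric window of five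
  indices counts alike from both sides.\<close>
proof (rule powr_sum_overlap[where R = "\<lambda>m k. \<bar>m - k\<bar> \<le> 2"])
  fix m :: int
  show "real (card {k \<in> grid a. \<bar>m - k\<bar> \<le> 2}) \<le> 5" "real (card {k \<in> grid a. \<bar>k - m\<bar> \<le> 2}) \<le> 5"
    by (rule card_int_near_le)+
  show "prob (wide_cell a m) \<le> (\<Sum>k\<in>{k \<in> grid a. \<bar>m - k\<bar> \<le> 2}. prob (cell a k))"
  proof (rule prob_le_sum_cover)
    fix x assume x: "x \<in> wide_cell a m" "x \<in> {0..1}"
    have "x / a \<le> of_int m + 2" "of_int m - 1 \<le> x / a"
      using x(1) a by (auto simp: wide_cell_def field_simps)
    then have "\<bar>m - \<lfloor>x / a\<rfloor>\<bar> \<le> 2" by linarith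
    then show "\<exists>k\<in>{k \<in> grid a. \<bar>m - k\<bar> \<le> 2}. x \<in> cell a k"
      using floor_mem_grid[OF a x(2)] mem_cell_floor[OF a, of x] by blast
  qed (use finite_grid a in auto)
qed (use finite_grid a q in auto)

text \<open>The integral whose logarithm, divided by -ln \<delta>, has \<open>moment_scaling\<close>
  as its limit.\<close>

definition ball_moment :: "real \<Rightarrow> real \<Rightarrow> real" where
  "ball_moment q \<delta> = (LINT x:measure_support \<nu>|\<nu>. prob (cball x \<delta>) powr (q - 1))"

text \<open>On the line the mass of a ball is a difference of two monotone functions of its centre.
  The Bochner integral in \<open>ball_moment\<close> would be 0 by convention for an integrand that
  is not measurable.\<close>

lemma borel_measurable_prob_cball:
  assumes "0 \<le> \<delta>"
  shows "(\<lambda>x. prob (cball x \<delta>)) \<in> borel_measurable borel"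
proof -
  have eq: "prob (cball x \<delta>) = prob {..x + \<delta>} - prob {..<x - \<delta>}" for x
  proof -
    have eq: "cball x \<delta> = {..x + \<delta>} - {..<x - \<delta>}" by (auto simp: cball_def dist_real_def)
    show ?thesis unfolding eq by (rule finite_measure_Diff) (use assms sets_eq in auto)
  qed
  have "mono (\<lambda>x. prob {..x + \<delta>})" "mono (\<lambda>x. prob {..<x - \<delta>})"
    by (rule monoI, rule finite_measure_mono; simp add: sets_eq subset_eq)+
  then have "(\<lambda>x. prob {..x + \<delta>}) \<in> borel_measurable borel"
    "(\<lambda>x. prob {..<x - \<delta>}) \<in> borel_measurable borel"
    using borel_measurable_mono by blast+
  then have "(\<lambda>x. prob {..x + \<delta>} - prob {..<x - \<delta>}) \<in> borel_measurable borel"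
    by (rule borel_measurable_diff)
  then show ?thesis by (simp only: eq)
qed

text \<open>The integrand is squeezed between step functions on the cells. Bounds are asked only on
  cells of positive mass, which contain almost every point: for q < 1 the natural upper bound
  \<open>prob (cell \<delta> m) powr (q - 1)\<close> is 0 at a null cell. The factor 2 counts the
  closed cells through one point.\<close>

lemma
  assumes d: "0 < \<delta>" and nn: "\<And>m. 0 \<le> u m" "\<And>m. 0 \<le> l m"
    and lu: "\<And>m x. m \<in> grid \<delta> \<Longrightarrow> 0 < prob (cell \<delta> m) \<Longrightarrow> x \<in> cell \<delta> m \<Longrightarrow>
      l m \<le> prob (cball x \<delta>) powr (q - 1) \<and> prob (cball x \<delta>) powr (q - 1) \<le> u m"
  shows ball_moment_le: "ball_moment q \<delta> \<le> (\<Sum>m\<in>grid \<delta>. u m * prob (cell \<delta> m))"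
    and ball_moment_ge: "(\<Sum>m\<in>grid \<delta>. l m * prob (cell \<delta> m)) \<le> 2 * ball_moment q \<delta>"
proof -
  define f where "f x = indicat_real (measure_support \<nu>) x * prob (cball x \<delta>) powr (q - 1)" for x
  define h where "h v x = (\<Sum>m\<in>grid \<delta>. v m * indicat_real (cell \<delta> m) x)" for v x
  have bm: "ball_moment q \<delta> = (LINT x|\<nu>. f x)"
    unfolding ball_moment_def set_lebesgue_integral_def f_def by simp
  have supp: "measure_support \<nu> \<in> sets borel" using closed_measure_support by (rule borel_closed)
  have fm: "f \<in> borel_measurable \<nu>"
  proof -
    have "f \<in> borel_measurable borel"
      unfolding f_def using powr_real_measurable[OF borel_measurable_prob_cball[of \<delta>] borel_measurable_const] borel_measurable_indicator[OF supp] d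
      by (intro borel_measurable_times) simp_all
    then show ?thesis by (simp add: measurable_cong_sets[OF sets_eq refl])
  qed
  have hi: "integrable \<nu> (h v)" for v
    unfolding h_def using sets_eq by (intro Bochner_Integration.integrable_sum integrable_mult_right) (auto simp: less_top[symmetric])
  have hint: "(LINT x|\<nu>. h v x) = (\<Sum>m\<in>grid \<delta>. v m * prob (cell \<delta> m))" for v
    unfolding h_def using sets_eq space_eq
    by (subst Bochner_Integration.integral_sum) (auto simp: less_top[symmetric] intro!: sum.cong integrable_mult_right)
  have "AE x in \<nu>. \<forall>m\<in>grid \<delta>. x \<in> cell \<delta> m \<longrightarrow> 0 < prob (cell \<delta> m)"
  proof (rule AE_finite_allI)
    fix m assume "m \<in> grid \<delta>"
    show "AE x in \<nu>. x \<in> cell \<delta> m \<longrightarrow> 0 < prob (cell \<delta> m)"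
    proof (cases "prob (cell \<delta> m) = 0")
      case True
      then have "AE x in \<nu>. x \<notin> cell \<delta> m" using prob_eq_0[of "cell \<delta> m"] sets_eq by simp
      then show ?thesis by eventually_elim auto
    next
      case False
      then have "0 < prob (cell \<delta> m)" by (simp add: zero_less_measure_iff)
      then show ?thesis by simp
    qed
  qed (use finite_grid d in auto)
  then have AE: "AE x in \<nu>. h l x \<le> 2 * f x \<and> f x \<le> h u x"
    using AE_unit AE_measure_support[OF sets_eq]
  proof eventually_elim
    case (elim x)
    have fx: "f x = prob (cball x \<delta>) powr (q - 1)" using elim by (simp add: f_def)
    have "h l x = (\<Sum>m\<in>{m\<in>grid \<delta>. x \<in> cell \<delta> m}. l m)"
      unfolding h_def by (subst sum.inter_filter[OF finite_grid[OF d]]) (auto simp: indicator_def intro: sum.cong)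
    also have "\<dots> \<le> (\<Sum>m\<in>{m\<in>grid \<delta>. x \<in> cell \<delta> m}. f x)"
      unfolding fx using lu elim by (intro sum_mono) auto
    also have "\<dots> = real (card {m\<in>grid \<delta>. x \<in> cell \<delta> m}) * f x" by simp
    also have "\<dots> \<le> 2 * f x"
    proof (rule mult_right_mono)
      have "card {m\<in>grid \<delta>. x \<in> cell \<delta> m} \<le> card {m. cell \<delta> m \<inter> {x} \<noteq> {}}"
        using cells_meeting(1)[of \<delta> 0 "{x}"] d by (intro card_mono) auto
      then show "real (card {m\<in>grid \<delta>. x \<in> cell \<delta> m}) \<le> 2"
        using cells_meeting(2)[of \<delta> 0 "{x}"] d by simp
    qed (simp add: fx)
    finally have 1: "h l x \<le> 2 * f x" .
    define m where "m = \<lfloor>x / \<delta>\<rfloor>"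
    have m: "m \<in> grid \<delta>" "x \<in> cell \<delta> m"
      using floor_mem_grid[OF d] mem_cell_floor[OF d] elim by (auto simp: m_def)
    have "f x \<le> u m * indicat_real (cell \<delta> m) x" unfolding fx using lu[of m x] m elim by simp
    also have "\<dots> \<le> h u x" unfolding h_def
      using m finite_grid[OF d] nn by (intro member_le_sum) auto
    finally show ?case using 1 by simp
  qed
  have fi: "integrable \<nu> f"
  proof (rule Bochner_Integration.integrable_bound[OF hi fm])
    show "AE x in \<nu>. norm (f x) \<le> norm (h u x)"
      using AE by eventually_elim (auto simp: f_def)
  qed
  show "ball_moment q \<delta> \<le> (\<Sum>m\<in>grid \<delta>. u m * prob (cell \<delta> m))"
    unfolding bm hint[symmetric] using AE by (intro integral_mono_AE fi hi) auto
  have "(LINT x|\<nu>. h l x) \<le> (LINT x|\<nu>. 2 * f x)"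
    using AE by (intro integral_mono_AE hi integrable_mult_right fi) auto
  then show "(\<Sum>m\<in>grid \<delta>. l m * prob (cell \<delta> m)) \<le> 2 * ball_moment q \<delta>"
    unfolding bm hint[symmetric] by simp
qed

lemma prob_cball_bounds:
  assumes "0 < \<delta>" "x \<in> cell \<delta> m"
  shows "prob (cell \<delta> m) \<le> prob (cball x \<delta>)" "prob (cball x \<delta>) \<le> prob (wide_cell \<delta> m)"
    "prob (cell \<delta> m) \<le> prob (wide_cell \<delta> m)"
proof -
  have "cell \<delta> m \<subseteq> cball x \<delta>" "cball x \<delta> \<subseteq> wide_cell \<delta> m"
    using assms by (auto simp: cell_def wide_cell_def cball_def dist_real_def algebra_simps abs_le_iff)
  then show "prob (cell \<delta> m) \<le> prob (cball x \<delta>)" "prob (cball x \<delta>) \<le> prob (wide_cell \<delta> m)"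
    using sets_eq by (auto intro!: finite_measure_mono simp: wide_cell_def)
  then show "prob (cell \<delta> m) \<le> prob (wide_cell \<delta> m)" by simp
qed

text \<open>For q at least 1 the integrand grows with the mass of the ball, which lies between those
  of the cell and of the wide cell.\<close>

lemma
  assumes "0 < \<delta>" "1 \<le> q"
  shows grid_sum_le_ball_moment: "grid_sum \<nu> q \<delta> \<le> 2 * ball_moment q \<delta>"
    and ball_moment_le_grid_sum: "ball_moment q \<delta> \<le> 5 powr q * 5 * grid_sum \<nu> q \<delta>"
proof -
  define l where "l m = prob (cell \<delta> m) powr (q - 1)" for m
  define u where "u m = prob (wide_cell \<delta> m) powr (q - 1)" for m
  have lu: "l m \<le> prob (cball x \<delta>) powr (q - 1) \<and> prob (cball x \<delta>) powr (q - 1) \<le> u m"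
    if "x \<in> cell \<delta> m" for m x
    unfolding l_def u_def using prob_cball_bounds[OF assms(1) that] assms by (auto intro!: powr_mono2)
  have "grid_sum \<nu> q \<delta> = (\<Sum>m\<in>grid \<delta>. l m * prob (cell \<delta> m))"
    unfolding l_def grid_sum_def by (simp add: powr_diff_one_mult)
  also have "\<dots> \<le> 2 * ball_moment q \<delta>"
    using lu by (intro ball_moment_ge[where u = u] assms) (auto simp: l_def u_def)
  finally show "grid_sum \<nu> q \<delta> \<le> 2 * ball_moment q \<delta>" .
  have "ball_moment q \<delta> \<le> (\<Sum>m\<in>grid \<delta>. u m * prob (cell \<delta> m))"
    using lu by (intro ball_moment_le[where l = l] assms) (auto simp: l_def u_def)
  also have "\<dots> \<le> (\<Sum>m\<in>grid \<delta>. u m * prob (wide_cell \<delta> m))"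
    using assms cell_subset_wide[of \<delta>] sets_eq
    by (intro sum_mono mult_left_mono finite_measure_mono) (auto simp: u_def wide_cell_def)
  also have "\<dots> = (\<Sum>m\<in>grid \<delta>. prob (wide_cell \<delta> m) powr q)"
    unfolding u_def by (simp add: powr_diff_one_mult)
  also have "\<dots> \<le> 5 powr q * 5 * grid_sum \<nu> q \<delta>"
    using assms by (intro grid_sum_wide) auto
  finally show "ball_moment q \<delta> \<le> 5 powr q * 5 * grid_sum \<nu> q \<delta>" .
qed

text \<open>For q < 1 the power decreases, so cell and wide cell exchange roles. The lower bound
  mixes both masses and is not yet a grid sum.\<close>

lemma
  assumes "0 < \<delta>" "q < 1"
  shows ball_moment_le_grid_sum': "ball_moment q \<delta> \<le> grid_sum \<nu> q \<delta>"
    and sum_wide_le_ball_moment: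
      "(\<Sum>m\<in>grid \<delta>. prob (wide_cell \<delta> m) powr (q - 1) * prob (cell \<delta> m)) \<le> 2 * ball_moment q \<delta>"
proof -
  define u where "u m = prob (cell \<delta> m) powr (q - 1)" for m
  define l where "l m = prob (wide_cell \<delta> m) powr (q - 1)" for m
  have lu: "l m \<le> prob (cball x \<delta>) powr (q - 1) \<and> prob (cball x \<delta>) powr (q - 1) \<le> u m"
    if "x \<in> cell \<delta> m" "0 < prob (cell \<delta> m)" for m x
    unfolding l_def u_def using prob_cball_bounds[OF assms(1) that(1)] assms that
    by (auto intro!: powr_mono2')
  have "ball_moment q \<delta> \<le> (\<Sum>m\<in>grid \<delta>. u m * prob (cell \<delta> m))"
    using lu by (intro ball_moment_le[where l = l] assms) (auto simp: l_def u_def)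
  also have "\<dots> = grid_sum \<nu> q \<delta>" unfolding u_def grid_sum_def by (simp add: powr_diff_one_mult)
  finally show "ball_moment q \<delta> \<le> grid_sum \<nu> q \<delta>" .
  show "(\<Sum>m\<in>grid \<delta>. prob (wide_cell \<delta> m) powr (q - 1) * prob (cell \<delta> m)) \<le> 2 * ball_moment q \<delta>"
    unfolding l_def[symmetric] using lu
    by (intro ball_moment_ge[where u = u] assms) (auto simp: l_def u_def)
qed

text \<open>Cells whose mass is much smaller than that of their neighbourhood contribute at most half of
  the grid sum, and on the remaining cells the two integrands are comparable. For \<open>q = 0\<close> the
  comparison with \<open>grid_sum \<nu> 0\<close> itself fails for general measures, hence the second exponent.\<close>

lemma grid_sum_le_ball_moment':
  assumes q: "0 \<le> q" "q < 1" and q': "q \<le> q'" "0 < q'"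
  shows "\<exists>C>0. \<forall>\<delta>>0. grid_sum \<nu> q' \<delta> \<le> C * ball_moment q \<delta>"
proof -
  \<comment> \<open>c is chosen so that c times the bound for wide cells is half the grid sum;
    \<theta> is the ratio of masses below which a cell counts as light.\<close>
  define c where "c = 1 / (2 * (5 powr q' * 5)) "
  define \<theta> where "\<theta> = c powr (1 / q')"
  have c: "0 < c" by (simp add: c_def)
  have l: "0 < \<theta>" "\<theta> powr q' = c" using c q' by (auto simp: \<theta>_def powr_powr)
  have "grid_sum \<nu> q' \<delta> \<le> 4 / \<theta> * ball_moment q \<delta>" if d: "0 < \<delta>" for \<delta>
  proof -
    define w W where "w m = prob (cell \<delta> m)" and "W m = prob (wide_cell \<delta> m)" for m
    define G where "G = {m\<in>grid \<delta>. \<theta> * W m \<le> w m}"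
    have fin: "finite (grid \<delta>)" using d by (rule finite_grid)
    have wW: "0 \<le> w m" "w m \<le> W m" "W m \<le> 1" for m
      unfolding w_def W_def using cell_subset_wide[OF d] sets_eq
      by (auto intro!: finite_measure_mono simp: wide_cell_def)
    have "(\<Sum>m\<in>grid \<delta> - G. w m powr q') \<le> (\<Sum>m\<in>grid \<delta> - G. c * W m powr q')"
    proof (rule sum_mono)
      fix m assume "m \<in> grid \<delta> - G"
      then have "w m powr q' \<le> (\<theta> * W m) powr q'"
        using wW[of m] q' by (intro powr_mono2) (auto simp: G_def)
      then show "w m powr q' \<le> c * W m powr q'"
        using l wW[of m] by (simp add: powr_mult)
    qed
    also have "\<dots> \<le> c * (\<Sum>m\<in>grid \<delta>. W m powr q')"
      unfolding sum_distrib_left using fin c by (intro sum_mono2) auto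
    also have "\<dots> \<le> c * (5 powr q' * 5 * grid_sum \<nu> q' \<delta>)"
      unfolding W_def using d q' c by (intro mult_left_mono grid_sum_wide) auto
    also have "\<dots> = grid_sum \<nu> q' \<delta> / 2" by (simp add: c_def)
    finally have bad: "(\<Sum>m\<in>grid \<delta> - G. w m powr q') \<le> grid_sum \<nu> q' \<delta> / 2" .
    have "grid_sum \<nu> q' \<delta> = (\<Sum>m\<in>grid \<delta> - G. w m powr q') + (\<Sum>m\<in>G. w m powr q')"
      unfolding grid_sum_def w_def[symmetric] using fin by (intro sum.subset_diff) (auto simp: G_def)
    with bad have "grid_sum \<nu> q' \<delta> \<le> 2 * (\<Sum>m\<in>G. w m powr q')" by simp
    also have "\<dots> \<le> 2 * (\<Sum>m\<in>G. 1 / \<theta> * (W m powr (q - 1) * w m))"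
    proof (intro mult_left_mono sum_mono)
      fix m assume m: "m \<in> G"
      show "w m powr q' \<le> 1 / \<theta> * (W m powr (q - 1) * w m)"
      proof (cases "w m = 0")
        case False
        then have pos: "0 < w m" "0 < W m" using wW[of m] by auto
        have "w m powr q' \<le> W m powr q'" using wW[of m] q' by (intro powr_mono2) auto
        also have "\<dots> \<le> W m powr q" using wW[of m] pos q' by (intro powr_mono') auto
        also have "\<dots> = W m powr (q - 1) * W m"
          using pos by (simp add: powr_diff_one_mult)
        also have "\<dots> \<le> W m powr (q - 1) * (w m / \<theta>)"
          using m l by (intro mult_left_mono) (auto simp: G_def field_simps)
        finally show ?thesis by simp
      qed simp
    qed auto
    also have "\<dots> = 2 / \<theta> * (\<Sum>m\<in>G. W m powr (q - 1) * w m)"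
      by (simp flip: sum_divide_distrib)
    also have "\<dots> \<le> 2 / \<theta> * (\<Sum>m\<in>grid \<delta>. W m powr (q - 1) * w m)"
      using l fin wW by (intro mult_left_mono sum_mono2) (auto simp: G_def)
    also have "\<dots> \<le> 2 / \<theta> * (2 * ball_moment q \<delta>)"
      unfolding W_def w_def using l d q by (intro mult_left_mono sum_wide_le_ball_moment) auto
    finally show ?thesis by simp
  qed
  then show ?thesis using l by (intro exI[of _ "4 / \<theta>"]) auto
qed

end

section \<open>Coordinates and cylinders of a box-like system\<close>

text \<open>Indexing by \<open>bool\<close>, with True for the first axis, lets a map that exchanges
  the axes read coordinate \<open>j \<noteq> s\<close>: exclusive or in place of case
  distinctions.\<close>

definition coord :: "bool \<Rightarrow> 'a \<times> 'a \<Rightarrow> 'a" where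
  "coord j z = (if j then fst z else snd z)"

lemma coord_simps [simp]: "coord True z = fst z" "coord False z = snd z"
  by (simp_all add: coord_def)

lemma prod_eq_coord_iff: "z = w \<longleftrightarrow> (\<forall>j. coord j z = coord j w)"
  by (simp add: coord_def prod_eq_iff all_bool_eq)

lemma mem_Times_coord_iff: "z \<in> X \<times> X \<longleftrightarrow> (\<forall>j. coord j z \<in> X)"
  by (simp add: coord_def mem_Times_iff all_bool_eq)

lemma continuous_on_coord [continuous_intros]: "continuous_on X (coord j)"
  unfolding coord_def by (cases j) (simp_all add: continuous_on_fst continuous_on_snd)

lemma borel_measurable_coord [measurable]:
  "coord j \<in> borel_measurable (borel :: (real \<times> real) measure)"
  by (rule borel_measurable_continuous_onI[OF continuous_on_coord])

text \<open>The corners (1, 1) and (1, -1) have squared norm 2 and are sent into the square, so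
  their images have coordinates 1 or -1. Hence L is a signed permutation of the axes, and
  \<open>s\<close> records whether it exchanges them.\<close>

lemma box_like_map_coord:
  assumes "box_like_map f"
  shows "\<exists>s a t. (\<forall>j z. coord j (f z) = a j * coord (j \<noteq> s) z + t j) \<and> (\<forall>j. 0 < \<bar>a j\<bar> \<and> \<bar>a j\<bar> < 1)"
proof -
  obtain c d L t where cd: "0 < c" "c < 1" "0 < d" "d < 1" and L: "orthogonal_transformation L"
    and sq: "L ` ({-1..1} \<times> {-1..1}) = {-1..1} \<times> {-1..1}"
    and f: "f = (\<lambda>x. (c * fst (L x), d * snd (L x)) + t)"
    using assms unfolding box_like_map_def by blast
  have lin: "linear L" using L by (simp add: orthogonal_transformation_def)
  obtain e1 e2 where e: "L (1, 0) = (e1, e2)" by (cases "L (1, 0)")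
  obtain g1 g2 where g: "L (0, 1) = (g1, g2)" by (cases "L (0, 1)")
  have Lxy: "L (x, y) = (x * e1 + y * g1, x * e2 + y * g2)" for x y
  proof -
    have "(x, y) = x *\<^sub>R (1, 0) + y *\<^sub>R (0, 1 :: real)" by simp
    then have "L (x, y) = x *\<^sub>R L (1, 0) + y *\<^sub>R L (0, 1)"
      by (simp only: linear_add[OF lin] linear_scale[OF lin])
    then show ?thesis by (simp add: e g)
  qed
  have nrm: "(fst (L z))\<^sup>2 + (snd (L z))\<^sup>2 = (fst z)\<^sup>2 + (snd z)\<^sup>2" for z
  proof -
    have "norm (L z) = norm z" using L unfolding orthogonal_transformation by blast
    then show ?thesis by (simp add: norm_prod_def)
  qed
  have "L (1, 1) \<in> L ` ({-1..1} \<times> {-1..1})" "L (1, -1) \<in> L ` ({-1..1} \<times> {-1..1})"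
    by (rule imageI; simp)+
  then have "\<bar>e1 + g1\<bar> \<le> 1" "\<bar>e2 + g2\<bar> \<le> 1" "\<bar>e1 - g1\<bar> \<le> 1" "\<bar>e2 - g2\<bar> \<le> 1"
    unfolding sq by (auto simp: Lxy)
  then have sq_le: "(e1 + g1)\<^sup>2 \<le> 1" "(e2 + g2)\<^sup>2 \<le> 1" "(e1 - g1)\<^sup>2 \<le> 1" "(e2 - g2)\<^sup>2 \<le> 1"
    by (simp_all add: abs_square_le_1)
  have "(e1 + g1)\<^sup>2 + (e2 + g2)\<^sup>2 = 2" "(e1 - g1)\<^sup>2 + (e2 - g2)\<^sup>2 = 2"
    using nrm[of "(1, 1)"] nrm[of "(1, -1)"] by (simp_all add: Lxy)
  then have eqs: "(e1 + g1)\<^sup>2 = 1" "(e2 + g2)\<^sup>2 = 1" "(e1 - g1)\<^sup>2 = 1" "(e2 - g2)\<^sup>2 = 1"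
    using sq_le by auto
  \<comment> \<open>Polarisation: equal squares of sum and difference force e1 or g1, and e2 or g2,
    to vanish.\<close>
  have "(x + y)\<^sup>2 - (x - y)\<^sup>2 = 4 * (x * y)" for x y :: real
    by (simp add: power2_eq_square algebra_simps)
  from this[of e1 g1] this[of e2 g2] eqs have z: "e1 * g1 = 0" "e2 * g2 = 0"
    by auto
  have ee: "e1\<^sup>2 + e2\<^sup>2 = 1" using nrm[of "(1, 0)"] by (simp add: e)
  show ?thesis
  proof (cases "g1 = 0")
    case True
    then have "\<bar>e1\<bar> = 1" using eqs(1) by (simp add: abs_square_eq_1)
    then have "e1\<^sup>2 = 1" by (simp add: abs_square_eq_1)
    then have "e2 = 0" using ee by simp
    then have "\<bar>g2\<bar> = 1" using eqs(2) by (simp add: abs_square_eq_1)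
    show ?thesis
    proof (rule exI[of _ False], rule exI[of _ "\<lambda>j. if j then c * e1 else d * g2"], rule exI[of _ "\<lambda>j. coord j t"],
        intro conjI allI)
      fix j z
      show "coord j (f z) = (if j then c * e1 else d * g2) * coord (j \<noteq> False) z + coord j t"
        using True \<open>e2 = 0\<close> by (cases z) (auto simp: f Lxy coord_def)
    next
      fix j
      show "0 < \<bar>if j then c * e1 else d * g2\<bar>" "\<bar>if j then c * e1 else d * g2\<bar> < 1"
        using cd \<open>\<bar>e1\<bar> = 1\<close> \<open>\<bar>g2\<bar> = 1\<close> by (auto simp: abs_mult)
    qed
  next
    case False
    then have "e1 = 0" using z by simp
    then have "\<bar>g1\<bar> = 1" "\<bar>e2\<bar> = 1" using eqs(1) ee by (simp_all add: abs_square_eq_1)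
    then have "g2 = 0" using z by auto
    show ?thesis
    proof (rule exI[of _ True], rule exI[of _ "\<lambda>j. if j then c * g1 else d * e2"], rule exI[of _ "\<lambda>j. coord j t"],
        intro conjI allI)
      fix j z
      show "coord j (f z) = (if j then c * g1 else d * e2) * coord (j \<noteq> True) z + coord j t"
        using \<open>e1 = 0\<close> \<open>g2 = 0\<close> by (cases z) (auto simp: f Lxy coord_def)
    next
      fix j
      show "0 < \<bar>if j then c * g1 else d * e2\<bar>" "\<bar>if j then c * g1 else d * e2\<bar> < 1"
        using cd \<open>\<bar>g1\<bar> = 1\<close> \<open>\<bar>e2\<bar> = 1\<close> by (auto simp: abs_mult)
    qed
  qed
qed

section \<open>Stopping the tree of words\<close>

definition proper_prefixes_avoid :: "('i list \<Rightarrow> bool) \<Rightarrow> 'i list \<Rightarrow> bool" where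
  "proper_prefixes_avoid P w \<longleftrightarrow> (\<forall>u v. w = u @ v \<and> v \<noteq> [] \<longrightarrow> \<not> P u)"

text \<open>The words at which P holds for the first time along their prefixes: a stopping line. Its
  words are incomparable as prefixes, and if every branch stops they carry the whole mass.\<close>

definition cut_set :: "'i set \<Rightarrow> ('i list \<Rightarrow> bool) \<Rightarrow> 'i list set" where
  "cut_set I P = {w. set w \<subseteq> I \<and> proper_prefixes_avoid P w \<and> P w}"

lemma proper_prefixes_avoid_Nil [simp]: "proper_prefixes_avoid P []"
  by (simp add: proper_prefixes_avoid_def)

lemma proper_prefixes_avoid_snoc [simp]:
  "proper_prefixes_avoid P (w @ [i]) \<longleftrightarrow> proper_prefixes_avoid P w \<and> \<not> P w"
proof
  assume "proper_prefixes_avoid P (w @ [i])"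
  then have *: "\<And>u v. w @ [i] = u @ v \<Longrightarrow> v \<noteq> [] \<Longrightarrow> \<not> P u"
    by (simp add: proper_prefixes_avoid_def)
  have "\<not> P u" if "w = u @ v" for u v using *[of u "v @ [i]"] that by simp
  then show "proper_prefixes_avoid P w \<and> \<not> P w"
    by (auto simp: proper_prefixes_avoid_def)
next
  assume *: "proper_prefixes_avoid P w \<and> \<not> P w"
  show "proper_prefixes_avoid P (w @ [i])"
    unfolding proper_prefixes_avoid_def
  proof (intro allI impI)
    fix u v assume uv: "w @ [i] = u @ v \<and> v \<noteq> []"
    then obtain v' x where "v = v' @ [x]" by (metis rev_exhaust)
    then have "w = u @ v'" using uv by simp
    then show "\<not> P u" using * by (cases "v' = []") (auto simp: proper_prefixes_avoid_def)
  qed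
qed

lemma cut_set_not_prefix:
  assumes "u \<in> cut_set I P" "u @ v \<in> cut_set I P"
  shows "v = []"
  using assms unfolding cut_set_def proper_prefixes_avoid_def by blast

text \<open>A function that splits over children keeps its total along the stopping line. Invariant
  in \<open>step\<close>: the value at the root is the sum over words stopped before level k plus
  that over words reaching level k unstopped. The bound n on the depth empties the second
  part.\<close>

lemma
  assumes I: "finite I" and n: "\<And>w. set w \<subseteq> I \<Longrightarrow> length w = n \<Longrightarrow> P w"
  shows finite_cut_set: "finite (cut_set I P)"
    and sum_cut_set: "(\<And>u. set u \<subseteq> I \<Longrightarrow> h u = (\<Sum>i\<in>I. h (u @ [i]) :: real)) \<Longrightarrow> h [] = (\<Sum>w\<in>cut_set I P. h w)"
proof -
  define U where "U k = {w. set w \<subseteq> I \<and> length w = k \<and> proper_prefixes_avoid P w}" for k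
  have finU: "finite (U k)" for k
    by (rule finite_subset[OF _ finite_lists_length_eq[OF I, of k]]) (auto simp: U_def)
  have short: "length w \<le> n" if "set w \<subseteq> I" "proper_prefixes_avoid P w" for w
  proof (rule ccontr)
    assume "\<not> length w \<le> n"
    then have "length (take n w) = n" "drop n w \<noteq> []" by auto
    moreover have "set (take n w) \<subseteq> I" using that set_take_subset[of n w] by blast
    ultimately have "P (take n w)" "w = take n w @ drop n w" "drop n w \<noteq> []" using n by auto
    then show False using that(2) unfolding proper_prefixes_avoid_def by blast
  qed
  have "cut_set I P \<subseteq> {w. set w \<subseteq> I \<and> length w \<le> n}"
    using short by (auto simp: cut_set_def)
  then show fin: "finite (cut_set I P)"
    using finite_lists_length_le[OF I, of n] finite_subset by blast
  assume h: "\<And>u. set u \<subseteq> I \<Longrightarrow> h u = (\<Sum>i\<in>I. h (u @ [i]))"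
  have step: "h [] = (\<Sum>w\<in>{w\<in>cut_set I P. length w < k}. h w) + (\<Sum>w\<in>U k. h w)" for k
  proof (induction k)
    case 0
    have "U 0 = {[]}" by (auto simp: U_def)
    then show ?case by simp
  next
    case (Suc k)
    have img: "U (Suc k) = (\<lambda>(w, i). w @ [i]) ` ({w\<in>U k. \<not> P w} \<times> I)"
    proof (intro equalityI subsetI)
      fix x assume x: "x \<in> U (Suc k)"
      then obtain w i where "x = w @ [i]" by (cases x rule: rev_cases) (auto simp: U_def)
      then show "x \<in> (\<lambda>(w, i). w @ [i]) ` ({w\<in>U k. \<not> P w} \<times> I)"
        using x by (auto simp: U_def intro!: image_eqI[of _ _ "(w, i)"])
    qed (auto simp: U_def)
    have "(\<Sum>w\<in>U (Suc k). h w) = (\<Sum>(w, i)\<in>{w\<in>U k. \<not> P w} \<times> I. h (w @ [i]))"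
      unfolding img by (subst sum.reindex) (auto simp: inj_on_def intro!: sum.cong)
    also have "\<dots> = (\<Sum>w\<in>{w\<in>U k. \<not> P w}. \<Sum>i\<in>I. h (w @ [i]))"
      by (simp add: sum.cartesian_product)
    also have "\<dots> = (\<Sum>w\<in>{w\<in>U k. \<not> P w}. h w)"
      by (intro sum.cong refl h[symmetric]) (auto simp: U_def)
    finally have 1: "(\<Sum>w\<in>U (Suc k). h w) = (\<Sum>w\<in>{w\<in>U k. \<not> P w}. h w)" .
    have "(\<Sum>w\<in>U k. h w) = (\<Sum>w\<in>{w\<in>U k. P w}. h w) + (\<Sum>w\<in>{w\<in>U k. \<not> P w}. h w)"
      using finU by (subst sum.union_disjoint[symmetric]) (auto intro!: sum.cong)
    moreover have "(\<Sum>w\<in>{w\<in>cut_set I P. length w < Suc k}. h w)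
        = (\<Sum>w\<in>{w\<in>cut_set I P. length w < k}. h w) + (\<Sum>w\<in>{w\<in>U k. P w}. h w)"
    proof -
      have "finite {w\<in>cut_set I P. length w < k}" "finite {w\<in>U k. P w}"
        using fin finU by auto
      moreover have "{w\<in>cut_set I P. length w < Suc k} = {w\<in>cut_set I P. length w < k} \<union> {w\<in>U k. P w}"
        "{w\<in>cut_set I P. length w < k} \<inter> {w\<in>U k. P w} = {}"
        by (auto simp: U_def cut_set_def less_Suc_eq)
      ultimately show ?thesis by (simp add: sum.union_disjoint)
    qed
    ultimately show ?case using Suc 1 by simp
  qed
  have "U (Suc n) = {}" using short by (force simp: U_def)
  moreover have "{w\<in>cut_set I P. length w < Suc n} = cut_set I P"
    using short by (auto simp: cut_set_def less_Suc_eq_le)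
  ultimately show "h [] = (\<Sum>w\<in>cut_set I P. h w)" using step[of "Suc n"] by simp
qed

section \<open>Composition along words\<close>

lemma word_map_append: "word_map S (u @ v) = word_map S u \<circ> word_map S v"
proof (induction u)
  case (Cons i u)
  then show ?case by (simp add: word_map_def comp_assoc)
qed (simp add: word_map_def)

lemma word_map_simps [simp]:
  "word_map S [] = id" "word_map S (i # w) = S i \<circ> word_map S w"
  by (simp_all add: word_map_def)

lemma word_prob_simps [simp]:
  "word_prob p [] = 1" "word_prob p (i # w) = p i * word_prob p w"
  "word_prob p (u @ v) = word_prob p u * word_prob p v"
  by (simp_all add: word_prob_def)

text \<open>The system in coordinates: \<open>sw i\<close> tells whether \<open>S i\<close>
  exchanges the axes, and \<open>A i j\<close>, \<open>t i j\<close> are the signed ratio and the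
  shift in output coordinate j.\<close>

locale coordinate_ifs =
  fixes I :: "'i set" and S :: "'i \<Rightarrow> real \<times> real \<Rightarrow> real \<times> real" and p :: "'i \<Rightarrow> real"
    and \<mu> :: "(real \<times> real) measure"
    and sw :: "'i \<Rightarrow> bool" and A t :: "'i \<Rightarrow> bool \<Rightarrow> real"
  assumes measure: "box_like_measure I S p \<mu>"
    and coord_S: "\<And>i j z. i \<in> I \<Longrightarrow> coord j (S i z) = A i j * coord (j \<noteq> sw i) z + t i j"
    and A_bounds: "\<And>i j. i \<in> I \<Longrightarrow> 0 < \<bar>A i j\<bar> \<and> \<bar>A i j\<bar> < 1"
begin

sublocale prob_space \<mu>
  using measure by (simp add: box_like_measure_def)

lemma sets_mu [measurable_cong]: "sets \<mu> = sets borel"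
  using measure by (simp add: box_like_measure_def)

lemma space_mu: "space \<mu> = UNIV"
  using sets_eq_imp_space_eq[OF sets_mu] by simp

lemma fin_I: "finite I" and I_ne: "I \<noteq> {}"
  using measure by (auto simp: box_like_measure_def box_like_ifs_def)

lemma p_pos: "i \<in> I \<Longrightarrow> 0 < p i" and sum_p: "(\<Sum>i\<in>I. p i) = 1"
  using measure by (auto simp: box_like_measure_def prob_vector_def)

lemma S_unit: "i \<in> I \<Longrightarrow> S i ` ({0..1} \<times> {0..1}) \<subseteq> {0..1} \<times> {0..1}"
  using measure by (auto simp: box_like_measure_def box_like_ifs_def box_like_map_def)

lemma prob_self_affine: "E \<in> sets borel \<Longrightarrow> prob E = (\<Sum>i\<in>I. p i * prob (S i -` E))"
  using measure by (auto simp: box_like_measure_def)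

definition rmin where "rmin = Min ((\<lambda>(i, j). \<bar>A i j\<bar>) ` (I \<times> UNIV))"
definition rmax where "rmax = Max ((\<lambda>(i, j). \<bar>A i j\<bar>) ` (I \<times> UNIV))"

lemma A_rmin: "i \<in> I \<Longrightarrow> rmin \<le> \<bar>A i j\<bar>" and A_rmax: "i \<in> I \<Longrightarrow> \<bar>A i j\<bar> \<le> rmax"
  unfolding rmin_def rmax_def using fin_I by (auto intro!: Min_le Max_ge)

lemma rmin_pos: "0 < rmin" and rmax_less_1: "rmax < 1"
  unfolding rmin_def rmax_def using fin_I I_ne A_bounds by (subst Min_gr_iff Max_less_iff; auto)+

lemma rmin_le_rmax: "rmin \<le> rmax"
  using I_ne A_rmin A_rmax by (meson ex_in_conv order_trans)

lemma rmax_pos: "0 < rmax" and rmin_less_1: "rmin < 1"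
  using rmin_le_rmax rmin_pos rmax_less_1 by auto

primrec wsw :: "'i list \<Rightarrow> bool" where
  "wsw [] = False"
| "wsw (i # w) = (sw i \<noteq> wsw w)"

primrec wA :: "'i list \<Rightarrow> bool \<Rightarrow> real" where
  "wA [] j = 1"
| "wA (i # w) j = A i j * wA w (j \<noteq> sw i)"

text \<open>The side along axis j of the image of the unit square under \<open>word_map S w\<close>.
  It is the image of the side along axis \<open>j \<noteq> wsw w\<close>.\<close>

definition len :: "'i list \<Rightarrow> bool \<Rightarrow> real" where
  "len w j = \<bar>wA w j\<bar>"

lemma wsw_append: "wsw (u @ v) = (wsw u \<noteq> wsw v)"
  by (induction u) auto

lemma wA_append: "wA (u @ v) j = wA u j * wA v (j \<noteq> wsw u)"
proof (induction u arbitrary: j)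
  case (Cons i u)
  have "((j \<noteq> sw i) \<noteq> wsw u) = (j \<noteq> wsw (i # u))" by auto
  then show ?case using Cons[of "j \<noteq> sw i"] by simp
qed simp

lemma len_append: "len (u @ v) j = len u j * len v (j \<noteq> wsw u)"
  by (simp add: len_def wA_append abs_mult)

lemma coord_word_map:
  "set w \<subseteq> I \<Longrightarrow> coord j (word_map S w z) = wA w j * coord (j \<noteq> wsw w) z + coord j (word_map S w 0)"
proof (induction w arbitrary: j)
  case Nil
  then show ?case by (simp add: coord_def)
next
  case (Cons i w)
  have eq: "((j \<noteq> sw i) \<noteq> wsw w) = (j \<noteq> wsw (i # w))" by auto
  have "coord (j \<noteq> sw i) (word_map S w z)
      = wA w (j \<noteq> sw i) * coord (j \<noteq> wsw (i # w)) z + coord (j \<noteq> sw i) (word_map S w 0)"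
    unfolding eq[symmetric] using Cons by simp
  then show ?case using Cons.prems by (simp add: coord_S algebra_simps)
qed

lemma len_bounds: "set w \<subseteq> I \<Longrightarrow> rmin ^ length w \<le> len w j \<and> len w j \<le> rmax ^ length w"
proof (induction w arbitrary: j)
  case (Cons i w)
  then have *: "rmin \<le> \<bar>A i j\<bar>" "\<bar>A i j\<bar> \<le> rmax" "rmin ^ length w \<le> len w (j \<noteq> sw i)"
    "len w (j \<noteq> sw i) \<le> rmax ^ length w" using A_rmin A_rmax by auto
  have "len (i # w) j = \<bar>A i j\<bar> * len w (j \<noteq> sw i)" by (simp add: len_def abs_mult)
  then show ?case using mult_mono[OF *(1,3)] mult_mono[OF *(2,4)] rmin_pos rmax_pos
    by (auto simp: len_def)
qed (simp add: len_def)

lemma len_pos: "set w \<subseteq> I \<Longrightarrow> 0 < len w j"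
  using len_bounds[of w j] rmin_pos by (meson less_le_trans zero_less_power)

lemma wA_nonzero: "set w \<subseteq> I \<Longrightarrow> wA w j \<noteq> 0"
  using len_pos[of w j] by (simp add: len_def)

lemma len_le_1: "set w \<subseteq> I \<Longrightarrow> len w j \<le> 1"
  using len_bounds[of w j] power_le_one[of rmax "length w"] rmax_pos rmax_less_1 by auto

lemma len_snoc:
  assumes "set w \<subseteq> I" "i \<in> I"
  shows "rmin * len w j \<le> len (w @ [i]) j" "len (w @ [i]) j \<le> len w j"
proof -
  have eq: "len (w @ [i]) j = len w j * \<bar>A i (j \<noteq> wsw w)\<bar>"
    unfolding len_append by (simp add: len_def)
  show "rmin * len w j \<le> len (w @ [i]) j" unfolding eq
    using A_rmin[OF assms(2)] len_pos[OF assms(1), of j] by (simp add: mult.commute mult_left_mono)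
  show "len (w @ [i]) j \<le> len w j" unfolding eq
    using A_bounds[OF assms(2)] len_pos[OF assms(1), of j] by (simp add: mult_left_le less_imp_le)
qed

lemma word_prob_pos: "set w \<subseteq> I \<Longrightarrow> 0 < word_prob p w"
  by (induction w) (auto simp: p_pos)

lemma word_map_unit: "set w \<subseteq> I \<Longrightarrow> z \<in> {0..1} \<times> {0..1} \<Longrightarrow> word_map S w z \<in> {0..1} \<times> {0..1}"
proof (induction w arbitrary: z)
  case (Cons i w)
  then have "S i (word_map S w z) \<in> S i ` ({0..1} \<times> {0..1})" by (intro imageI) simp
  moreover have "i \<in> I" using Cons.prems by simp
  ultimately have "S i (word_map S w z) \<in> {0..1} \<times> {0..1}" using S_unit by blast
  then show ?case by (simp only: word_map_simps comp_apply)
qed simp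

lemma continuous_word_map:
  assumes "set w \<subseteq> I"
  shows "continuous_on UNIV (word_map S w)"
proof -
  have "word_map S w = (\<lambda>z. (wA w True * coord (True \<noteq> wsw w) z + coord True (word_map S w 0),
      wA w False * coord (False \<noteq> wsw w) z + coord False (word_map S w 0)))"
  proof
    fix z
    show "word_map S w z = (wA w True * coord (True \<noteq> wsw w) z + coord True (word_map S w 0),
      wA w False * coord (False \<noteq> wsw w) z + coord False (word_map S w 0))"
      using coord_word_map[OF assms, of True z] coord_word_map[OF assms, of False z]
      by (simp add: prod_eq_iff)
  qed
  then show ?thesis
    by (rule ssubst) (auto intro!: continuous_intros)
qed

lemma word_map_vimage_borel [measurable]:
  "set w \<subseteq> I \<Longrightarrow> E \<in> sets borel \<Longrightarrow> word_map S w -` E \<in> sets borel"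
  using measurable_sets[OF borel_measurable_continuous_onI[OF continuous_word_map], of w E] by simp

lemma prob_word_snoc:
  assumes "set u \<subseteq> I" "E \<in> sets borel"
  shows "word_prob p u * prob (word_map S u -` E)
    = (\<Sum>i\<in>I. word_prob p (u @ [i]) * prob (word_map S (u @ [i]) -` E))"
  using prob_self_affine[OF word_map_vimage_borel[OF assms]]
  by (simp add: sum_distrib_left word_map_append vimage_comp[symmetric] mult.assoc)

lemma prob_cut_set:
  assumes "\<And>w. set w \<subseteq> I \<Longrightarrow> length w = n \<Longrightarrow> P w" "E \<in> sets borel"
  shows "prob E = (\<Sum>w\<in>cut_set I P. word_prob p w * prob (word_map S w -` E))"
  using sum_cut_set[OF fin_I assms(1), where h = "\<lambda>u. word_prob p u * prob (word_map S u -` E)"]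
    prob_word_snoc[OF _ assms(2)] by simp

lemma dist_S_le:
  assumes "i \<in> I"
  shows "dist (S i x) (S i y) \<le> rmax * dist x y"
proof -
  have c: "(coord j (S i x) - coord j (S i y))\<^sup>2 \<le> rmax\<^sup>2 * (coord (j \<noteq> sw i) x - coord (j \<noteq> sw i) y)\<^sup>2" for j
  proof -
    have "coord j (S i x) - coord j (S i y) = A i j * (coord (j \<noteq> sw i) x - coord (j \<noteq> sw i) y)"
      by (simp add: coord_S[OF assms] algebra_simps)
    then have "(coord j (S i x) - coord j (S i y))\<^sup>2 = \<bar>A i j\<bar>\<^sup>2 * (coord (j \<noteq> sw i) x - coord (j \<noteq> sw i) y)\<^sup>2"
      by (simp add: power_mult_distrib)
    also have "\<dots> \<le> rmax\<^sup>2 * (coord (j \<noteq> sw i) x - coord (j \<noteq> sw i) y)\<^sup>2"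
      using A_rmax[OF assms, of j] by (intro mult_right_mono power_mono) auto
    finally show ?thesis .
  qed
  have d: "dist u v = sqrt ((coord True u - coord True v)\<^sup>2 + (coord False u - coord False v)\<^sup>2)" for u v :: "real \<times> real"
    by (simp add: dist_prod_def dist_real_def)
  have "(coord True (S i x) - coord True (S i y))\<^sup>2 + (coord False (S i x) - coord False (S i y))\<^sup>2
      \<le> rmax\<^sup>2 * ((coord True x - coord True y)\<^sup>2 + (coord False x - coord False y)\<^sup>2)"
    using c[of True] c[of False] by (cases "sw i") (simp_all add: distrib_left)
  then have "dist (S i x) (S i y) \<le> sqrt (rmax\<^sup>2 * ((coord True x - coord True y)\<^sup>2 + (coord False x - coord False y)\<^sup>2))"
    unfolding d by (rule real_sqrt_le_mono)
  also have "\<dots> = rmax * dist x y"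
    unfolding d using rmax_pos by (simp add: real_sqrt_mult)
  finally show ?thesis .
qed

text \<open>Every \<open>S i\<close> shrinks the distance to X by rmax, so by self-affinity the
  points farther than e from X have at most the mass of those farther than e / rmax. Iterating,
  these sets decrease to the empty set. This works without prior knowledge that \<mu> has bounded
  support.\<close>

lemma AE_closed_invariant:
  assumes X: "closed X" "X \<noteq> {}" and inv: "\<And>i. i \<in> I \<Longrightarrow> S i ` X \<subseteq> X"
  shows "AE x in \<mu>. x \<in> X"
proof -
  define B where "B e = {x. e < infdist x X}" for e
  have B_borel: "B e \<in> sets borel" for e
  proof -
    have "open (B e)" unfolding B_def by (intro open_Collect_less continuous_intros)
    then show ?thesis by simp
  qed
  have inf_S: "infdist (S i x) X \<le> rmax * infdist x X" if i: "i \<in> I" for i x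
  proof -
    obtain y where y: "y \<in> X" "infdist x X = dist x y"
      using infdist_attains_inf[OF X] by blast
    have "infdist (S i x) X \<le> dist (S i x) (S i y)"
      using inv[OF i] y by (intro infdist_le) auto
    also have "\<dots> \<le> rmax * infdist x X" using dist_S_le[OF i] y by simp
    finally show ?thesis .
  qed
  have step: "prob (B e) \<le> prob (B (e / rmax))" for e
  proof -
    have "prob (B e) = (\<Sum>i\<in>I. p i * prob (S i -` B e))" using prob_self_affine[OF B_borel] .
    also have "\<dots> \<le> (\<Sum>i\<in>I. p i * prob (B (e / rmax)))"
    proof (intro sum_mono mult_left_mono finite_measure_mono)
      fix i assume i: "i \<in> I"
      show "S i -` B e \<subseteq> B (e / rmax)"
      proof
        fix x assume "x \<in> S i -` B e"
        then have "e < rmax * infdist x X" using inf_S[OF i, of x] by (simp add: B_def)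
        then show "x \<in> B (e / rmax)" using rmax_pos by (simp add: B_def pos_divide_less_eq mult.commute)
      qed
    qed (use B_borel sets_mu p_pos in \<open>auto intro: less_imp_le\<close>)
    also have "\<dots> = prob (B (e / rmax))" by (simp add: sum_distrib_right[symmetric] sum_p)
    finally show ?thesis .
  qed
  have zero: "prob (B e) = 0" if e: "0 < e" for e
  proof -
    have le: "prob (B e) \<le> prob (B (e / rmax ^ n))" for n
    proof (induction n)
      case (Suc n)
      then show ?case using step[of "e / rmax ^ n"] by (simp add: mult.commute)
    qed simp
    have mono: "e / rmax ^ m \<le> e / rmax ^ n" if "m \<le> n" for m n
      using that e rmax_pos rmax_less_1 by (intro divide_left_mono power_decreasing) auto
    have "decseq (\<lambda>n. B (e / rmax ^ n))"
      using mono by (fastforce simp: decseq_def B_def)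
    moreover have "(\<Inter>n. B (e / rmax ^ n)) = {}"
    proof (rule ccontr)
      assume "(\<Inter>n. B (e / rmax ^ n)) \<noteq> {}"
      then obtain x where x: "\<And>n. e / rmax ^ n < infdist x X" by (auto simp: B_def)
      have "0 < infdist x X" using x[of 0] e by simp
      then obtain n where "rmax ^ n < e / infdist x X"
        using real_arch_pow_inv[of "e / infdist x X" rmax] e rmax_less_1 by auto
      then have "infdist x X < e / rmax ^ n"
        using \<open>0 < infdist x X\<close> rmax_pos by (simp add: field_simps)
      then show False using x[of n] by simp
    qed
    ultimately have "(\<lambda>n. prob (B (e / rmax ^ n))) \<longlonglongrightarrow> 0"
      using finite_Lim_measure_decseq[of "\<lambda>n. B (e / rmax ^ n)"] B_borel sets_mu by auto
    then have "prob (B e) \<le> 0" using le by (intro LIMSEQ_le_const) auto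
    then show ?thesis using measure_nonneg[of \<mu> "B e"] by linarith
  qed
  have "AE x in \<mu>. \<forall>n::nat. x \<notin> B (1 / real (Suc n))"
    unfolding AE_all_countable
    using zero B_borel sets_mu prob_eq_0 by (intro allI) (simp add: del: of_nat_Suc)
  then show ?thesis
  proof eventually_elim
    case (elim x)
    have "infdist x X = 0"
    proof (rule ccontr)
      assume "infdist x X \<noteq> 0"
      then have "0 < infdist x X" using infdist_nonneg[of x X] by simp
      then obtain n where "1 / real (Suc n) < infdist x X"
        using reals_Archimedean by (auto simp: inverse_eq_divide)
      then show False using elim by (auto simp: B_def)
    qed
    then show ?case using X in_closed_iff_infdist_zero by blast
  qed
qed

definition \<nu> :: "bool \<Rightarrow> real measure" where
  "\<nu> j = distr \<mu> borel (coord j)"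

lemma coord_measurable: "coord j \<in> borel_measurable \<mu>"
  using borel_measurable_coord by (simp add: measurable_cong_sets[OF sets_mu refl])

lemma measure_nu: "E \<in> sets borel \<Longrightarrow> measure (\<nu> j) E = prob (coord j -` E)"
  unfolding \<nu>_def using measure_distr[OF coord_measurable] space_mu by simp

lemma AE_unit_square: "AE z in \<mu>. z \<in> {0..1} \<times> {0..1}"
  by (rule AE_closed_invariant) (use S_unit in \<open>simp_all add: closed_Times\<close>)

lemma unit_interval_nu: "unit_interval_measure (\<nu> j)"
proof -
  have "prob_space (\<nu> j)" unfolding \<nu>_def by (rule prob_space_distr[OF coord_measurable])
  moreover have "measure (\<nu> j) {0..1} = 1"
  proof -
    have "AE z in \<mu>. z \<in> coord j -` {0..1}"
      using AE_unit_square by eventually_elim (auto simp: coord_def)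
    moreover have "coord j -` {0..1} \<in> events"
      using measurable_sets[OF coord_measurable, of "{0..1}"] space_mu by simp
    ultimately have "prob (coord j -` {0..1}) = 1" by (subst prob_eq_1) auto
    then show ?thesis by (simp add: measure_nu)
  qed
  ultimately show ?thesis
    by (auto simp: unit_interval_measure_def unit_interval_measure_axioms_def \<nu>_def)
qed

text \<open>In direction j the piece of \<mu> carried by w is an affine copy of a single projection,
  the one on axis \<open>j \<noteq> wsw w\<close>.\<close>

lemma prob_coord_word:
  assumes "set w \<subseteq> I" "E \<in> sets borel"
  shows "prob (word_map S w -` coord j -` E)
    = measure (\<nu> (j \<noteq> wsw w)) {z. wA w j * z + coord j (word_map S w 0) \<in> E}"
proof -
  have "{z. wA w j * z + coord j (word_map S w 0) \<in> E} \<in> sets borel"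
    using assms by measurable
  moreover have "coord (j \<noteq> wsw w) -` {z. wA w j * z + coord j (word_map S w 0) \<in> E}
      = word_map S w -` coord j -` E"
    unfolding vimage_def using coord_word_map[OF assms(1), of j, symmetric] by simp
  ultimately show ?thesis by (simp add: measure_nu)
qed

lemma affine_word_unit:
  assumes "set w \<subseteq> I" "z \<in> {0..1}"
  shows "wA w j * z + coord j (word_map S w 0) \<in> {0..1}"
proof -
  have "word_map S w (z, z) \<in> {0..1} \<times> {0..1}" using assms by (intro word_map_unit) auto
  then have "coord j (word_map S w (z, z)) \<in> {0..1}" by (auto simp: mem_Times_coord_iff)
  moreover have "coord (j \<noteq> wsw w) (z, z) = z" by (simp add: coord_def)
  ultimately show ?thesis using coord_word_map[OF assms(1), of j "(z, z)"] by simp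
qed

lemma ex_power_le: "0 < \<delta> \<Longrightarrow> \<exists>n. rmax ^ n \<le> \<delta>"
  using real_arch_pow_inv[of \<delta> rmax] rmax_less_1 less_imp_le by blast

end

section \<open>Existence of the exponents of the projections\<close>

lemma one_le_powr_uminus: "0 < \<delta> \<Longrightarrow> \<delta> \<le> 1 \<Longrightarrow> 0 \<le> \<epsilon> \<Longrightarrow> 1 \<le> \<delta> powr (- \<epsilon> :: real)"
  using ge_one_powr_ge_zero[of "1/\<delta>" \<epsilon>] by (simp add: powr_minus_divide powr_divide)

lemma (in unit_interval_measure) prob_eq_0_outside: "E \<inter> {0..1} = {} \<Longrightarrow> prob E = 0"
  using prob_le_sum_cover[of "{}" "\<lambda>_. {}" E] by (metis IntI all_not_in_conv finite.emptyI measure_le_0_iff sum.empty empty_iff)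

lemma (in unit_interval_measure) prob_eq_1_unit:
  assumes "E \<in> sets borel" "{0..1} \<subseteq> E"
  shows "prob E = 1"
proof -
  have "AE x in \<nu>. x \<in> E" using AE_unit by eventually_elim (use assms in auto)
  then show ?thesis using assms(1) borel_events by (subst prob_eq_1) auto
qed

section \<open>Comparison of the two projections under an exchange of axes\<close>

context coordinate_ifs
begin

sublocale nu: unit_interval_measure "\<nu> j" for j
  by (rule unit_interval_nu)

definition pmin where "pmin = Min (p ` I)"

lemma pmin_pos: "0 < pmin" and pmin_le: "i \<in> I \<Longrightarrow> pmin \<le> p i"
  unfolding pmin_def using fin_I I_ne p_pos by auto

lemma pmin_le_1: "pmin \<le> 1"
proof -
  obtain i where i: "i \<in> I" using I_ne by blast
  have "p i \<le> (\<Sum>i\<in>I. p i)" using fin_I p_pos i by (intro member_le_sum) (auto intro: less_imp_le)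
  then show ?thesis using pmin_le[OF i] sum_p by simp
qed

text \<open>An exchanging letter puts an affine copy of one projection, with weight
  \<open>p i\<close>, inside the other; the affine bound then compares their grid sums.\<close>

lemma grid_sum_swap_letter:
  assumes i: "i \<in> I" "sw i" and q: "0 \<le> q" and a: "0 < a"
  shows "grid_sum (\<nu> (\<not> j)) q a \<le> (2 / rmin + 2) powr (q + 1) * pmin powr (- q) * grid_sum (\<nu> j) q a"
proof -
  define E where "E m = {z. A i j * z + coord j (S i 0) \<in> cell a m}" for m
  have w: "set [i] \<subseteq> I" using i by simp
  have le: "measure (\<nu> (\<not> j)) (E m) powr q \<le> pmin powr (- q) * measure (\<nu> j) (cell a m) powr q" for m
  proof -
    have c: "coord j -` cell a m \<in> sets borel"
      using measurable_sets[OF borel_measurable_coord cell_borel] by simp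
    have "measure (\<nu> (\<not> j)) (E m) = prob (S i -` coord j -` cell a m)"
      using prob_coord_word[OF w cell_borel, of j a m] i by (simp add: E_def)
    then have "pmin * measure (\<nu> (\<not> j)) (E m) \<le> p i * prob (S i -` coord j -` cell a m)"
      using pmin_le[OF i(1)] by (simp add: mult_right_mono)
    also have "\<dots> \<le> (\<Sum>i\<in>I. p i * prob (S i -` coord j -` cell a m))"
      using fin_I i p_pos by (intro member_le_sum) (auto intro!: mult_nonneg_nonneg intro: less_imp_le)
    also have "\<dots> = measure (\<nu> j) (cell a m)"
      using prob_self_affine[OF c] by (simp add: measure_nu)
    finally have "measure (\<nu> (\<not> j)) (E m) \<le> measure (\<nu> j) (cell a m) / pmin"
      using pmin_pos by (simp add: field_simps)
    then have "measure (\<nu> (\<not> j)) (E m) powr q \<le> (measure (\<nu> j) (cell a m) / pmin) powr q"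
      using q by (intro powr_mono2) auto
    then show ?thesis using pmin_pos by (simp add: powr_divide powr_minus_divide)
  qed
  have A: "rmin \<le> \<bar>A i j\<bar>" "\<bar>A i j\<bar> \<le> 1" "A i j \<noteq> 0"
    using A_rmin[OF i(1)] A_bounds[OF i(1)] by (auto intro: less_imp_le)
  have "grid_sum (\<nu> (\<not> j)) q a \<le> (2 * (1 / rmin) + 2) powr (q + 1) * (\<Sum>m\<in>grid a. measure (\<nu> (\<not> j)) (E m) powr q)"
    unfolding E_def
  proof (rule nu.grid_sum_affine_ge[OF A(3) a a q])
    have "rmin * a \<le> \<bar>A i j\<bar> * a" using A(1) a by (intro mult_right_mono) auto
    then show "a \<le> 1 / rmin * (\<bar>A i j\<bar> * a)" using rmin_pos by (simp add: field_simps)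
    have "\<bar>A i j\<bar> * rmin \<le> 1 * 1" using A rmin_pos rmin_less_1 by (intro mult_mono) auto
    then have "\<bar>A i j\<bar> * rmin * a \<le> a" using a by simp
    then show "\<bar>A i j\<bar> * a \<le> 1 / rmin * a" using rmin_pos by (simp add: field_simps)
    show "A i j * z + coord j (S i 0) \<in> {0..1}" if "z \<in> {0..1}" for z
      using affine_word_unit[OF w that, of j] by simp
  qed
  also have "\<dots> \<le> (2 * (1 / rmin) + 2) powr (q + 1) * (\<Sum>m\<in>grid a. pmin powr (- q) * measure (\<nu> j) (cell a m) powr q)"
    by (intro mult_left_mono sum_mono le) auto
  finally show ?thesis by (simp add: grid_sum_def sum_distrib_left mult.assoc)
qed

lemma wsw_imp_ex_swap: "wsw w \<Longrightarrow> \<exists>i\<in>set w. sw i"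
  by (induction w) auto

text \<open>A word that exchanges the axes contains an exchanging letter, so the bound for letters
  serves all words with one constant.\<close>

lemma grid_sum_swap_word:
  assumes q: "0 \<le> q"
  obtains K where "1 \<le> K"
    "\<And>j w a. set w \<subseteq> I \<Longrightarrow> 0 < a \<Longrightarrow> grid_sum (\<nu> (j \<noteq> wsw w)) q a \<le> K * grid_sum (\<nu> j) q a"
proof
  define K where "K = max 1 ((2 / rmin + 2) powr (q + 1) * pmin powr (- q))"
  show "1 \<le> K" by (simp add: K_def)
  fix j w and a :: real assume w: "set w \<subseteq> I" and a: "0 < a"
  have pos: "0 \<le> grid_sum (\<nu> j) q a" using nu.grid_sum_pos[OF a] less_imp_le by blast
  show "grid_sum (\<nu> (j \<noteq> wsw w)) q a \<le> K * grid_sum (\<nu> j) q a"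
  proof (cases "wsw w")
    case True
    then obtain i where i: "i \<in> I" "sw i" using wsw_imp_ex_swap w by blast
    have "grid_sum (\<nu> (\<not> j)) q a \<le> (2 / rmin + 2) powr (q + 1) * pmin powr (- q) * grid_sum (\<nu> j) q a"
      by (rule grid_sum_swap_letter[OF i q a])
    also have "\<dots> \<le> K * grid_sum (\<nu> j) q a"
      using pos by (intro mult_right_mono) (auto simp: K_def)
    finally show ?thesis using True by simp
  next
    case False
    then show ?thesis using mult_right_mono[OF \<open>1 \<le> K\<close> pos] by simp
  qed
qed

end

text \<open>For a fixed axis j, words are stopped when their side along j first falls to \<delta>.
  The projection on axis j is then a mixture of pieces of length between rmin * \<delta> and
  \<delta>.\<close>

locale coordinate_cut = coordinate_ifs I S p \<mu> sw A t
  for I :: "'i set" and S p \<mu> sw A t +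
  fixes j :: bool and \<delta> :: real
  assumes \<delta>: "0 < \<delta>" "\<delta> \<le> 1"
begin

definition "W = cut_set I (\<lambda>w. len w j \<le> \<delta>)"

definition "g w z = wA w j * z + coord j (word_map S w 0)"

lemma W_words: "w \<in> W \<Longrightarrow> set w \<subseteq> I"
  by (simp add: W_def cut_set_def)

lemma cut_complete: "\<exists>n. \<forall>w. set w \<subseteq> I \<longrightarrow> length w = n \<longrightarrow> len w j \<le> \<delta>"
proof -
  obtain n where "rmax ^ n \<le> \<delta>" using ex_power_le[OF \<delta>(1)] by blast
  then have "len w j \<le> \<delta>" if "set w \<subseteq> I" "length w = n" for w
    using len_bounds[OF that(1), of j] that(2) by simp
  then show ?thesis by blast
qed

lemma finite_W: "finite W"
proof -
  obtain n where "\<And>w. set w \<subseteq> I \<Longrightarrow> length w = n \<Longrightarrow> len w j \<le> \<delta>" using cut_complete by blast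
  then show ?thesis unfolding W_def by (rule finite_cut_set[OF fin_I])
qed

lemma len_W: "w \<in> W \<Longrightarrow> len w j \<le> \<delta>" "w \<in> W \<Longrightarrow> rmin * \<delta> \<le> len w j"
proof -
  assume w: "w \<in> W"
  then show "len w j \<le> \<delta>" by (simp add: W_def cut_set_def)
  show "rmin * \<delta> \<le> len w j"
  proof (cases w rule: rev_cases)
    case Nil
    then show ?thesis using \<delta> rmin_pos rmin_less_1 mult_mono[of rmin 1 \<delta> 1] by (simp add: len_def)
  next
    case (snoc u i)
    then have "\<delta> < len u j" "set u \<subseteq> I" "i \<in> I" using w by (auto simp: W_def cut_set_def)
    then have "rmin * \<delta> \<le> rmin * len u j" using rmin_pos by simp
    then show ?thesis using len_snoc(1)[of u i j] \<open>set u \<subseteq> I\<close> \<open>i \<in> I\<close> snoc by simp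
  qed
qed

lemma word_prob_W: "w \<in> W \<Longrightarrow> 0 < word_prob p w"
  using word_prob_pos W_words by blast

lemma measure_nu_cut:
  assumes "E \<in> sets borel"
  shows "measure (\<nu> j) E = (\<Sum>w\<in>W. word_prob p w * measure (\<nu> (j \<noteq> wsw w)) {z. g w z \<in> E})"
proof -
  have c: "coord j -` E \<in> sets borel"
    using measurable_sets[OF borel_measurable_coord assms] by simp
  obtain n where n: "\<And>w. set w \<subseteq> I \<Longrightarrow> length w = n \<Longrightarrow> len w j \<le> \<delta>" using cut_complete by blast
  have "measure (\<nu> j) E = prob (coord j -` E)" using assms by (rule measure_nu)
  also have "\<dots> = (\<Sum>w\<in>W. word_prob p w * prob (word_map S w -` coord j -` E))"
    unfolding W_def by (rule prob_cut_set[OF n c])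
  also have "\<dots> = (\<Sum>w\<in>W. word_prob p w * measure (\<nu> (j \<noteq> wsw w)) {z. g w z \<in> E})"
    by (intro sum.cong refl arg_cong2[of _ _ _ _ "(*)"]) (simp add: prob_coord_word[OF W_words assms] g_def)
  finally show ?thesis .
qed

lemma g_unit: "w \<in> W \<Longrightarrow> z \<in> {0..1} \<Longrightarrow> g w z \<in> {0..1}"
  unfolding g_def using affine_word_unit W_words by blast

lemma g_diam:
  assumes "w \<in> W" "z \<in> {0..1}" "z' \<in> {0..1}"
  shows "\<bar>g w z - g w z'\<bar> \<le> \<delta>"
proof -
  have "\<bar>g w z - g w z'\<bar> = len w j * \<bar>z - z'\<bar>"
    by (simp add: g_def len_def flip: abs_mult right_diff_distrib)
  also have "\<dots> \<le> \<delta> * 1" using assms len_W(1)[OF assms(1)] \<delta> by (intro mult_mono) (auto simp: len_def)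
  finally show ?thesis by simp
qed

lemma g_borel: "E \<in> sets borel \<Longrightarrow> {z. g w z \<in> E} \<in> sets borel"
  using measurable_sets[of "g w" borel borel E] unfolding g_def by (simp add: vimage_def)

text \<open>A piece meeting a cell has length at most \<delta>, so it lies in the wide cell with its
  whole weight.\<close>

lemma word_prob_le_wide:
  assumes "V \<subseteq> W" and "\<And>w. w \<in> V \<Longrightarrow> \<exists>z\<in>{0..1}. g w z \<in> cell \<delta> k"
  shows "(\<Sum>w\<in>V. word_prob p w) \<le> measure (\<nu> j) (nu.wide_cell \<delta> k)"
proof -
  have wide: "nu.wide_cell \<delta> k \<in> sets borel" by (simp add: nu.wide_cell_def)
  have "(\<Sum>w\<in>V. word_prob p w)
      = (\<Sum>w\<in>V. word_prob p w * measure (\<nu> (j \<noteq> wsw w)) {z. g w z \<in> nu.wide_cell \<delta> k})"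
  proof (rule sum.cong[OF refl])
    fix w assume w: "w \<in> V"
    then obtain z where z: "z \<in> {0..1}" "g w z \<in> cell \<delta> k" using assms(2) by blast
    have "{0..1} \<subseteq> {z. g w z \<in> nu.wide_cell \<delta> k}"
    proof
      fix z' :: real assume "z' \<in> {0..1}"
      then have "\<bar>g w z - g w z'\<bar> \<le> \<delta>" using z(1) w assms(1) by (intro g_diam) auto
      then show "z' \<in> {z. g w z \<in> nu.wide_cell \<delta> k}"
        using z(2) by (auto simp: cell_def nu.wide_cell_def algebra_simps)
    qed
    then have "measure (\<nu> (j \<noteq> wsw w)) {z. g w z \<in> nu.wide_cell \<delta> k} = 1"
      by (intro nu.prob_eq_1_unit g_borel wide)
    then show "word_prob p w = word_prob p w * measure (\<nu> (j \<noteq> wsw w)) {z. g w z \<in> nu.wide_cell \<delta> k}"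
      by simp
  qed
  also have "\<dots> \<le> (\<Sum>w\<in>W. word_prob p w * measure (\<nu> (j \<noteq> wsw w)) {z. g w z \<in> nu.wide_cell \<delta> k})"
    using finite_W assms(1) word_prob_W by (intro sum_mono2) (auto intro!: mult_nonneg_nonneg intro: less_imp_le)
  also have "\<dots> = measure (\<nu> j) (nu.wide_cell \<delta> k)"
    by (rule measure_nu_cut[OF wide, symmetric])
  finally show ?thesis .
qed

text \<open>Rounding the image of 0 assigns each word to a single cell, so that W is partitioned
  although closed cells overlap.\<close>

definition "Wk k = {w\<in>W. \<lfloor>g w 0 / \<delta>\<rfloor> = k}"

definition "P k = (\<Sum>w\<in>Wk k. word_prob p w)"

lemma Wk: "finite (Wk k)" "w \<in> Wk k \<Longrightarrow> w \<in> W" "w \<in> Wk k \<Longrightarrow> g w 0 \<in> cell \<delta> k"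
  using finite_W mem_cell_floor[OF \<delta>(1), of "g w 0"] by (auto simp: Wk_def)

lemma sum_W_group: "(\<Sum>w\<in>W. f w) = (\<Sum>k\<in>grid \<delta>. \<Sum>w\<in>Wk k. f w)"
  unfolding Wk_def using finite_W finite_grid[OF \<delta>(1)] floor_mem_grid[OF \<delta>(1)] g_unit
  by (intro sum.group[symmetric]) auto

lemma P_nonneg: "0 \<le> P k"
  unfolding P_def using word_prob_W Wk(2) by (intro sum_nonneg) (auto intro: less_imp_le)

lemma sum_P_powr_le:
  assumes "0 \<le> q"
  shows "(\<Sum>k\<in>grid \<delta>. P k powr q) \<le> 5 powr q * 5 * grid_sum (\<nu> j) q \<delta>"
proof -
  have "(\<Sum>k\<in>grid \<delta>. P k powr q) \<le> (\<Sum>k\<in>grid \<delta>. measure (\<nu> j) (nu.wide_cell \<delta> k) powr q)"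
  proof (intro sum_mono powr_mono2 assms P_nonneg)
    fix k show "P k \<le> measure (\<nu> j) (nu.wide_cell \<delta> k)"
      unfolding P_def using Wk by (intro word_prob_le_wide) (auto intro!: bexI[of _ 0])
  qed
  also have "\<dots> \<le> 5 powr q * 5 * grid_sum (\<nu> j) q \<delta>"
    using assms \<delta> by (intro nu.grid_sum_wide) auto
  finally show ?thesis .
qed

lemma near_of_measure_nonzero:
  assumes "w \<in> Wk k" "measure (\<nu> i) {z. g w z \<in> E} \<noteq> 0"
  obtains x y where "x \<in> cell \<delta> k" "y \<in> E" "\<bar>x - y\<bar> \<le> \<delta>"
proof -
  have "{z. g w z \<in> E} \<inter> {0..1} \<noteq> {}" using nu.prob_eq_0_outside assms(2) by blast
  then obtain z where z: "z \<in> {0..1}" "g w z \<in> E" by blast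
  have "\<bar>g w 0 - g w z\<bar> \<le> \<delta>" using z(1) Wk(2)[OF assms(1)] by (intro g_diam) simp_all
  then show ?thesis using that[of "g w 0" "g w z"] z Wk(3)[OF assms(1)] by simp
qed

text \<open>A piece reaches at most \<delta> from its starting point, so a cell gets mass only from
  groups at index distance at most 2. With \<open>sum_P_powr_le\<close>, group weights and cell
  masses become interchangeable.\<close>

lemma grid_sum_le_sum_P_powr:
  assumes "0 \<le> q"
  shows "grid_sum (\<nu> j) q \<delta> \<le> 5 powr q * 5 * (\<Sum>k\<in>grid \<delta>. P k powr q)"
  unfolding grid_sum_def
proof (rule powr_sum_overlap[where R = "\<lambda>m k. \<bar>m - k\<bar> \<le> 2"])
  fix m :: int
  show "real (card {k \<in> grid \<delta>. \<bar>m - k\<bar> \<le> 2}) \<le> 5" "real (card {k \<in> grid \<delta>. \<bar>k - m\<bar> \<le> 2}) \<le> 5"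
    by (rule card_int_near_le)+
  define f where "f w = word_prob p w * measure (\<nu> (j \<noteq> wsw w)) {z. g w z \<in> cell \<delta> m}" for w
  have f_le: "f w \<le> word_prob p w" if "w \<in> W" for w
    unfolding f_def using word_prob_W[OF that] by (simp add: mult_left_le less_imp_le)
  have "measure (\<nu> j) (cell \<delta> m) = (\<Sum>k\<in>grid \<delta>. \<Sum>w\<in>Wk k. f w)"
    unfolding measure_nu_cut[OF cell_borel] sum_W_group f_def by simp
  also have "\<dots> = (\<Sum>k\<in>{k\<in>grid \<delta>. \<bar>m - k\<bar> \<le> 2}. \<Sum>w\<in>Wk k. f w)"
  proof (rule sum.mono_neutral_right)
    show "\<forall>k\<in>grid \<delta> - {k\<in>grid \<delta>. \<bar>m - k\<bar> \<le> 2}. (\<Sum>w\<in>Wk k. f w) = 0"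
    proof (intro ballI sum.neutral)
      fix k w assume k: "k \<in> grid \<delta> - {k\<in>grid \<delta>. \<bar>m - k\<bar> \<le> 2}" and w: "w \<in> Wk k"
      show "f w = 0"
      proof (rule ccontr)
        assume "f w \<noteq> 0"
        then have "measure (\<nu> (j \<noteq> wsw w)) {z. g w z \<in> cell \<delta> m} \<noteq> 0" by (auto simp: f_def)
        then obtain x y where xy: "x \<in> cell \<delta> k" "y \<in> cell \<delta> m" "\<bar>x - y\<bar> \<le> \<delta>"
          using near_of_measure_nonzero[OF w] by blast
        then have "\<delta> * of_int m \<le> \<delta> * (of_int k + 2)" "\<delta> * of_int k \<le> \<delta> * (of_int m + 2)"
          by (auto simp: cell_def algebra_simps)
        then have "of_int m \<le> real_of_int k + 2" "of_int k \<le> real_of_int m + 2"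
          using \<delta> by simp_all
        then have "\<bar>m - k\<bar> \<le> 2" by linarith
        then show False using k by simp
      qed
    qed
  qed (use finite_grid \<delta> in auto)
  also have "\<dots> \<le> (\<Sum>k\<in>{k\<in>grid \<delta>. \<bar>m - k\<bar> \<le> 2}. P k)"
    unfolding P_def using f_le Wk by (intro sum_mono) auto
  finally show "measure (\<nu> j) (cell \<delta> m) \<le> \<dots>" .
qed (use finite_grid \<delta> assms P_nonneg in auto)

text \<open>The share of group k in the mass of the fine cell m: coarse location k, fine structure
  m.\<close>

definition "T \<eta> k m = (\<Sum>w\<in>Wk k. word_prob p w * measure (\<nu> (j \<noteq> wsw w)) {z. g w z \<in> cell (\<delta> * \<eta>) m})"

lemma T_nonneg: "0 \<le> T \<eta> k m"
  unfolding T_def using word_prob_W Wk(2) by (intro sum_nonneg mult_nonneg_nonneg) (auto intro: less_imp_le)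

lemma measure_nu_eq_sum_T: "measure (\<nu> j) (cell (\<delta> * \<eta>) m) = (\<Sum>k\<in>grid \<delta>. T \<eta> k m)"
  unfolding measure_nu_cut[OF cell_borel] sum_W_group T_def by simp

text \<open>Groups charging one fine cell start in cells that meet its \<delta>-neighbourhood, a set
  of diameter at most 3 * \<delta>, and 2 * 3 + 2 = 8.\<close>

lemma T_support:
  assumes \<eta>: "0 < \<eta>" "\<eta> \<le> 1"
  shows "finite {k. T \<eta> k m \<noteq> 0}" "real (card {k. T \<eta> k m \<noteq> 0}) \<le> 8"
proof -
  define E where "E = {x. \<exists>y\<in>cell (\<delta> * \<eta>) m. \<bar>x - y\<bar> \<le> \<delta>}"
  have sub: "{k. T \<eta> k m \<noteq> 0} \<subseteq> {k. cell \<delta> k \<inter> E \<noteq> {}}"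
  proof
    fix k assume k: "k \<in> {k. T \<eta> k m \<noteq> 0}"
    have "\<not> (\<forall>w\<in>Wk k. measure (\<nu> (j \<noteq> wsw w)) {z. g w z \<in> cell (\<delta> * \<eta>) m} = 0)"
    proof
      assume "\<forall>w\<in>Wk k. measure (\<nu> (j \<noteq> wsw w)) {z. g w z \<in> cell (\<delta> * \<eta>) m} = 0"
      then have "T \<eta> k m = 0" unfolding T_def by (intro sum.neutral) simp
      with k show False by simp
    qed
    then obtain w where w: "w \<in> Wk k" "measure (\<nu> (j \<noteq> wsw w)) {z. g w z \<in> cell (\<delta> * \<eta>) m} \<noteq> 0"
      by blast
    obtain x y where "x \<in> cell \<delta> k" "y \<in> cell (\<delta> * \<eta>) m" "\<bar>x - y\<bar> \<le> \<delta>"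
      using near_of_measure_nonzero[OF w] by blast
    then show "k \<in> {k. cell \<delta> k \<inter> E \<noteq> {}}" unfolding E_def by blast
  qed
  have diam: "\<bar>x - x'\<bar> \<le> 3 * \<delta>" if xE: "x \<in> E" "x' \<in> E" for x x'
  proof -
    obtain y y' where y: "y \<in> cell (\<delta> * \<eta>) m" "\<bar>x - y\<bar> \<le> \<delta>" "y' \<in> cell (\<delta> * \<eta>) m" "\<bar>x' - y'\<bar> \<le> \<delta>"
      using xE unfolding E_def by blast
    have "\<bar>y - y'\<bar> \<le> \<delta> * \<eta>" using cell_diam y by blast
    also have "\<dots> \<le> \<delta>" using \<delta> \<eta> by (simp add: mult_left_le)
    finally show ?thesis using y by linarith
  qed
  have "finite {k. cell \<delta> k \<inter> E \<noteq> {}}" "real (card {k. cell \<delta> k \<inter> E \<noteq> {}}) \<le> 2 * (3 * \<delta>) / \<delta> + 2"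
    using cells_meeting[of \<delta> "3 * \<delta>" E] \<delta> diam by auto
  then show "finite {k. T \<eta> k m \<noteq> 0}" "real (card {k. T \<eta> k m \<noteq> 0}) \<le> 8"
    using finite_subset[OF sub] card_mono[OF _ sub] \<delta> by auto
qed

text \<open>Since at most 8 groups charge a fine cell, taking q-th powers before or after summing
  over groups changes the grid sum by a bounded factor only.\<close>

lemma
  assumes \<eta>: "0 < \<eta>" "\<eta> \<le> 1" and q: "0 \<le> q"
  shows grid_sum_le_sum_T: "grid_sum (\<nu> j) q (\<delta> * \<eta>)
      \<le> 8 powr q * (\<Sum>k\<in>grid \<delta>. \<Sum>m\<in>grid (\<delta> * \<eta>). T \<eta> k m powr q)"
    and sum_T_le_grid_sum: "(\<Sum>k\<in>grid \<delta>. \<Sum>m\<in>grid (\<delta> * \<eta>). T \<eta> k m powr q)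
      \<le> 8 * grid_sum (\<nu> j) q (\<delta> * \<eta>)"
proof -
  define B where "B m = {k\<in>grid \<delta>. T \<eta> k m \<noteq> 0}" for m
  have fin: "finite (grid \<delta>)" using finite_grid \<delta> by simp
  have B: "finite (B m)" "real (card (B m)) \<le> 8" for m
  proof -
    have "B m \<subseteq> {k. T \<eta> k m \<noteq> 0}" by (auto simp: B_def)
    then show "finite (B m)" "real (card (B m)) \<le> 8"
      using T_support[OF \<eta>, of m] card_mono[of "{k. T \<eta> k m \<noteq> 0}" "B m"] finite_subset by auto
  qed
  have s1: "(\<Sum>k\<in>grid \<delta>. T \<eta> k m) = (\<Sum>k\<in>B m. T \<eta> k m)" for m
    using fin by (intro sum.mono_neutral_right) (auto simp: B_def)
  have s2: "(\<Sum>k\<in>grid \<delta>. T \<eta> k m powr q) = (\<Sum>k\<in>B m. T \<eta> k m powr q)" for m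
    using fin by (intro sum.mono_neutral_right) (auto simp: B_def)
  have swap: "(\<Sum>k\<in>grid \<delta>. \<Sum>m\<in>grid (\<delta> * \<eta>). T \<eta> k m powr q)
      = (\<Sum>m\<in>grid (\<delta> * \<eta>). \<Sum>k\<in>B m. T \<eta> k m powr q)"
    by (subst sum.swap) (simp add: s2)
  show "grid_sum (\<nu> j) q (\<delta> * \<eta>) \<le> 8 powr q * (\<Sum>k\<in>grid \<delta>. \<Sum>m\<in>grid (\<delta> * \<eta>). T \<eta> k m powr q)"
    unfolding grid_sum_def measure_nu_eq_sum_T s1 swap sum_distrib_left
    using B T_nonneg q by (intro sum_mono) (simp add: sum_distrib_left[symmetric] powr_sum_le)
  have "(\<Sum>k\<in>B m. T \<eta> k m powr q) \<le> 8 * measure (\<nu> j) (cell (\<delta> * \<eta>) m) powr q" for m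
  proof -
    have "T \<eta> k m \<le> measure (\<nu> j) (cell (\<delta> * \<eta>) m)" if "k \<in> B m" for k
      unfolding measure_nu_eq_sum_T using that fin T_nonneg
      by (intro member_le_sum) (auto simp: B_def)
    then have "(\<Sum>k\<in>B m. T \<eta> k m powr q) \<le> (\<Sum>k\<in>B m. measure (\<nu> j) (cell (\<delta> * \<eta>) m) powr q)"
      using q T_nonneg by (intro sum_mono powr_mono2) auto
    also have "\<dots> \<le> 8 * measure (\<nu> j) (cell (\<delta> * \<eta>) m) powr q"
      using B[of m] by (simp add: mult_right_mono)
    finally show ?thesis .
  qed
  then show "(\<Sum>k\<in>grid \<delta>. \<Sum>m\<in>grid (\<delta> * \<eta>). T \<eta> k m powr q) \<le> 8 * grid_sum (\<nu> j) q (\<delta> * \<eta>)"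
    unfolding swap grid_sum_def sum_distrib_left by (rule sum_mono)
qed

text \<open>Rescaling: a piece has length comparable with \<delta>, so what the mesh \<delta> *
  \<eta> sees of it is what the mesh \<eta> sees of the whole projection.\<close>

lemma
  assumes \<eta>: "0 < \<eta>" and q: "0 \<le> q" and w: "w \<in> W"
  shows sum_piece_le: "(\<Sum>m\<in>grid (\<delta> * \<eta>). measure (\<nu> i) {z. g w z \<in> cell (\<delta> * \<eta>) m} powr q)
      \<le> (2 / rmin + 2) powr (q + 1) * grid_sum (\<nu> i) q \<eta>"
    and sum_piece_ge: "grid_sum (\<nu> i) q \<eta> \<le> (2 / rmin + 2) powr (q + 1) *
      (\<Sum>m\<in>grid (\<delta> * \<eta>). measure (\<nu> i) {z. g w z \<in> cell (\<delta> * \<eta>) m} powr q)"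
proof -
  have k1: "\<delta> * \<eta> \<le> 1 / rmin * (\<bar>wA w j\<bar> * \<eta>)"
  proof -
    have "rmin * \<delta> * \<eta> \<le> len w j * \<eta>" using len_W(2)[OF w] \<eta> by (intro mult_right_mono) auto
    then show ?thesis using rmin_pos by (simp add: len_def field_simps)
  qed
  have k2: "\<bar>wA w j\<bar> * \<eta> \<le> 1 / rmin * (\<delta> * \<eta>)"
  proof -
    have "rmin * len w j \<le> 1 * \<delta>"
      using len_W(1)[OF w] rmin_pos rmin_less_1 by (intro mult_mono) (auto simp: len_def)
    then have "rmin * len w j * \<eta> \<le> \<delta> * \<eta>" using \<eta> by (intro mult_right_mono) auto
    then show ?thesis using rmin_pos by (simp add: len_def field_simps)
  qed
  have pos: "0 < \<delta> * \<eta>" using \<delta> \<eta> by simp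
  note * = wA_nonzero[OF W_words[OF w]] pos \<eta> q k1 k2
  show "(\<Sum>m\<in>grid (\<delta> * \<eta>). measure (\<nu> i) {z. g w z \<in> cell (\<delta> * \<eta>) m} powr q)
      \<le> (2 / rmin + 2) powr (q + 1) * grid_sum (\<nu> i) q \<eta>"
    using nu.grid_sum_affine_le[OF *, of "grid (\<delta> * \<eta>)" i] finite_grid[OF pos] unfolding g_def by simp
  show "grid_sum (\<nu> i) q \<eta> \<le> (2 / rmin + 2) powr (q + 1) *
      (\<Sum>m\<in>grid (\<delta> * \<eta>). measure (\<nu> i) {z. g w z \<in> cell (\<delta> * \<eta>) m} powr q)"
    using nu.grid_sum_affine_ge[OF *] g_unit[OF w] unfolding g_def by simp
qed

text \<open>Jensen inside one group: T is a sum weighted by word probabilities of total P k, and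
  convexity separates P k powr q from an average of rescaled grid sums. By \<open>cmp\<close> these
  all refer to the one axis j.\<close>

lemma sum_T_le:
  assumes \<eta>: "0 < \<eta>" and q: "1 \<le> q" and K: "0 \<le> K"
    and cmp: "\<And>w. set w \<subseteq> I \<Longrightarrow> grid_sum (\<nu> (j \<noteq> wsw w)) q \<eta> \<le> K * grid_sum (\<nu> j) q \<eta>"
  shows "(\<Sum>m\<in>grid (\<delta> * \<eta>). T \<eta> k m powr q)
    \<le> (2 / rmin + 2) powr (q + 1) * K * (P k powr q * grid_sum (\<nu> j) q \<eta>)"
proof -
  define y where "y w m = measure (\<nu> (j \<noteq> wsw w)) {z. g w z \<in> cell (\<delta> * \<eta>) m}" for w m
  define C where "C = (2 / rmin + 2) powr (q + 1)"
  have wp: "0 < word_prob p w" if "w \<in> Wk k" for w using word_prob_W Wk(2)[OF that] .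
  have "(\<Sum>m\<in>grid (\<delta> * \<eta>). T \<eta> k m powr q)
      \<le> (\<Sum>m\<in>grid (\<delta> * \<eta>). P k powr (q - 1) * (\<Sum>w\<in>Wk k. word_prob p w * y w m powr q))"
    unfolding T_def P_def y_def[symmetric] using q wp Wk
    by (intro sum_mono powr_weighted_sum_le) (auto simp: y_def)
  also have "\<dots> = P k powr (q - 1) * (\<Sum>w\<in>Wk k. word_prob p w * (\<Sum>m\<in>grid (\<delta> * \<eta>). y w m powr q))"
    unfolding sum_distrib_left[symmetric] by (subst sum.swap) (simp add: sum_distrib_left)
  also have "\<dots> \<le> P k powr (q - 1) * (\<Sum>w\<in>Wk k. word_prob p w * (C * (K * grid_sum (\<nu> j) q \<eta>)))"
  proof (intro mult_left_mono sum_mono)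
    fix w assume w: "w \<in> Wk k"
    have "(\<Sum>m\<in>grid (\<delta> * \<eta>). y w m powr q) \<le> C * grid_sum (\<nu> (j \<noteq> wsw w)) q \<eta>"
      unfolding y_def C_def using q \<eta> Wk(2)[OF w] by (intro sum_piece_le) auto
    also have "\<dots> \<le> C * (K * grid_sum (\<nu> j) q \<eta>)"
      using cmp W_words Wk(2)[OF w] by (intro mult_left_mono) (auto simp: C_def)
    finally show "(\<Sum>m\<in>grid (\<delta> * \<eta>). y w m powr q) \<le> \<dots>" .
  qed (use wp in \<open>auto intro: less_imp_le\<close>)
  also have "\<dots> = P k powr (q - 1) * P k * (C * (K * grid_sum (\<nu> j) q \<eta>))"
    by (simp add: P_def sum_distrib_right[symmetric])
  also have "P k powr (q - 1) * P k = P k powr q"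
    using P_nonneg by (simp add: powr_diff_one_mult)
  finally show ?thesis by (simp add: C_def mult_ac)
qed

text \<open>The concave counterpart; here \<open>cmp\<close> is required from axis j to the axis of
  the piece.\<close>

lemma sum_T_ge:
  assumes \<eta>: "0 < \<eta>" and q: "0 \<le> q" "q < 1" and K: "0 \<le> K"
    and cmp: "\<And>w. set w \<subseteq> I \<Longrightarrow> grid_sum (\<nu> j) q \<eta> \<le> K * grid_sum (\<nu> (j \<noteq> wsw w)) q \<eta>"
  shows "P k powr q * grid_sum (\<nu> j) q \<eta>
    \<le> (2 / rmin + 2) powr (q + 1) * K * (\<Sum>m\<in>grid (\<delta> * \<eta>). T \<eta> k m powr q)"
proof -
  define y where "y w m = measure (\<nu> (j \<noteq> wsw w)) {z. g w z \<in> cell (\<delta> * \<eta>) m}" for w m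
  define C where "C = (2 / rmin + 2) powr (q + 1)"
  have wp: "0 < word_prob p w" if "w \<in> Wk k" for w using word_prob_W Wk(2)[OF that] .
  have "P k powr q = P k powr (q - 1) * P k"
    using P_nonneg by (simp add: powr_diff_one_mult)
  then have "P k powr q * grid_sum (\<nu> j) q \<eta>
      = P k powr (q - 1) * (\<Sum>w\<in>Wk k. word_prob p w * grid_sum (\<nu> j) q \<eta>)"
    by (simp add: P_def sum_distrib_right)
  also have "\<dots> \<le> P k powr (q - 1) * (\<Sum>w\<in>Wk k. word_prob p w * (K * (C * (\<Sum>m\<in>grid (\<delta> * \<eta>). y w m powr q))))"
  proof (intro mult_left_mono sum_mono)
    fix w assume w: "w \<in> Wk k"
    have "grid_sum (\<nu> j) q \<eta> \<le> K * grid_sum (\<nu> (j \<noteq> wsw w)) q \<eta>"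
      using cmp W_words Wk(2)[OF w] by blast
    also have "\<dots> \<le> K * (C * (\<Sum>m\<in>grid (\<delta> * \<eta>). y w m powr q))"
      unfolding y_def C_def using q \<eta> Wk(2)[OF w] K by (intro mult_left_mono sum_piece_ge) auto
    finally show "grid_sum (\<nu> j) q \<eta> \<le> \<dots>" .
  qed (use wp in \<open>auto intro: less_imp_le\<close>)
  also have "\<dots> = C * K * (P k powr (q - 1) * (\<Sum>w\<in>Wk k. \<Sum>m\<in>grid (\<delta> * \<eta>). word_prob p w * y w m powr q))"
    by (simp add: sum_distrib_left mult_ac)
  also have "\<dots> = C * K * (\<Sum>m\<in>grid (\<delta> * \<eta>). P k powr (q - 1) * (\<Sum>w\<in>Wk k. word_prob p w * y w m powr q))"
    unfolding sum_distrib_left[symmetric] by (subst sum.swap) (simp add: sum_distrib_left)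
  also have "\<dots> \<le> C * K * (\<Sum>m\<in>grid (\<delta> * \<eta>). T \<eta> k m powr q)"
    unfolding T_def P_def y_def[symmetric] using q wp Wk K
    by (intro mult_left_mono sum_mono powr_weighted_sum_ge) (auto simp: y_def C_def)
  finally show ?thesis by (simp add: C_def)
qed

end

section \<open>Exponents of the grid sums and of the ball moments\<close>

context coordinate_ifs
begin

text \<open>Location and structure factorise: fine masses are resolved into shares of groups, each
  group into its weight and a rescaled grid sum, and group weights return to cells. Which of the two
  inequalities results is decided by the Jensen step.\<close>

lemma grid_sum_mult:
  assumes q: "0 \<le> q"
  obtains K where "1 \<le> K"
    "\<And>\<delta> \<eta>. 0 < \<delta> \<Longrightarrow> \<delta> \<le> 1 \<Longrightarrow> 0 < \<eta> \<Longrightarrow> \<eta> \<le> 1 \<Longrightarrow> 1 \<le> q \<Longrightarrow>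
      grid_sum (\<nu> j) q (\<delta> * \<eta>) \<le> K * (grid_sum (\<nu> j) q \<delta> * grid_sum (\<nu> j) q \<eta>)"
    "\<And>\<delta> \<eta>. 0 < \<delta> \<Longrightarrow> \<delta> \<le> 1 \<Longrightarrow> 0 < \<eta> \<Longrightarrow> \<eta> \<le> 1 \<Longrightarrow> q < 1 \<Longrightarrow>
      grid_sum (\<nu> j) q \<delta> * grid_sum (\<nu> j) q \<eta> \<le> K * grid_sum (\<nu> j) q (\<delta> * \<eta>)"
proof -
  obtain K0 where K0: "1 \<le> K0"
    "\<And>j w a. set w \<subseteq> I \<Longrightarrow> 0 < a \<Longrightarrow> grid_sum (\<nu> (j \<noteq> wsw w)) q a \<le> K0 * grid_sum (\<nu> j) q a"
    using grid_sum_swap_word[OF q] by blast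
  define C where "C = (2 / rmin + 2) powr (q + 1)"
  define D where "D = 5 powr q * 5 * (C * K0 * 8)"
  define E where "E = 8 powr q * (C * K0 * (5 powr q * 5))"
  have C: "0 \<le> C" "0 \<le> K0" using K0(1) by (simp_all add: C_def)
  show ?thesis
  proof (rule that[of "max 1 (max D E)"])
    fix \<delta> \<eta> :: real assume d: "0 < \<delta>" "\<delta> \<le> 1" and e: "0 < \<eta>" "\<eta> \<le> 1"
    interpret coordinate_cut I S p \<mu> sw A t j \<delta> by unfold_locales (use d in auto)
    have Np: "0 < grid_sum (\<nu> j) q a" if "0 < a" for a using nu.grid_sum_pos that by blast
    show "grid_sum (\<nu> j) q (\<delta> * \<eta>) \<le> max 1 (max D E) * (grid_sum (\<nu> j) q \<delta> * grid_sum (\<nu> j) q \<eta>)" if q1: "1 \<le> q"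
    proof -
      have "grid_sum (\<nu> j) q (\<delta> * \<eta>) \<le> 8 powr q * (\<Sum>k\<in>grid \<delta>. \<Sum>m\<in>grid (\<delta> * \<eta>). T \<eta> k m powr q)"
        by (rule grid_sum_le_sum_T[OF e q])
      also have "\<dots> \<le> 8 powr q * (\<Sum>k\<in>grid \<delta>. C * K0 * (P k powr q * grid_sum (\<nu> j) q \<eta>))"
        unfolding C_def by (rule mult_left_mono[OF sum_mono[OF sum_T_le[OF e(1) q1 C(2) K0(2)[OF _ e(1)]]]]) simp_all
      also have "\<dots> = 8 powr q * (C * K0 * ((\<Sum>k\<in>grid \<delta>. P k powr q) * grid_sum (\<nu> j) q \<eta>))"
        by (simp add: sum_distrib_left sum_distrib_right)
      also have "\<dots> \<le> 8 powr q * (C * K0 * ((5 powr q * 5 * grid_sum (\<nu> j) q \<delta>) * grid_sum (\<nu> j) q \<eta>))"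
        using C sum_P_powr_le[OF q] Np[OF e(1)] by (intro mult_left_mono mult_right_mono) auto
      also have "\<dots> = E * (grid_sum (\<nu> j) q \<delta> * grid_sum (\<nu> j) q \<eta>)"
        by (simp add: E_def)
      also have "\<dots> \<le> max 1 (max D E) * (grid_sum (\<nu> j) q \<delta> * grid_sum (\<nu> j) q \<eta>)"
        using mult_pos_pos[OF Np[OF d(1)] Np[OF e(1)]] by (intro mult_right_mono) simp_all
      finally show ?thesis .
    qed
    show "grid_sum (\<nu> j) q \<delta> * grid_sum (\<nu> j) q \<eta> \<le> max 1 (max D E) * grid_sum (\<nu> j) q (\<delta> * \<eta>)" if q1: "q < 1"
    proof -
      \<comment> \<open>The comparison is applied at axis \<open>j \<noteq> wsw w\<close>; a second
        exchange leads back to j and thus gives the reverse direction.\<close>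
      have cmp: "grid_sum (\<nu> j) q \<eta> \<le> K0 * grid_sum (\<nu> (j \<noteq> wsw w)) q \<eta>" if "set w \<subseteq> I" for w
      proof -
        have "((j \<noteq> wsw w) \<noteq> wsw w) = j" by auto
        then show ?thesis using K0(2)[OF that e(1), of "j \<noteq> wsw w"] by simp
      qed
      have "grid_sum (\<nu> j) q \<delta> * grid_sum (\<nu> j) q \<eta>
          \<le> (5 powr q * 5 * (\<Sum>k\<in>grid \<delta>. P k powr q)) * grid_sum (\<nu> j) q \<eta>"
        using grid_sum_le_sum_P_powr[OF q] Np[OF e(1)] by (intro mult_right_mono) auto
      also have "\<dots> = 5 powr q * 5 * (\<Sum>k\<in>grid \<delta>. P k powr q * grid_sum (\<nu> j) q \<eta>)"
        by (simp add: sum_distrib_left sum_distrib_right mult.assoc)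
      also have "\<dots> \<le> 5 powr q * 5 * (\<Sum>k\<in>grid \<delta>. C * K0 * (\<Sum>m\<in>grid (\<delta> * \<eta>). T \<eta> k m powr q))"
        unfolding C_def by (rule mult_left_mono[OF sum_mono[OF sum_T_ge[OF e(1) q q1 C(2) cmp]]]) simp_all
      also have "\<dots> = 5 powr q * 5 * (C * K0 * (\<Sum>k\<in>grid \<delta>. \<Sum>m\<in>grid (\<delta> * \<eta>). T \<eta> k m powr q))"
        by (simp add: sum_distrib_left)
      also have "\<dots> \<le> 5 powr q * 5 * (C * K0 * (8 * grid_sum (\<nu> j) q (\<delta> * \<eta>)))"
        using C sum_T_le_grid_sum[OF e q] by (intro mult_left_mono) auto
      also have "\<dots> = D * grid_sum (\<nu> j) q (\<delta> * \<eta>)" by (simp add: D_def)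
      also have "\<dots> \<le> max 1 (max D E) * grid_sum (\<nu> j) q (\<delta> * \<eta>)"
        using Np[of "\<delta> * \<eta>"] d e by (intro mult_right_mono) simp_all
      finally show ?thesis .
    qed
  qed simp
qed

lemma grid_sum_growth_exists:
  assumes q: "0 \<le> q"
  shows "\<exists>T. growth_exponent (grid_sum (\<nu> j) q) T"
proof -
  obtain K where K: "1 \<le> K"
    "\<And>\<delta> \<eta>. 0 < \<delta> \<Longrightarrow> \<delta> \<le> 1 \<Longrightarrow> 0 < \<eta> \<Longrightarrow> \<eta> \<le> 1 \<Longrightarrow> 1 \<le> q \<Longrightarrow>
      grid_sum (\<nu> j) q (\<delta> * \<eta>) \<le> K * (grid_sum (\<nu> j) q \<delta> * grid_sum (\<nu> j) q \<eta>)"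
    "\<And>\<delta> \<eta>. 0 < \<delta> \<Longrightarrow> \<delta> \<le> 1 \<Longrightarrow> 0 < \<eta> \<Longrightarrow> \<eta> \<le> 1 \<Longrightarrow> q < 1 \<Longrightarrow>
      grid_sum (\<nu> j) q \<delta> * grid_sum (\<nu> j) q \<eta> \<le> K * grid_sum (\<nu> j) q (\<delta> * \<eta>)"
    using grid_sum_mult[OF q, of j] by blast
  define K1 where "K1 = (2 * 2 + 2 :: real) powr (q + 1)"
  have Np: "0 < grid_sum (\<nu> j) q a" if "0 < a" for a using nu.grid_sum_pos that by blast
  have up: "K * y \<le> max K K1 * y" "K1 * y \<le> max K K1 * y" if "0 \<le> y" for y
    using that by (auto intro!: mult_right_mono)
  show ?thesis
  proof (rule growth_exponent_exists)
    show "1 \<le> max K K1" using K(1) by simp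
    fix \<delta> \<delta>' :: real
    assume *: "0 < \<delta>" "\<delta> \<le> 1" "0 < \<delta>'" "\<delta>' \<le> 1" "\<delta> \<le> 2 * \<delta>'" "\<delta>' \<le> 2 * \<delta>"
    have "grid_sum (\<nu> j) q \<delta> \<le> K1 * grid_sum (\<nu> j) q \<delta>'"
      unfolding K1_def by (rule nu.grid_sum_mesh) (use * q in auto)
    also have "\<dots> \<le> max K K1 * grid_sum (\<nu> j) q \<delta>'"
      using Np[OF *(3)] by (intro up) simp
    finally show "grid_sum (\<nu> j) q \<delta> \<le> max K K1 * grid_sum (\<nu> j) q \<delta>'" .
  next
    show "(\<forall>\<delta>\<in>{0<..1}. \<forall>\<eta>\<in>{0<..1}. grid_sum (\<nu> j) q (\<delta> * \<eta>)
        \<le> max K K1 * (grid_sum (\<nu> j) q \<delta> * grid_sum (\<nu> j) q \<eta>)) \<or>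
      (\<forall>\<delta>\<in>{0<..1}. \<forall>\<eta>\<in>{0<..1}. grid_sum (\<nu> j) q \<delta> * grid_sum (\<nu> j) q \<eta>
        \<le> max K K1 * grid_sum (\<nu> j) q (\<delta> * \<eta>))"
    proof (cases "1 \<le> q")
      case True
      show ?thesis
      proof (rule disjI1, intro ballI)
        fix \<delta> \<eta> :: real assume *: "\<delta> \<in> {0<..1}" "\<eta> \<in> {0<..1}"
        then have "0 \<le> grid_sum (\<nu> j) q \<delta> * grid_sum (\<nu> j) q \<eta>"
          using Np[of \<delta>] Np[of \<eta>] by simp
        then show "grid_sum (\<nu> j) q (\<delta> * \<eta>) \<le> max K K1 * (grid_sum (\<nu> j) q \<delta> * grid_sum (\<nu> j) q \<eta>)"
          using K(2)[of \<delta> \<eta>] * True up(1) by (meson greaterThanAtMost_iff order_trans)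
      qed
    next
      case False
      show ?thesis
      proof (rule disjI2, intro ballI)
        fix \<delta> \<eta> :: real assume *: "\<delta> \<in> {0<..1}" "\<eta> \<in> {0<..1}"
        then have "0 \<le> grid_sum (\<nu> j) q (\<delta> * \<eta>)" using Np[of "\<delta> * \<eta>"] by simp
        then show "grid_sum (\<nu> j) q \<delta> * grid_sum (\<nu> j) q \<eta> \<le> max K K1 * grid_sum (\<nu> j) q (\<delta> * \<eta>)"
          using K(3)[of \<delta> \<eta>] * False up(1) by (meson greaterThanAtMost_iff not_le order_trans)
      qed
    qed
  qed (use Np in auto)
qed

text \<open>At \<open>q = 0\<close> grid sums count cells; self-affinity bounds the mass of a neighbourhood of a charged
  cell below by a power of the mesh, which makes \<open>q\<close> slightly above \<open>0\<close> comparable with \<open>q = 0\<close>.\<close>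

lemma grid_sum_zero_le:
  assumes \<epsilon>: "0 < \<epsilon>"
  shows "\<exists>q'>0. \<exists>C>0. \<forall>\<delta>\<in>{0<..1}. grid_sum (\<nu> j) 0 \<delta> \<le> C * \<delta> powr (- \<epsilon>) * grid_sum (\<nu> j) q' \<delta>"
proof -
  \<comment> \<open>D makes a side of length r force weight at least r powr D. Halving pmin keeps
    the logarithm negative, and hence D positive, also if pmin were 1.\<close>
  define D where "D = ln (pmin / 2) / ln rmax"
  have lns: "ln (pmin / 2) < 0" "ln rmax < 0"
    using pmin_pos pmin_le_1 rmax_pos rmax_less_1 by (auto simp: ln_less_zero_iff)
  have D: "0 < D" unfolding D_def using lns by (simp add: divide_neg_neg)
  have rD: "rmax powr D = pmin / 2"
    unfolding D_def powr_def using lns rmax_pos pmin_pos by simp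
  have wp: "len w j powr D \<le> word_prob p w" if "set w \<subseteq> I" for w
  proof -
    have "len w j powr D \<le> (rmax ^ length w) powr D"
      using len_bounds[OF that] D by (intro powr_mono2) (auto simp: len_def)
    also have "\<dots> = (rmax powr D) ^ length w"
      using rmax_pos by (simp add: powr_realpow[symmetric] powr_powr mult.commute)
    also have "\<dots> \<le> pmin ^ length w"
      unfolding rD using pmin_pos by (intro power_mono) auto
    also have "\<dots> \<le> word_prob p w" using that
    proof (induction w)
      case (Cons i w)
      then show ?case using pmin_le[of i] pmin_pos by (auto intro!: mult_mono)
    qed simp
    finally show ?thesis .
  qed
  \<comment> \<open>With this exponent a mass of at least (rmin * \<delta>) powr D, raised to q', is
    at least (rmin * \<delta>) powr \<epsilon>, which the allowed loss compensates.\<close>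
  define q' where "q' = \<epsilon> / D"
  have q': "0 < q'" using \<epsilon> D by (simp add: q'_def)
  define C where "C = rmin powr (- \<epsilon>) * (5 powr q' * 5)"
  have "grid_sum (\<nu> j) 0 \<delta> \<le> C * \<delta> powr (- \<epsilon>) * grid_sum (\<nu> j) q' \<delta>" if d: "0 < \<delta>" "\<delta> \<le> 1" for \<delta>
  proof -
    interpret coordinate_cut I S p \<mu> sw A t j \<delta> by unfold_locales (use d in auto)
    have rd: "0 < rmin * \<delta>" using rmin_pos d by simp
    have wide: "(rmin * \<delta>) powr D \<le> measure (\<nu> j) (nu.wide_cell \<delta> m)"
      if m: "measure (\<nu> j) (cell \<delta> m) \<noteq> 0" for m
    proof -
      have "\<not> (\<forall>w\<in>W. measure (\<nu> (j \<noteq> wsw w)) {z. g w z \<in> cell \<delta> m} = 0)"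
        using m unfolding measure_nu_cut[OF cell_borel] by (metis (mono_tags, lifting) mult_zero_right sum.neutral)
      then obtain w where w: "w \<in> W" "measure (\<nu> (j \<noteq> wsw w)) {z. g w z \<in> cell \<delta> m} \<noteq> 0" by blast
      have "{z. g w z \<in> cell \<delta> m} \<inter> {0..1} \<noteq> {}" using nu.prob_eq_0_outside w(2) by blast
      then have ex: "\<exists>z\<in>{0..1}. g w z \<in> cell \<delta> m" by blast
      have "(rmin * \<delta>) powr D \<le> len w j powr D"
        using len_W(2)[OF w(1)] rd D by (intro powr_mono2) auto
      also have "\<dots> \<le> word_prob p w" using wp W_words[OF w(1)] by blast
      also have "\<dots> = (\<Sum>w\<in>{w}. word_prob p w)" by simp
      also have "\<dots> \<le> measure (\<nu> j) (nu.wide_cell \<delta> m)"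
        using ex w(1) by (intro word_prob_le_wide) auto
      finally show ?thesis .
    qed
    \<comment> \<open>At a null cell the left side is 0, as \<open>0 powr 0 = 0\<close>: for q = 0
      the grid sum counts charged cells only.\<close>
    have le: "measure (\<nu> j) (cell \<delta> m) powr 0
        \<le> (rmin * \<delta>) powr (- \<epsilon>) * measure (\<nu> j) (nu.wide_cell \<delta> m) powr q'" for m
    proof (cases "measure (\<nu> j) (cell \<delta> m) = 0")
      case False
      have "1 = (rmin * \<delta>) powr (- \<epsilon>) * ((rmin * \<delta>) powr D) powr q'"
      proof -
        have "(rmin * \<delta>) powr (- \<epsilon>) * ((rmin * \<delta>) powr D) powr q' = (rmin * \<delta>) powr (- \<epsilon> + \<epsilon>)"
          unfolding powr_add using D by (simp add: powr_powr q'_def)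
        then show ?thesis using rmin_pos d by simp
      qed
      also have "\<dots> \<le> (rmin * \<delta>) powr (- \<epsilon>) * measure (\<nu> j) (nu.wide_cell \<delta> m) powr q'"
        using wide[OF False] q' by (intro mult_left_mono powr_mono2) auto
      finally show ?thesis using False by simp
    qed simp
    have "grid_sum (\<nu> j) 0 \<delta> \<le> (\<Sum>m\<in>grid \<delta>. (rmin * \<delta>) powr (- \<epsilon>) * measure (\<nu> j) (nu.wide_cell \<delta> m) powr q')"
      unfolding grid_sum_def by (intro sum_mono le)
    also have "\<dots> \<le> (rmin * \<delta>) powr (- \<epsilon>) * (5 powr q' * 5 * grid_sum (\<nu> j) q' \<delta>)"
      unfolding sum_distrib_left[symmetric] using d q' by (intro mult_left_mono nu.grid_sum_wide) auto
    also have "\<dots> = C * \<delta> powr (- \<epsilon>) * grid_sum (\<nu> j) q' \<delta>"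
      using rmin_pos d by (simp add: C_def powr_mult)
    finally show ?thesis .
  qed
  moreover have "0 < C" using rmin_pos by (simp add: C_def)
  ultimately show ?thesis using q' by (intro exI[of _ q'] exI[of _ C] conjI) auto
qed

text \<open>For q > 0 a constant suffices, and \<delta> powr (-\<epsilon>) is at least 1. At q = 0
  the grid sum passes through a small exponent q' > 0, whose grid sum is bounded by the ball moment
  of exponent 0.\<close>

lemma grid_sum_le_ball_moment_powr:
  assumes q: "0 \<le> q" and \<epsilon>: "0 < \<epsilon>"
  shows "\<exists>C>0. \<forall>\<delta>\<in>{0<..1}. grid_sum (\<nu> j) q \<delta> \<le> C * \<delta> powr (- \<epsilon>) * unit_interval_measure.ball_moment (\<nu> j) q \<delta>"
proof -
  let ?X = "unit_interval_measure.ball_moment (\<nu> j) q"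
  have *: "\<exists>C>0. \<forall>\<delta>\<in>{0<..1}. grid_sum (\<nu> j) q \<delta> \<le> C * \<delta> powr (- \<epsilon>) * ?X \<delta>"
    if C: "0 < C" "\<And>\<delta>. 0 < \<delta> \<Longrightarrow> grid_sum (\<nu> j) q \<delta> \<le> C * ?X \<delta>" for C
  proof (intro exI[of _ C] conjI ballI C(1))
    fix \<delta> :: real assume "\<delta> \<in> {0<..1}"
    then have d: "0 < \<delta>" "\<delta> \<le> 1" by auto
    have "0 < C * ?X \<delta>" using C(2)[OF d(1)] nu.grid_sum_pos[OF d(1), of j q] by linarith
    moreover have "1 \<le> \<delta> powr (- \<epsilon>)" using one_le_powr_uminus[OF d less_imp_le[OF \<epsilon>]] .
    ultimately have "1 * (C * ?X \<delta>) \<le> \<delta> powr (- \<epsilon>) * (C * ?X \<delta>)" by (intro mult_right_mono) auto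
    then show "grid_sum (\<nu> j) q \<delta> \<le> C * \<delta> powr (- \<epsilon>) * ?X \<delta>"
      using C(2)[OF d(1)] by (simp add: mult_ac)
  qed
  consider "1 \<le> q" | "0 < q" "q < 1" | "q = 0" using q by linarith
  then show ?thesis
  proof cases
    case 1
    then show ?thesis using nu.grid_sum_le_ball_moment[of _ q j] by (intro *[of 2]) auto
  next
    case 2
    then obtain C where "C > 0" "\<And>\<delta>. 0 < \<delta> \<Longrightarrow> grid_sum (\<nu> j) q \<delta> \<le> C * ?X \<delta>"
      using nu.grid_sum_le_ball_moment'[of q q j] by auto
    then show ?thesis by (intro *[of C]) auto
  next
    case 3
    obtain q' C where q': "0 < q'" "C > 0"
      "\<And>\<delta>. 0 < \<delta> \<Longrightarrow> \<delta> \<le> 1 \<Longrightarrow> grid_sum (\<nu> j) 0 \<delta> \<le> C * \<delta> powr (- \<epsilon>) * grid_sum (\<nu> j) q' \<delta>"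
      using grid_sum_zero_le[OF \<epsilon>, of j] by auto
    obtain C' where C': "C' > 0" "\<And>\<delta>. 0 < \<delta> \<Longrightarrow> grid_sum (\<nu> j) q' \<delta> \<le> C' * ?X \<delta>"
      using nu.grid_sum_le_ball_moment'[of q q' j] 3 q' by auto
    show ?thesis
    proof (intro exI[of _ "C * C'"] conjI ballI)
      fix \<delta> :: real assume "\<delta> \<in> {0<..1}"
      then have d: "0 < \<delta>" "\<delta> \<le> 1" by auto
      have "C * \<delta> powr (- \<epsilon>) * grid_sum (\<nu> j) q' \<delta> \<le> C * \<delta> powr (- \<epsilon>) * (C' * ?X \<delta>)"
        using C'(2)[OF d(1)] q' by (intro mult_left_mono) auto
      then show "grid_sum (\<nu> j) q \<delta> \<le> C * C' * \<delta> powr (- \<epsilon>) * ?X \<delta>"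
        using q'(3)[OF d] 3 by (simp add: mult_ac)
    qed (use q' C' in auto)
  qed
qed

definition tau :: "bool \<Rightarrow> real \<Rightarrow> real" where
  "tau j q = moment_scaling (\<nu> j) q"

text \<open>Ball moments inherit the exponent of the grid sums, so the \<open>Lim\<close> in
  \<open>moment_scaling\<close> is a genuine limit and equals that exponent.\<close>

lemma growth_exponent_grid_sum:
  assumes q: "0 \<le> q"
  shows "growth_exponent (grid_sum (\<nu> j) q) (tau j q)"
proof -
  let ?X = "unit_interval_measure.ball_moment (\<nu> j) q"
  obtain T where T: "growth_exponent (grid_sum (\<nu> j) q) T"
    using grid_sum_growth_exists[OF q] by blast
  have "growth_exponent ?X T"
  proof (rule growth_exponent_cong[OF T])
    fix \<epsilon> :: real assume \<epsilon>: "0 < \<epsilon>"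
    show "\<exists>C>0. \<forall>\<delta>\<in>{0<..1}. grid_sum (\<nu> j) q \<delta> \<le> C * \<delta> powr (- \<epsilon>) * ?X \<delta>"
      by (rule grid_sum_le_ball_moment_powr[OF q \<epsilon>])
    have "?X \<delta> \<le> (5 powr q * 5) * \<delta> powr (- \<epsilon>) * grid_sum (\<nu> j) q \<delta>" if d: "0 < \<delta>" "\<delta> \<le> 1" for \<delta>
    proof -
      have N: "0 < grid_sum (\<nu> j) q \<delta>" using nu.grid_sum_pos d by blast
      have "?X \<delta> \<le> (5 powr q * 5) * grid_sum (\<nu> j) q \<delta>"
      proof (cases "1 \<le> q")
        case True
        then show ?thesis using nu.ball_moment_le_grid_sum[OF d(1)] by blast
      next
        case False
        then have "?X \<delta> \<le> 1 * grid_sum (\<nu> j) q \<delta>"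
          using nu.ball_moment_le_grid_sum'[OF d(1), of q j] by simp
        also have "\<dots> \<le> (5 powr q * 5) * grid_sum (\<nu> j) q \<delta>"
          using N q ge_one_powr_ge_zero[of 5 q] by (intro mult_right_mono) auto
        finally show ?thesis .
      qed
      also have "\<dots> \<le> (5 powr q * 5) * (\<delta> powr (- \<epsilon>) * grid_sum (\<nu> j) q \<delta>)"
        using N mult_right_mono[OF one_le_powr_uminus[OF d less_imp_le[OF \<epsilon>]], of "grid_sum (\<nu> j) q \<delta>"]
        by (intro mult_left_mono) simp_all
      finally show ?thesis by simp
    qed
    then show "\<exists>C>0. \<forall>\<delta>\<in>{0<..1}. ?X \<delta> \<le> C * \<delta> powr (- \<epsilon>) * grid_sum (\<nu> j) q \<delta>"
      by (intro exI[of _ "5 powr q * 5"]) auto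
  qed
  then have "((\<lambda>\<delta>. ln (?X \<delta>) / (- ln \<delta>)) \<longlongrightarrow> T) (at_right 0)"
    by (rule growth_exponent_tendsto)
  then have "tau j q = T"
    unfolding tau_def moment_scaling_def nu.ball_moment_def by (intro tendsto_Lim) auto
  then show ?thesis using T by simp
qed

lemma tau_swap:
  assumes q: "0 \<le> q" and i: "i \<in> I" "sw i"
  shows "tau True q = tau False q"
proof -
  define C where "C = (2 / rmin + 2) powr (q + 1) * pmin powr (- q)"
  have "0 < 2 / rmin + 2" using rmin_pos by (simp add: add_pos_pos)
  then have C: "0 < C" using pmin_pos by (simp add: C_def)
  have le: "\<exists>C>0. \<forall>\<delta>\<in>{0<..1}. grid_sum (\<nu> (\<not> j)) q \<delta> \<le> C * \<delta> powr (- \<epsilon>) * grid_sum (\<nu> j) q \<delta>"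
    if \<epsilon>: "0 < \<epsilon>" for j \<epsilon>
  proof (intro exI[of _ C] conjI ballI C)
    fix \<delta> :: real assume "\<delta> \<in> {0<..1}"
    then have d: "0 < \<delta>" "\<delta> \<le> 1" by auto
    have N: "0 < grid_sum (\<nu> j) q \<delta>" using nu.grid_sum_pos d by blast
    have "grid_sum (\<nu> (\<not> j)) q \<delta> \<le> C * (1 * grid_sum (\<nu> j) q \<delta>)"
      using grid_sum_swap_letter[OF i q d(1), of j] by (simp add: C_def)
    also have "\<dots> \<le> C * (\<delta> powr (- \<epsilon>) * grid_sum (\<nu> j) q \<delta>)"
      using N C one_le_powr_uminus[OF d less_imp_le[OF \<epsilon>]]
      by (intro mult_left_mono mult_right_mono) simp_all
    finally show "grid_sum (\<nu> (\<not> j)) q \<delta> \<le> C * \<delta> powr (- \<epsilon>) * grid_sum (\<nu> j) q \<delta>" by simp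
  qed
  have "growth_exponent (grid_sum (\<nu> False) q) (tau True q)"
    using le[of _ True] le[of _ False]
    by (intro growth_exponent_cong[OF growth_exponent_grid_sum[OF q, of True]]) auto
  then show ?thesis using growth_exponent_unique growth_exponent_grid_sum[OF q] by blast
qed

end

section \<open>Pressure\<close>

context
  fixes f :: "real \<times> real \<Rightarrow> real \<times> real" and s :: bool and a t :: "bool \<Rightarrow> real"
  assumes f: "\<And>j z. coord j (f z) = a j * coord (j \<noteq> s) z + t j" and a: "\<And>j. a j \<noteq> 0"
begin

text \<open>The adjoint sends the axes back, so \<open>adjoint A (A v)\<close> is diagonal with the
  squared ratios as entries.\<close>

lemma singular_values_axis: "singular_values (linear_part f) = {\<bar>a True\<bar>, \<bar>a False\<bar>}"
proof -
  define g where "g y = (a (True \<noteq> s) * coord (True \<noteq> s) y, a (False \<noteq> s) * coord (False \<noteq> s) y)" for y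
  have lin: "linear_part f z = (a True * coord (True \<noteq> s) z, a False * coord (False \<noteq> s) z)" for z
    using f[of True z] f[of False z] f[of True 0] f[of False 0]
    by (simp add: linear_part_def prod_eq_iff) (simp add: coord_def)
  have "linear_part f x \<bullet> y = x \<bullet> g y" for x y
    unfolding lin g_def by (cases s) (auto simp: inner_prod_def)
  then have adj: "adjoint (linear_part f) = g"
    by (intro adjoint_unique) simp
  have gf: "g (linear_part f v) = ((a (True \<noteq> s))\<^sup>2 * fst v, (a (False \<noteq> s))\<^sup>2 * snd v)" for v
    unfolding lin g_def by (cases s) (auto simp: power2_eq_square)
  have "\<sigma> \<in> singular_values (linear_part f) \<longleftrightarrow> \<sigma> = \<bar>a (True \<noteq> s)\<bar> \<or> \<sigma> = \<bar>a (False \<noteq> s)\<bar>" for \<sigma>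
  proof
    assume "\<sigma> \<in> singular_values (linear_part f)"
    then obtain v where "0 \<le> \<sigma>" "v \<noteq> 0" "g (linear_part f v) = \<sigma>\<^sup>2 *\<^sub>R v"
      unfolding singular_values_def adj by blast
    then have v: "0 \<le> \<sigma>" "fst v \<noteq> 0 \<or> snd v \<noteq> 0"
      "(a (True \<noteq> s))\<^sup>2 * fst v = \<sigma>\<^sup>2 * fst v" "(a (False \<noteq> s))\<^sup>2 * snd v = \<sigma>\<^sup>2 * snd v"
      unfolding gf by (auto simp: prod_eq_iff)
    then have "(a (True \<noteq> s))\<^sup>2 = \<sigma>\<^sup>2 \<or> (a (False \<noteq> s))\<^sup>2 = \<sigma>\<^sup>2" by auto
    then show "\<sigma> = \<bar>a (True \<noteq> s)\<bar> \<or> \<sigma> = \<bar>a (False \<noteq> s)\<bar>"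
      using v(1) by (auto simp: power2_eq_iff abs_if split: if_splits)
  next
    assume "\<sigma> = \<bar>a (True \<noteq> s)\<bar> \<or> \<sigma> = \<bar>a (False \<noteq> s)\<bar>"
    then show "\<sigma> \<in> singular_values (linear_part f)"
    proof
      assume "\<sigma> = \<bar>a (True \<noteq> s)\<bar>"
      then show ?thesis unfolding singular_values_def adj gf
        by (auto intro!: exI[of _ "(1, 0)"] simp: zero_prod_def)
    next
      assume "\<sigma> = \<bar>a (False \<noteq> s)\<bar>"
      then show ?thesis unfolding singular_values_def adj gf
        by (auto intro!: exI[of _ "(0, 1)"] simp: zero_prod_def)
    qed
  qed
  then have "singular_values (linear_part f) = {\<bar>a (True \<noteq> s)\<bar>, \<bar>a (False \<noteq> s)\<bar>}" by auto
  then show ?thesis by (cases s) auto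
qed

lemma sv_axis: "sv1 f = max \<bar>a True\<bar> \<bar>a False\<bar>" "sv2 f = min \<bar>a True\<bar> \<bar>a False\<bar>"
  unfolding sv1_def sv2_def singular_values_axis by simp_all

lemma diameter_coord_axis: "diameter (coord j ` f ` ({0..1} \<times> {0..1})) = \<bar>a j\<bar>"
proof -
  have "coord j ` f ` ({0..1} \<times> {0..1}) = (\<lambda>x. a j * x + t j) ` coord (j \<noteq> s) ` ({0..1} \<times> {0..1})"
    by (simp add: image_image f)
  also have "coord (j \<noteq> s) ` ({0..1} \<times> {0..1}) = {0..1::real}"
    by (cases "j \<noteq> s") (auto simp: coord_def fst_image_times snd_image_times)
  also have "(\<lambda>x. a j * x + t j) ` {0..1} = (if 0 \<le> a j then {t j..a j + t j} else {a j + t j..t j})"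
    by (simp add: image_affinity_atLeastAtMost)
  finally show ?thesis by (auto simp: diameter_closed_interval)
qed

lemma base_height_axis: "base_length f = \<bar>a True\<bar>" "height_length f = \<bar>a False\<bar>"
proof -
  have "coord True = fst" "coord False = snd" by auto
  then show "base_length f = \<bar>a True\<bar>" "height_length f = \<bar>a False\<bar>"
    using diameter_coord_axis[of True] diameter_coord_axis[of False]
    by (simp_all add: base_length_def height_length_def)
qed

lemma preserves_horizontal_axis: "preserves_horizontal f \<longleftrightarrow> \<not> s"
proof
  assume ph: "preserves_horizontal f"
  show "\<not> s"
  proof
    assume s
    obtain y where "f ` (UNIV \<times> {0}) = UNIV \<times> {y}" using ph unfolding preserves_horizontal_def by blast
    then have "f (0, 0) \<in> UNIV \<times> {y}" "f (1, 0) \<in> UNIV \<times> {y}" by auto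
    then have "snd (f (0, 0)) = snd (f (1, 0))" by auto
    then show False using f[of False "(0, 0)"] f[of False "(1, 0)"] \<open>s\<close> a[of False] by simp
  qed
next
  assume s: "\<not> s"
  have fe: "f (x, y) = (a True * x + t True, a False * y + t False)" for x y
    using f[of True "(x, y)"] f[of False "(x, y)"] s by (simp add: prod_eq_iff)
  have "f ` (UNIV \<times> {y}) = UNIV \<times> {a False * y + t False}" for y :: real
  proof (intro equalityI subsetI)
    fix z :: "real \<times> real" assume "z \<in> UNIV \<times> {a False * y + t False}"
    then have "z = f ((fst z - t True) / a True, y)"
      using a[of True] by (auto simp: fe)
    then show "z \<in> f ` (UNIV \<times> {y})" by blast
  qed (auto simp: fe)
  then show "preserves_horizontal f" unfolding preserves_horizontal_def by blast
qed

end

text \<open>The exponents \<tau> and s have no known sign; for a base in [r, 1] a bound on |x|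
  covers both signs.\<close>

lemma powr_bounds_of_bounds:
  fixes y r x X :: real
  assumes r: "0 < r" "r \<le> y" "y \<le> 1" and x: "\<bar>x\<bar> \<le> X"
  shows "r powr X \<le> y powr x" "y powr x \<le> r powr (- X)"
proof -
  have "r powr X \<le> y powr X" using r x by (intro powr_mono2) auto
  also have "\<dots> \<le> y powr x" using r x by (intro powr_mono') auto
  finally show "r powr X \<le> y powr x" .
  have "y powr x \<le> y powr (- X)" using r x by (intro powr_mono') auto
  also have "\<dots> \<le> r powr (- X)" using r x by (intro powr_mono2') auto
  finally show "y powr x \<le> r powr (- X)" .
qed

text \<open>The two bounds make g Lipschitz, hence continuous, and decreasing at rate at least b. It
  therefore changes sign within distance |g 0| / b of 0, and only once.\<close>

lemma Lipschitz_decreasing_zero: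
  fixes g :: "real \<Rightarrow> real"
  assumes b: "0 < b" and up: "\<And>s h. 0 \<le> h \<Longrightarrow> g (s + h) \<le> g s - b * h"
    and low: "\<And>s h. 0 \<le> h \<Longrightarrow> g s - a * h \<le> g (s + h)"
  shows "\<exists>!s. g s = 0"
proof (rule ex_ex1I)
  have ab: "b \<le> a" using up[of 1 0] low[of 1 0] by simp
  have lip: "\<bar>g s - g s'\<bar> \<le> a * \<bar>s - s'\<bar>" for s s'
  proof (induction s s' rule: linorder_wlog)
    case (le s s')
    have "b * (s' - s) \<ge> 0" using le b by simp
    then show ?case using up[of "s' - s" s] low[of "s' - s" s] le by (simp add: abs_if)
  next
    case (sym s s')
    then show ?case by (simp add: abs_minus_commute)
  qed
  have "a-lipschitz_on UNIV g"
    using lip ab b by (intro lipschitz_onI) (auto simp: dist_real_def)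
  then have cont: "continuous_on UNIV g" by (rule lipschitz_on_continuous_on)
  define u where "u = \<bar>g 0\<bar> / b"
  have u: "0 \<le> u" "b * u = \<bar>g 0\<bar>" using b by (auto simp: u_def)
  have "g u \<le> 0" using up[OF u(1), of 0] u by simp
  moreover have "0 \<le> g (- u)" using up[OF u(1), of "- u"] u by simp
  ultimately have "\<exists>s. - u \<le> s \<and> s \<le> u \<and> g s = 0"
    using u by (intro IVT2' continuous_on_subset[OF cont]) auto
  then show "\<exists>s. g s = 0" by blast
next
  fix s s' assume z: "g s = 0" "g s' = 0"
  have "\<not> x < y" if "g x = 0" "g y = 0" for x y
    using up[of "y - x" x] that b by (auto simp: mult_le_0_iff)
  then show "s = s'" using z by (meson linorder_neqE)
qed

section \<open>The weights \<psi> and the pressure\<close>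

context coordinate_ifs
begin

text \<open>The axis of the longer side, with ties going to the first axis as in
  \<open>word_tau\<close>.\<close>

definition big :: "'i list \<Rightarrow> bool" where
  "big w \<longleftrightarrow> len w False \<le> len w True"

lemma big_le: "len w j \<le> len w (big w)" "len w (\<not> big w) \<le> len w j"
proof -
  have "len w j \<le> len w (big w) \<and> len w (\<not> big w) \<le> len w j"
  proof (cases "len w False \<le> len w True")
    case True
    then have "big w" by (simp add: big_def)
    then show ?thesis using True by (cases j) simp_all
  next
    case False
    then have "\<not> big w" by (simp add: big_def)
    then show ?thesis using False by (cases j) simp_all
  qed
  then show "len w j \<le> len w (big w)" "len w (\<not> big w) \<le> len w j" by auto
qed

lemma sv_word:
  assumes "set w \<subseteq> I"
  shows "sv1 (word_map S w) = len w (big w)" "sv2 (word_map S w) = len w (\<not> big w)"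
proof -
  have "sv1 (word_map S w) = max (len w True) (len w False)" "sv2 (word_map S w) = min (len w True) (len w False)"
    using sv_axis[OF coord_word_map[OF assms] wA_nonzero[OF assms]] by (simp_all add: len_def)
  then show "sv1 (word_map S w) = len w (big w)" "sv2 (word_map S w) = len w (\<not> big w)"
    using big_le[of w True] big_le[of w False] by (cases "big w"; simp add: max_def min_def)+
qed

text \<open>The longer side of the image comes from axis \<open>big w \<noteq> wsw w\<close>, so
  this is the projection seen along it; the four cases of \<open>word_tau\<close> collapse into one
  formula.\<close>

lemma word_tau_eq:
  assumes "set w \<subseteq> I"
  shows "word_tau S \<mu> w = tau (big w \<noteq> wsw w)"
proof -
  have c: "coord True = fst" "coord False = snd" by auto
  have "tau True = moment_scaling (distr \<mu> borel fst)" "tau False = moment_scaling (distr \<mu> borel snd)"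
    by (rule ext, simp add: tau_def \<nu>_def c)+
  then show ?thesis
    using base_height_axis[OF coord_word_map[OF assms] wA_nonzero[OF assms]]
      preserves_horizontal_axis[OF coord_word_map[OF assms] wA_nonzero[OF assms]]
    unfolding word_tau_def Let_def by (auto simp: big_def len_def not_le)
qed

text \<open>The geometric factor of \<psi> with axis j in the role of the longer side. Leaving j
  free separates exact multiplicativity (\<open>stretch_append\<close>) from the choice of the
  longer side (\<open>stretch_cmp\<close>).\<close>

definition stretch :: "real \<Rightarrow> real \<Rightarrow> 'i list \<Rightarrow> bool \<Rightarrow> real" where
  "stretch s q w j = len w j powr tau (j \<noteq> wsw w) q * len w (\<not> j) powr (s - tau (j \<noteq> wsw w) q)"

lemma psi_eq:
  "set w \<subseteq> I \<Longrightarrow> psi S p \<mu> s q w = word_prob p w powr q * stretch s q w (big w)"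
  unfolding psi_def stretch_def by (simp add: sv_word word_tau_eq)

lemma stretch_pos: "set w \<subseteq> I \<Longrightarrow> 0 < stretch s q w j"
  unfolding stretch_def using len_pos[of w j] len_pos[of w "\<not> j"] by simp

lemma psi_pos: "set w \<subseteq> I \<Longrightarrow> 0 < psi S p \<mu> s q w"
  using stretch_pos word_prob_pos[of w] by (simp add: psi_eq)

text \<open>Sides multiply axis by axis, so only the exponents must agree. Those of u and of u @ v
  differ by the exchange in v, and if v has one, both projections share the same \<tau>.\<close>

lemma stretch_append:
  assumes "set u \<subseteq> I" "set v \<subseteq> I" "0 \<le> q"
  shows "stretch s q (u @ v) j = stretch s q u j * stretch s q v (j \<noteq> wsw u)"
proof -
  have eq: "tau (j \<noteq> wsw (u @ v)) q = tau ((j \<noteq> wsw u) \<noteq> wsw v) q"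
    by (cases j; cases "wsw u"; cases "wsw v"; simp add: wsw_append)
  have same: "tau (j \<noteq> wsw u) q = tau ((j \<noteq> wsw u) \<noteq> wsw v) q"
  proof (cases "wsw v")
    case True
    then obtain i where "i \<in> I" "sw i" using wsw_imp_ex_swap assms(2) by blast
    then have "tau True q = tau False q" using tau_swap assms(3) by blast
    then show ?thesis by (metis (full_types))
  qed simp
  have n: "(\<not> j) \<noteq> wsw u \<longleftrightarrow> \<not> (j \<noteq> wsw u)" by auto
  show ?thesis
    unfolding stretch_def eq same len_append n
    using len_pos[OF assms(1)] len_pos[OF assms(2)] by (simp add: powr_mult less_imp_le)
qed

text \<open>For sides x >= y with exponents \<alpha>, \<beta>, exchanging the roles turns a factor x
  powr (\<alpha> + \<beta> - s) into y powr (\<alpha> + \<beta> - s); the sign of that exponent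
  decides.\<close>

lemma stretch_cmp:
  assumes w: "set w \<subseteq> I"
  shows "s \<le> tau True q + tau False q \<Longrightarrow> stretch s q w j \<le> stretch s q w (big w)"
    and "tau True q + tau False q \<le> s \<Longrightarrow> stretch s q w (big w) \<le> stretch s q w j"
proof -
  define x y \<alpha> \<beta> where "x = len w (big w)" and "y = len w (\<not> big w)"
    and "\<alpha> = tau (big w \<noteq> wsw w) q" and "\<beta> = tau ((\<not> big w) \<noteq> wsw w) q"
  have xy: "0 < y" "y \<le> x" "0 < x"
    using len_pos[OF w] big_le(1)[of w "\<not> big w"] by (auto simp: x_def y_def)
  have ab: "\<alpha> + \<beta> = tau True q + tau False q"
    unfolding \<alpha>_def \<beta>_def by (cases "big w"; cases "wsw w") auto
  have b: "stretch s q w (big w) = x powr (\<alpha> + \<beta> - s) * (x powr (s - \<beta>) * y powr (s - \<alpha>))"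
    unfolding stretch_def x_def[symmetric] y_def[symmetric] \<alpha>_def[symmetric] using xy
    by (simp flip: powr_add mult.assoc)
  have nb: "stretch s q w (\<not> big w) = y powr (\<alpha> + \<beta> - s) * (x powr (s - \<beta>) * y powr (s - \<alpha>))"
  proof -
    have "y powr (\<alpha> + \<beta> - s) * y powr (s - \<alpha>) = y powr \<beta>" by (simp flip: powr_add)
    then show ?thesis
      unfolding stretch_def x_def[symmetric] y_def[symmetric] \<beta>_def[symmetric] not_not
        x_def[symmetric, simplified] by (simp add: x_def[symmetric] mult_ac)
  qed
  have j: "j = big w \<or> j = (\<not> big w)" by auto
  show "stretch s q w j \<le> stretch s q w (big w)" if "s \<le> tau True q + tau False q"
    using j unfolding b[symmetric]
  proof
    assume "j = (\<not> big w)"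
    then show ?thesis unfolding b using nb xy that ab
      by (auto intro!: mult_right_mono powr_mono2)
  qed simp
  show "stretch s q w (big w) \<le> stretch s q w j" if "tau True q + tau False q \<le> s"
    using j unfolding b[symmetric]
  proof
    assume "j = (\<not> big w)"
    then show ?thesis unfolding b using nb xy that ab
      by (auto intro!: mult_right_mono powr_mono2')
  qed simp
qed

text \<open>The longer side of u @ v induces axes for u and v that need not be those of their own
  longer sides; \<open>stretch_cmp\<close> corrects both in the same direction.\<close>

lemma psi_append:
  assumes "set u \<subseteq> I" "set v \<subseteq> I" "0 \<le> q"
  shows "s \<le> tau True q + tau False q \<Longrightarrow> psi S p \<mu> s q (u @ v) \<le> psi S p \<mu> s q u * psi S p \<mu> s q v"
    and "tau True q + tau False q \<le> s \<Longrightarrow> psi S p \<mu> s q u * psi S p \<mu> s q v \<le> psi S p \<mu> s q (u @ v)"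
proof -
  define j where "j = big (u @ v)"
  have wp: "0 < word_prob p u" "0 < word_prob p v" using word_prob_pos assms by auto
  have uv: "psi S p \<mu> s q (u @ v) = (word_prob p u powr q * word_prob p v powr q) * (stretch s q u j * stretch s q v (j \<noteq> wsw u))"
    using assms wp by (simp add: psi_eq stretch_append[OF assms] j_def powr_mult)
  have prod: "psi S p \<mu> s q u * psi S p \<mu> s q v = (word_prob p u powr q * word_prob p v powr q) * (stretch s q u (big u) * stretch s q v (big v))"
    using assms by (simp add: psi_eq)
  show "psi S p \<mu> s q (u @ v) \<le> psi S p \<mu> s q u * psi S p \<mu> s q v" if "s \<le> tau True q + tau False q"
    unfolding uv prod using stretch_cmp(1)[OF assms(1) that] stretch_cmp(1)[OF assms(2) that] stretch_pos assms
    by (intro mult_left_mono mult_mono) (simp_all add: less_imp_le)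
  show "psi S p \<mu> s q u * psi S p \<mu> s q v \<le> psi S p \<mu> s q (u @ v)" if "tau True q + tau False q \<le> s"
    unfolding uv prod using stretch_cmp(2)[OF assms(1) that] stretch_cmp(2)[OF assms(2) that] stretch_pos assms
    by (intro mult_left_mono mult_mono) (simp_all add: less_imp_le)
qed

abbreviation "\<Psi> k s q \<equiv> Psi I S p \<mu> k s q"

lemma words_finite: "finite (words I k)" and card_words: "card (words I k) = card I ^ k"
  unfolding words_def using finite_lists_length_eq[OF fin_I] card_lists_length_eq[OF fin_I] by auto

lemma words_set: "w \<in> words I k \<Longrightarrow> set w \<subseteq> I" "w \<in> words I k \<Longrightarrow> length w = k"
  by (auto simp: words_def)

lemma words_nonempty: "words I k \<noteq> {}"
  using card_words[of k] I_ne fin_I by (metis card.empty card_0_eq power_not_zero)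

lemma Psi_pos: "0 < \<Psi> k s q"
  unfolding Psi_def using words_nonempty words_finite psi_pos words_set by (intro sum_pos) auto

lemma sum_words_add:
  "(\<Sum>w\<in>words I (m + n). h w) = (\<Sum>u\<in>words I m. \<Sum>v\<in>words I n. h (u @ v) :: real)"
proof -
  have img: "words I (m + n) = (\<lambda>(u, v). u @ v) ` (words I m \<times> words I n)"
  proof (intro equalityI subsetI)
    fix w assume w: "w \<in> words I (m + n)"
    then have "(take m w, drop m w) \<in> words I m \<times> words I n"
      using set_take_subset[of m w] set_drop_subset[of m w] by (auto simp: words_def)
    then show "w \<in> (\<lambda>(u, v). u @ v) ` (words I m \<times> words I n)"
      by (rule rev_image_eqI) simp
  qed (auto simp: words_def)
  have "inj_on (\<lambda>(u, v). u @ v) (words I m \<times> words I n)"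
    by (auto simp: inj_on_def words_def)
  then show ?thesis
    unfolding img by (simp add: sum.reindex sum.cartesian_product case_prod_unfold)
qed

lemma Psi_add:
  assumes "0 \<le> q"
  shows "s \<le> tau True q + tau False q \<Longrightarrow> \<Psi> (m + n) s q \<le> \<Psi> m s q * \<Psi> n s q"
    and "tau True q + tau False q \<le> s \<Longrightarrow> \<Psi> m s q * \<Psi> n s q \<le> \<Psi> (m + n) s q"
  unfolding Psi_def sum_words_add sum_product
  by (intro sum_mono psi_append assms words_set; assumption)+

text \<open>Crude exponential bounds on the single terms, needed as the linear bounds in Fekete's
  lemma. M dominates both exponents in \<open>stretch\<close> whatever their signs.\<close>

lemma Psi_bounds:
  assumes q: "0 \<le> q"
  shows "\<exists>B. \<forall>k. \<bar>ln (\<Psi> k s q)\<bar> \<le> B * real k"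
proof -
  define M where "M = \<bar>tau True q\<bar> + \<bar>tau False q\<bar> + \<bar>s\<bar>"
  define l where "l = q * ln pmin + 2 * (M * ln rmin)"
  define u where "u = ln (real (card I)) - 2 * (M * ln rmin)"
  have M: "\<bar>tau j q\<bar> \<le> M" "\<bar>s - tau j q\<bar> \<le> M" for j by (cases j; simp add: M_def)+
  have psi_b: "exp (l * real k) \<le> psi S p \<mu> s q w" "psi S p \<mu> s q w \<le> exp (- 2 * (M * ln rmin) * real k)"
    if "w \<in> words I k" for w k
  proof -
    have w: "set w \<subseteq> I" "length w = k" using words_set that by auto
    have rk: "0 < rmin ^ k" using rmin_pos by simp
    have len_b: "rmin ^ k \<le> len w j" "len w j \<le> 1" for j using len_bounds[OF w(1)] len_le_1[OF w(1)] w(2) by auto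
    have L: "(rmin ^ k) powr M * (rmin ^ k) powr M \<le> stretch s q w j" for j
      unfolding stretch_def using powr_bounds_of_bounds(1)[OF rk len_b] M by (intro mult_mono) auto
    have U: "stretch s q w j \<le> (rmin ^ k) powr (- M) * (rmin ^ k) powr (- M)" for j
      unfolding stretch_def using powr_bounds_of_bounds(2)[OF rk len_b] M by (intro mult_mono) auto
    have e: "(rmin ^ k) powr x = exp (x * ln rmin * real k)" for x
      using rmin_pos by (simp add: powr_def ln_realpow mult_ac)
    have wp: "pmin ^ k \<le> word_prob p w" "word_prob p w \<le> 1" using w
    proof (induction w arbitrary: k)
      case (Cons i w)
      { case 1 then show ?case using pmin_le[of i] pmin_pos Cons.IH(1)[of "length w"] by (auto intro!: mult_mono) }
      { case 2
        have "p i \<le> (\<Sum>i\<in>I. p i)" using fin_I p_pos 2 by (intro member_le_sum) (auto intro: less_imp_le)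
        then have "p i * word_prob p w \<le> 1 * 1"
          using 2 Cons.IH(2)[of "length w"] sum_p word_prob_pos[of w] by (intro mult_mono) auto
        then show ?case by simp }
    qed simp_all
    have "(pmin ^ k) powr q \<le> word_prob p w powr q" using wp q pmin_pos by (intro powr_mono2) auto
    then have 1: "exp (q * ln pmin * real k) \<le> word_prob p w powr q"
      using pmin_pos by (simp add: powr_def ln_realpow mult_ac)
    have "exp (l * real k) = exp (q * ln pmin * real k) * ((rmin ^ k) powr M * (rmin ^ k) powr M)"
      unfolding e by (simp add: l_def algebra_simps flip: exp_add)
    also have "\<dots> \<le> psi S p \<mu> s q w"
      unfolding psi_eq[OF w(1)] using 1 L by (intro mult_mono) auto
    finally show "exp (l * real k) \<le> psi S p \<mu> s q w" .
    have "word_prob p w powr q \<le> 1" using wp q word_prob_pos[OF w(1)] by (simp add: powr_le1)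
    then have "psi S p \<mu> s q w \<le> 1 * ((rmin ^ k) powr (- M) * (rmin ^ k) powr (- M))"
      unfolding psi_eq[OF w(1)] using U stretch_pos[OF w(1)] by (intro mult_mono) (auto intro: less_imp_le)
    also have "\<dots> = exp (- 2 * (M * ln rmin) * real k)"
      unfolding e by (simp add: algebra_simps flip: exp_add)
    finally show "psi S p \<mu> s q w \<le> exp (- 2 * (M * ln rmin) * real k)" .
  qed
  have "\<bar>ln (\<Psi> k s q)\<bar> \<le> (\<bar>l\<bar> + \<bar>u\<bar>) * real k" for k
  proof -
    obtain w where w: "w \<in> words I k" using words_nonempty by blast
    have "exp (l * real k) \<le> psi S p \<mu> s q w" using psi_b w by blast
    also have "\<dots> \<le> \<Psi> k s q" unfolding Psi_def
      using w words_finite psi_pos words_set by (intro member_le_sum) (auto intro: less_imp_le)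
    finally have 1: "l * real k \<le> ln (\<Psi> k s q)" using Psi_pos by (simp add: ln_ge_iff)
    have "\<Psi> k s q \<le> (\<Sum>w\<in>words I k. exp (- 2 * (M * ln rmin) * real k))"
      unfolding Psi_def by (intro sum_mono psi_b)
    also have "\<dots> = exp (u * real k)"
    proof -
      have "0 < card I" using I_ne fin_I by (simp add: card_gt_0_iff)
      then have "real (card I) ^ k = exp (ln (real (card I)) * real k)"
        by (simp add: exp_of_nat2_mult)
      then show ?thesis by (simp add: card_words u_def algebra_simps flip: exp_add)
    qed
    finally have 2: "ln (\<Psi> k s q) \<le> u * real k" using Psi_pos by (metis ln_exp ln_mono)
    have "- l * real k \<le> \<bar>l\<bar> * real k" "u * real k \<le> \<bar>u\<bar> * real k"
      by (intro mult_right_mono; simp)+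
    moreover have "0 \<le> \<bar>l\<bar> * real k" "0 \<le> \<bar>u\<bar> * real k" by simp_all
    ultimately show ?thesis using 1 2 unfolding distrib_right abs_le_iff by linarith
  qed
  then show ?thesis by blast
qed

definition log_pressure :: "real \<Rightarrow> real \<Rightarrow> real" where
  "log_pressure s q = lim (\<lambda>k. ln (\<Psi> k s q) / real k)"

text \<open>Up to s = \<tau>1(q) + \<tau>2(q) the sums are submultiplicative in the length, from
  there on supermultiplicative; Fekete's lemma covers either case.\<close>

lemma log_pressure_LIMSEQ:
  assumes q: "0 \<le> q"
  shows "(\<lambda>k. ln (\<Psi> k s q) / real k) \<longlonglongrightarrow> log_pressure s q"
proof -
  obtain B where B: "\<And>k. \<bar>ln (\<Psi> k s q)\<bar> \<le> B * real k" using Psi_bounds[OF q] by blast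
  have B1: "0 \<le> B" using B[of 1] by simp
  have "convergent (\<lambda>k. ln (\<Psi> k s q) / real k)"
  proof (cases "s \<le> tau True q + tau False q")
    case True
    have "ln (\<Psi> (m + n) s q) \<le> ln (\<Psi> m s q) + ln (\<Psi> n s q) + 0" for m n
      using Psi_add(1)[OF q True, of m n] Psi_pos[of m s q] Psi_pos[of n s q] Psi_pos[of "m + n" s q]
      by (simp flip: ln_mult_pos)
    moreover have "- B * real n - B \<le> ln (\<Psi> n s q)" for n using B[of n] B1 by (simp add: abs_le_iff)
    ultimately show ?thesis by (rule Fekete_subadditive)
  next
    case False
    then have s: "tau True q + tau False q \<le> s" by simp
    have "ln (\<Psi> m s q) + ln (\<Psi> n s q) - 0 \<le> ln (\<Psi> (m + n) s q)" for m n
      using Psi_add(2)[OF q s, of m n] Psi_pos[of m s q] Psi_pos[of n s q] Psi_pos[of "m + n" s q]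
      by (simp flip: ln_mult_pos)
    moreover have "ln (\<Psi> n s q) \<le> B * real n + B" for n using B[of n] B1 by (simp add: abs_le_iff)
    ultimately show ?thesis by (rule Fekete_superadditive)
  qed
  then show ?thesis unfolding log_pressure_def by (simp add: convergent_LIMSEQ_iff)
qed

lemma pressure_eq:
  assumes q: "0 \<le> q"
  shows "pressure I S p \<mu> s q = exp (log_pressure s q)"
proof -
  have "(\<lambda>k. exp (ln (\<Psi> k s q) / real k)) \<longlonglongrightarrow> exp (log_pressure s q)"
    by (intro tendsto_exp log_pressure_LIMSEQ q)
  moreover have "eventually (\<lambda>k. exp (ln (\<Psi> k s q) / real k) = root k (\<Psi> k s q)) sequentially"
    using eventually_gt_at_top[of 0]
  proof eventually_elim
    case (elim k)
    then have "root k (\<Psi> k s q) = \<Psi> k s q powr (1 / real k)"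
      using Psi_pos by (simp add: root_powr_inverse less_imp_le)
    then show ?case using Psi_pos[of k s q] by (simp add: powr_def)
  qed
  ultimately have "(\<lambda>k. root k (\<Psi> k s q)) \<longlonglongrightarrow> exp (log_pressure s q)"
    by (rule Lim_transform_eventually)
  then show ?thesis unfolding pressure_def by (rule limI)
qed

text \<open>Raising s by h multiplies the term of w by the h-th power of its shorter side, which
  lies between rmin ^ k and rmax ^ k.\<close>

lemma Psi_shift:
  assumes h: "0 \<le> h"
  shows "ln (\<Psi> k s q) + h * ln rmin * real k \<le> ln (\<Psi> k (s + h) q)"
    and "ln (\<Psi> k (s + h) q) \<le> ln (\<Psi> k s q) + h * ln rmax * real k"
proof -
  have psi: "psi S p \<mu> (s + h) q w = psi S p \<mu> s q w * len w (\<not> big w) powr h" if "set w \<subseteq> I" for w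
    using that by (simp add: psi_eq stretch_def algebra_simps flip: powr_add)
  have b: "rmin ^ k \<le> len w j" "len w j \<le> rmax ^ k" if "w \<in> words I k" for w j
    using len_bounds words_set that by blast+
  have e: "(r ^ k) powr h = exp (h * ln r * real k)" if "0 < r" for r
    using that by (simp add: powr_def ln_realpow mult_ac)
  have "\<Psi> k s q * (rmin ^ k) powr h \<le> \<Psi> k (s + h) q"
    unfolding Psi_def sum_distrib_right
  proof (rule sum_mono)
    fix w assume w: "w \<in> words I k"
    show "psi S p \<mu> s q w * (rmin ^ k) powr h \<le> psi S p \<mu> (s + h) q w"
      unfolding psi[OF words_set(1)[OF w]] using b[OF w] h rmin_pos psi_pos[OF words_set(1)[OF w], of s q]
      by (intro mult_left_mono powr_mono2) auto
  qed
  then have "ln (\<Psi> k s q * (rmin ^ k) powr h) \<le> ln (\<Psi> k (s + h) q)"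
    using Psi_pos rmin_pos by (intro ln_mono) auto
  then show "ln (\<Psi> k s q) + h * ln rmin * real k \<le> ln (\<Psi> k (s + h) q)"
    using Psi_pos rmin_pos by (simp add: e ln_mult_pos)
  have "\<Psi> k (s + h) q \<le> \<Psi> k s q * (rmax ^ k) powr h"
    unfolding Psi_def sum_distrib_right
  proof (rule sum_mono)
    fix w assume w: "w \<in> words I k"
    show "psi S p \<mu> (s + h) q w \<le> psi S p \<mu> s q w * (rmax ^ k) powr h"
      unfolding psi[OF words_set(1)[OF w]] using b[OF w] h len_pos[OF words_set(1)[OF w]] psi_pos[OF words_set(1)[OF w], of s q]
      by (intro mult_left_mono powr_mono2) (auto intro: less_imp_le)
  qed
  then have "ln (\<Psi> k (s + h) q) \<le> ln (\<Psi> k s q * (rmax ^ k) powr h)"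
    using Psi_pos by (intro ln_mono)
  then show "ln (\<Psi> k (s + h) q) \<le> ln (\<Psi> k s q) + h * ln rmax * real k"
    using Psi_pos rmax_pos by (simp add: e ln_mult_pos)
qed

lemma log_pressure_shift:
  assumes q: "0 \<le> q" and h: "0 \<le> h"
  shows "log_pressure s q - (- ln rmin) * h \<le> log_pressure (s + h) q"
    and "log_pressure (s + h) q \<le> log_pressure s q - (- ln rmax) * h"
proof -
  note lims = log_pressure_LIMSEQ[OF q, of s] log_pressure_LIMSEQ[OF q, of "s + h"]
  have "(\<lambda>k. ln (\<Psi> k s q) / real k - (- ln rmin) * h) \<longlonglongrightarrow> log_pressure s q - (- ln rmin) * h"
    by (intro tendsto_diff lims tendsto_const)
  then show "log_pressure s q - (- ln rmin) * h \<le> log_pressure (s + h) q"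
  proof (rule LIMSEQ_le[OF _ lims(2)], intro exI[of _ 1] allI impI)
    fix k :: nat assume "1 \<le> k"
    then have "ln (\<Psi> k s q) / real k - (- ln rmin) * h = (ln (\<Psi> k s q) + h * ln rmin * real k) / real k"
      by (simp add: add_divide_distrib mult.commute)
    also have "\<dots> \<le> ln (\<Psi> k (s + h) q) / real k"
      by (intro divide_right_mono Psi_shift h) simp
    finally show "ln (\<Psi> k s q) / real k - (- ln rmin) * h \<le> ln (\<Psi> k (s + h) q) / real k" .
  qed
  have "(\<lambda>k. ln (\<Psi> k s q) / real k - (- ln rmax) * h) \<longlonglongrightarrow> log_pressure s q - (- ln rmax) * h"
    by (intro tendsto_diff lims tendsto_const)
  then show "log_pressure (s + h) q \<le> log_pressure s q - (- ln rmax) * h"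
  proof (rule LIMSEQ_le[OF lims(2)], intro exI[of _ 1] allI impI)
    fix k :: nat assume "1 \<le> k"
    have "ln (\<Psi> k (s + h) q) / real k \<le> (ln (\<Psi> k s q) + h * ln rmax * real k) / real k"
      by (intro divide_right_mono Psi_shift h) simp
    also have "\<dots> = ln (\<Psi> k s q) / real k - (- ln rmax) * h"
      using \<open>1 \<le> k\<close> by (simp add: add_divide_distrib mult.commute)
    finally show "ln (\<Psi> k (s + h) q) / real k \<le> ln (\<Psi> k s q) / real k - (- ln rmax) * h" .
  qed
qed

abbreviation "\<gamma> q \<equiv> moment_scaling_gamma I S p \<mu> q"

text \<open>The log pressure falls in s at a rate between -ln rmax and -ln rmin, so it has exactly
  one zero and the \<open>THE\<close> denotes it.\<close>

lemma log_pressure_gamma: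
  assumes q: "0 \<le> q"
  shows "log_pressure (\<gamma> q) q = 0"
proof -
  have pos: "0 < - ln rmax" using rmax_pos rmax_less_1 by simp
  have "\<exists>!s. log_pressure s q = 0"
    by (rule Lipschitz_decreasing_zero[OF pos log_pressure_shift(2)[OF q] log_pressure_shift(1)[OF q]])
  then have "log_pressure (THE s. log_pressure s q = 0) q = 0" by (rule theI')
  then show ?thesis unfolding moment_scaling_gamma_def pressure_eq[OF q] by simp
qed

text \<open>Beyond \<gamma> q the log pressure is negative, so the level sums decay geometrically
  and the series over all words converges. The form with finite sets suits stopping lines, which mix
  word lengths.\<close>

lemma sum_psi_bounded:
  assumes q: "0 \<le> q" and s: "\<gamma> q < s"
  obtains B where "0 < B" "\<And>V. finite V \<Longrightarrow> (\<And>w. w \<in> V \<Longrightarrow> set w \<subseteq> I) \<Longrightarrow> (\<Sum>w\<in>V. psi S p \<mu> s q w) \<le> B"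
proof -
  have "0 < - ln rmax * (s - \<gamma> q)" using s rmax_pos rmax_less_1 by (intro mult_pos_pos) auto
  moreover have "log_pressure s q \<le> log_pressure (\<gamma> q) q - (- ln rmax) * (s - \<gamma> q)"
    using log_pressure_shift(2)[OF q, of "s - \<gamma> q" "\<gamma> q"] s by simp
  ultimately have neg: "log_pressure s q < 0" using log_pressure_gamma[OF q] by simp
  define c where "c = log_pressure s q / 2"
  have c: "log_pressure s q < c" "c < 0" using neg by (auto simp: c_def)
  have "eventually (\<lambda>k. ln (\<Psi> k s q) / real k < c) sequentially"
    using order_tendstoD(2)[OF log_pressure_LIMSEQ[OF q] c(1)] .
  then have ev: "eventually (\<lambda>k. norm (\<Psi> k s q) \<le> exp c ^ k) sequentially"
    using eventually_gt_at_top[of 0]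
  proof eventually_elim
    case (elim k)
    then have "ln (\<Psi> k s q) \<le> real k * c" by (simp add: pos_divide_less_eq mult.commute less_imp_le)
    then have "exp (ln (\<Psi> k s q)) \<le> exp (real k * c)" by (simp only: exp_le_cancel_iff)
    then have "\<Psi> k s q \<le> exp (real k * c)" using Psi_pos[of k s q] by simp
    then show ?case using Psi_pos[of k s q] by (simp add: exp_of_nat_mult)
  qed
  have sm: "summable (\<lambda>k. \<Psi> k s q)"
    using c by (intro summable_comparison_test_ev[OF ev] summable_geometric) simp
  have pos: "0 < (\<Sum>k. \<Psi> k s q)" using sm Psi_pos by (intro suminf_pos)
  show ?thesis
  proof (rule that[OF pos])
    fix V assume V: "finite V" "\<And>w. w \<in> V \<Longrightarrow> set w \<subseteq> I"
    define n where "n = Suc (Max (length ` V))"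
    have n: "length w < n" if "w \<in> V" for w
      unfolding n_def using V(1) that by (simp add: less_Suc_eq_le)
    have disj: "disjoint_family_on (words I) {..<n}" by (auto simp: disjoint_family_on_def words_def)
    have "(\<Sum>w\<in>V. psi S p \<mu> s q w) \<le> (\<Sum>w\<in>(\<Union>k<n. words I k). psi S p \<mu> s q w)"
    proof (rule sum_mono2)
      show "V \<subseteq> (\<Union>k<n. words I k)" using V n by (auto simp: words_def)
      show "0 \<le> psi S p \<mu> s q w" if "w \<in> (\<Union>k<n. words I k) - V" for w
        using that psi_pos words_set by (auto intro: less_imp_le)
    qed (use words_finite in auto)
    also have "\<dots> = (\<Sum>k<n. \<Psi> k s q)"
      unfolding Psi_def using disj words_finite
      by (intro sum.UNION_disjoint) (auto simp: disjoint_family_on_def)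
    also have "\<dots> \<le> (\<Sum>k. \<Psi> k s q)"
      using sm Psi_pos by (intro sum_le_suminf) (auto intro: less_imp_le)
    finally show "(\<Sum>w\<in>V. psi S p \<mu> s q w) \<le> (\<Sum>k. \<Psi> k s q)" .
  qed
qed

end

section \<open>Grid sums in the plane\<close>

text \<open>The lattice point next to z on its right is within h; if it might leave the interval,
  the length 3 * h leaves room on the left. Strict inequalities are needed because the point must
  fall into an open rectangle.\<close>

lemma ex_lattice_point_near:
  fixes h x y z :: real
  assumes h: "0 < h" "3 * h \<le> y - x" and z: "x \<le> z" "z \<le> y"
  shows "\<exists>k::int. x < h * of_int k \<and> h * of_int k < y \<and> \<bar>h * of_int k - z\<bar> \<le> h"
proof (cases "z + h < y")
  case True
  \<comment> \<open>Strictly to the right of z, also when z is itself a lattice point.\<close>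
  define k where "k = \<lfloor>z / h\<rfloor> + 1"
  have "z / h < of_int k" "of_int k \<le> z / h + 1" unfolding k_def by linarith+
  then have "z < h * of_int k" "h * of_int k \<le> z + h"
    using h by (simp_all add: pos_divide_less_eq mult.commute) (simp add: field_simps)
  then show ?thesis using True z h by (intro exI[of _ k]) auto
next
  case False
  define k where "k = \<lceil>z / h\<rceil> - 1"
  have "of_int k < z / h" "z / h - 1 \<le> of_int k" unfolding k_def by linarith+
  then have "h * of_int k < z" "z - h \<le> h * of_int k"
    using h by (simp_all add: pos_less_divide_eq mult.commute) (simp add: field_simps)
  then show ?thesis using False z h by (intro exI[of _ k]) auto
qed

lemma ex_lattice_point_affine:
  fixes h A t l r v :: real
  assumes h: "0 < h" "3 * h \<le> \<bar>A\<bar> * (r - l)" and v: "l \<le> v" "v \<le> r"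
  shows "\<exists>k::int. \<exists>u. l < u \<and> u < r \<and> A * u + t = h * of_int k \<and> \<bar>h * of_int k - (A * v + t)\<bar> \<le> h"
proof -
  have A: "A \<noteq> 0" using h by auto
  show ?thesis
  proof (cases "0 < A")
    case True
    have "3 * h \<le> (A * r + t) - (A * l + t)" "A * l + t \<le> A * v + t" "A * v + t \<le> A * r + t"
      using h v True by (simp_all add: algebra_simps)
    then obtain k :: int where k: "A * l + t < h * of_int k" "h * of_int k < A * r + t"
      "\<bar>h * of_int k - (A * v + t)\<bar> \<le> h"
      using ex_lattice_point_near[OF h(1)] by blast
    then show ?thesis using True
      by (intro exI[of _ k] exI[of _ "(h * of_int k - t) / A"]) (simp add: field_simps)
  next
    case False
    then have neg: "A < 0" using A by simp
    have "3 * h \<le> (A * l + t) - (A * r + t)" "A * r + t \<le> A * v + t" "A * v + t \<le> A * l + t"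
      using h v neg by (simp_all add: algebra_simps)
    then obtain k :: int where k: "A * r + t < h * of_int k" "h * of_int k < A * l + t"
      "\<bar>h * of_int k - (A * v + t)\<bar> \<le> h"
      using ex_lattice_point_near[OF h(1)] by blast
    then show ?thesis using neg
      by (intro exI[of _ k] exI[of _ "(h * of_int k - t) / A"]) (simp add: field_simps)
  qed
qed

lemma sum_Times_coord:
  fixes F H :: "'a \<Rightarrow> real"
  shows "(\<Sum>z\<in>G \<times> G. F (coord j z) * H (coord (\<not> j) z)) = (\<Sum>m\<in>G. F m) * (\<Sum>m\<in>G. H m)"
proof (cases j)
  case True
  then show ?thesis by (simp add: sum_product sum.cartesian_product case_prod_unfold)
next
  case False
  then have "(\<Sum>z\<in>G \<times> G. F (coord j z) * H (coord (\<not> j) z)) = (\<Sum>z\<in>G \<times> G. H (fst z) * F (snd z))"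
    by (simp add: mult.commute)
  also have "\<dots> = (\<Sum>m\<in>G. H m) * (\<Sum>m\<in>G. F m)"
    by (simp add: sum_product sum.cartesian_product case_prod_unfold)
  finally show ?thesis by (simp add: mult.commute)
qed

section \<open>Squares of the planar grid\<close>

definition cell2 :: "real \<Rightarrow> int \<times> int \<Rightarrow> (real \<times> real) set" where
  "cell2 a k = cell a (fst k) \<times> cell a (snd k)"

definition grid_sum2 :: "(real \<times> real) measure \<Rightarrow> real \<Rightarrow> real \<Rightarrow> real" where
  "grid_sum2 \<mu> q a = (\<Sum>k\<in>grid a \<times> grid a. measure \<mu> (cell2 a k) powr q)"

lemma mem_cell2_iff: "z \<in> cell2 a k \<longleftrightarrow> (\<forall>j. coord j z \<in> cell a (coord j k))"
  by (simp add: cell2_def mem_Times_iff all_bool_eq)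

lemma cell2_borel [measurable]: "cell2 a k \<in> sets borel"
  unfolding cell2_def cell_def by (intro borel_closed closed_Times closed_atLeastAtMost)

section \<open>The open rectangle and its images\<close>

locale coordinate_rosc = coordinate_ifs I S p \<mu> sw A t
  for I :: "'i set" and S p \<mu> sw A t +
  fixes lo hi :: "bool \<Rightarrow> real" and R :: "(real \<times> real) set"
  assumes lo_less_hi: "lo j < hi j"
    and R_def: "R = {lo True<..<hi True} \<times> {lo False<..<hi False}"
    and S_R: "i \<in> I \<Longrightarrow> S i ` R \<subseteq> R"
    and disjoint_S_R: "disjoint_family_on (\<lambda>i. S i ` R) I"
begin

lemma mem_R_iff: "z \<in> R \<longleftrightarrow> (\<forall>j. lo j < coord j z \<and> coord j z < hi j)"
  by (auto simp: R_def mem_Times_iff all_bool_eq)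

lemma mem_closure_R_iff: "z \<in> closure R \<longleftrightarrow> (\<forall>j. lo j \<le> coord j z \<and> coord j z \<le> hi j)"
  using lo_less_hi[of True] lo_less_hi[of False]
  by (auto simp: R_def closure_Times mem_Times_iff all_bool_eq)

lemma AE_closure_R: "AE z in \<mu>. z \<in> closure R"
proof (rule AE_closed_invariant)
  have "((lo True + hi True) / 2, (lo False + hi False) / 2) \<in> R"
    using lo_less_hi[of True] lo_less_hi[of False] by (simp add: R_def)
  then show "closure R \<noteq> {}" using closure_subset by blast
  fix i assume i: "i \<in> I"
  have "word_map S [i] ` closure R \<subseteq> closure R"
  proof (rule image_closure_subset)
    show "continuous_on (closure R) (word_map S [i])"
      using continuous_word_map[of "[i]"] i by (auto intro: continuous_on_subset)
    show "word_map S [i] ` R \<subseteq> closure R" using S_R[OF i] closure_subset[of R] by auto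
  qed simp
  then show "S i ` closure R \<subseteq> closure R" by simp
qed simp

lemma word_map_R: "set w \<subseteq> I \<Longrightarrow> word_map S w ` R \<subseteq> R"
proof (induction w)
  case (Cons i w)
  then have "word_map S w ` R \<subseteq> R" "S i ` R \<subseteq> R" using S_R by auto
  then show ?case by (simp add: image_comp[symmetric]) blast
qed simp

lemma inj_S: "i \<in> I \<Longrightarrow> inj (S i)"
proof (rule injI)
  fix x y assume i: "i \<in> I" and eq: "S i x = S i y"
  have "A i j \<noteq> 0" for j using A_bounds[OF i, of j] by auto
  then have "coord (j \<noteq> sw i) x = coord (j \<noteq> sw i) y" for j
    using coord_S[OF i, of j x] coord_S[OF i, of j y] eq by simp
  then have "coord ((j \<noteq> sw i) \<noteq> sw i) x = coord ((j \<noteq> sw i) \<noteq> sw i) y" for j by blast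
  moreover have "((j \<noteq> sw i) \<noteq> sw i) = j" for j by auto
  ultimately show "x = y" by (simp add: prod_eq_coord_iff)
qed

text \<open>Incomparable words differ at a first letter. Before it both apply the same injective
  map, and at it the open set condition separates the images.\<close>

lemma disjoint_word_map_R:
  "set u \<subseteq> I \<Longrightarrow> set v \<subseteq> I \<Longrightarrow> (\<And>x. v \<noteq> u @ x) \<Longrightarrow> (\<And>x. u \<noteq> v @ x) \<Longrightarrow>
    word_map S u ` R \<inter> word_map S v ` R = {}"
proof (induction u arbitrary: v)
  case (Cons i u)
  obtain k v' where v: "v = k # v'" using Cons.prems(4)[of "i # u"] by (cases v) auto
  have ik: "i \<in> I" "k \<in> I" "set u \<subseteq> I" "set v' \<subseteq> I" using Cons.prems v by auto
  show ?case
  proof (cases "i = k")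
    case True
    have "word_map S u ` R \<inter> word_map S v' ` R = {}"
    proof (rule Cons.IH)
      show "v' \<noteq> u @ x" for x using Cons.prems(3)[of x] v True by auto
      show "u \<noteq> v' @ x" for x using Cons.prems(4)[of x] v True by auto
    qed (use ik in auto)
    then have "S i ` (word_map S u ` R) \<inter> S i ` (word_map S v' ` R) = {}"
      using image_Int[OF inj_S[OF ik(1)]] by (metis image_empty)
    then show ?thesis using v True by (simp add: image_comp)
  next
    case False
    have "S i ` R \<inter> S k ` R = {}"
      using disjoint_S_R ik False by (auto simp: disjoint_family_on_def)
    moreover have "word_map S (i # u) ` R \<subseteq> S i ` R" "word_map S v ` R \<subseteq> S k ` R"
      using word_map_R ik v by (auto simp: image_comp[symmetric])
    ultimately show ?thesis by blast
  qed
qed auto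

lemma word_map_eqI:
  assumes w: "set w \<subseteq> I" and eq: "\<And>j. coord j z = wA w j * u (j \<noteq> wsw w) + coord j (word_map S w 0)"
  shows "z = word_map S w (u True, u False)"
proof -
  have "coord j (u True, u False) = u j" for j by (cases j) auto
  then have "coord j (word_map S w (u True, u False)) = coord j z" for j
    using coord_word_map[OF w, of j "(u True, u False)"] eq[of j] by simp
  then show ?thesis by (simp add: prod_eq_coord_iff)
qed

end

text \<open>Words are now stopped when either side first falls to \<delta>: the shorter side is then
  at most \<delta>, and both are at least rmin * \<delta>.\<close>

locale coordinate_rosc_cut = coordinate_rosc I S p \<mu> sw A t lo hi R
  for I :: "'i set" and S p \<mu> sw A t lo hi R +
  fixes \<delta> :: real
  assumes \<delta>: "0 < \<delta>" "\<delta> \<le> 1"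
begin

definition "V = cut_set I (\<lambda>w. \<exists>j. len w j \<le> \<delta>)"

lemma V_words: "w \<in> V \<Longrightarrow> set w \<subseteq> I"
  by (simp add: V_def cut_set_def)

lemma cut_complete: "\<exists>n. \<forall>w. set w \<subseteq> I \<longrightarrow> length w = n \<longrightarrow> (\<exists>j. len w j \<le> \<delta>)"
proof -
  obtain n where "rmax ^ n \<le> \<delta>" using ex_power_le[OF \<delta>(1)] by blast
  then have "len w True \<le> \<delta>" if "set w \<subseteq> I" "length w = n" for w
    using len_bounds[OF that(1), of True] that(2) by simp
  then show ?thesis by blast
qed

lemma finite_V: "finite V"
proof -
  obtain n where "\<And>w. set w \<subseteq> I \<Longrightarrow> length w = n \<Longrightarrow> \<exists>j. len w j \<le> \<delta>" using cut_complete by blast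
  then show ?thesis unfolding V_def by (rule finite_cut_set[OF fin_I])
qed

lemma prob_V: "E \<in> sets borel \<Longrightarrow> prob E = (\<Sum>w\<in>V. word_prob p w * prob (word_map S w -` E))"
proof -
  assume E: "E \<in> sets borel"
  obtain n where n: "\<And>w. set w \<subseteq> I \<Longrightarrow> length w = n \<Longrightarrow> \<exists>j. len w j \<le> \<delta>" using cut_complete by blast
  show ?thesis unfolding V_def by (rule prob_cut_set[OF n E])
qed

lemma len_V: "w \<in> V \<Longrightarrow> len w (\<not> big w) \<le> \<delta>" "w \<in> V \<Longrightarrow> rmin * \<delta> \<le> len w j"
proof -
  assume w: "w \<in> V"
  then obtain i where "len w i \<le> \<delta>" by (auto simp: V_def cut_set_def)
  then show "len w (\<not> big w) \<le> \<delta>" using big_le(2)[of w i] by simp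
  show "rmin * \<delta> \<le> len w j"
  proof (cases w rule: rev_cases)
    case Nil
    then show ?thesis using \<delta> rmin_pos rmin_less_1 mult_mono[of rmin 1 \<delta> 1] by (simp add: len_def)
  next
    case (snoc u i)
    then have u: "\<delta> < len u j" "set u \<subseteq> I" "i \<in> I" using w by (auto simp: V_def cut_set_def not_le)
    then have "rmin * \<delta> \<le> rmin * len u j" using rmin_pos by simp
    then show ?thesis using len_snoc(1)[OF u(2,3), of j] snoc by simp
  qed
qed

text \<open>A third of a lower bound for the sides of the images of R under stopped words, as
  \<open>ex_lattice_point_affine\<close> requires.\<close>

definition "h = rmin * \<delta> * min (hi True - lo True) (hi False - lo False) / 3"

lemma h_pos: "0 < h"
  using rmin_pos \<delta> lo_less_hi[of True] lo_less_hi[of False] by (simp add: h_def)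

lemma h_le: "w \<in> V \<Longrightarrow> 3 * h \<le> \<bar>wA w j\<bar> * (hi i - lo i)"
proof -
  assume w: "w \<in> V"
  have "3 * h = rmin * \<delta> * min (hi True - lo True) (hi False - lo False)" by (simp add: h_def)
  also have "\<dots> \<le> len w j * (hi i - lo i)"
    using len_V(2)[OF w, of j] rmin_pos \<delta> lo_less_hi[of True] lo_less_hi[of False]
    by (intro mult_mono) (cases i; simp add: len_def)+
  finally show ?thesis by (simp add: len_def)
qed

text \<open>The rectangles \<open>S\<^sub>w(R)\<close> are disjoint with sides comparable to \<open>\<delta>\<close>, so each contains its own
  point of a lattice of comparable mesh.\<close>

lemma card_meeting_le:
  assumes meets: "\<And>w. w \<in> U \<Longrightarrow> w \<in> V \<and> word_map S w ` closure R \<inter> cell2 \<delta> k \<noteq> {}"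
  shows "real (card U) \<le> (2 * (\<delta> + 2 * h) / h + 2)\<^sup>2"
proof -
  \<comment> \<open>The lattice point will be chosen within h, in each coordinate, of a point where
    the rectangle meets the square.\<close>
  define E where "E j = {x. \<exists>y\<in>cell \<delta> (coord j k). \<bar>x - y\<bar> \<le> h}" for j
  define L where "L j = {m. cell h m \<inter> E j \<noteq> {}}" for j
  have Ed: "\<bar>x - y\<bar> \<le> \<delta> + 2 * h" if xy: "x \<in> E j" "y \<in> E j" for x y j
  proof -
    obtain x' y' where "x' \<in> cell \<delta> (coord j k)" "\<bar>x - x'\<bar> \<le> h" "y' \<in> cell \<delta> (coord j k)" "\<bar>y - y'\<bar> \<le> h"
      using xy unfolding E_def by blast
    then show ?thesis using cell_diam[of x' \<delta> "coord j k" y'] by linarith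
  qed
  have L: "finite (L j)" "real (card (L j)) \<le> 2 * (\<delta> + 2 * h) / h + 2" for j
    unfolding L_def using cells_meeting[OF h_pos, of "\<delta> + 2 * h" "E j"] Ed h_pos \<delta> by auto
  have ex: "\<exists>l\<in>L True \<times> L False. (h * of_int (fst l), h * of_int (snd l)) \<in> word_map S w ` R" if wU: "w \<in> U" for w
  proof -
    have w: "w \<in> V" "set w \<subseteq> I" using meets[OF wU] V_words by auto
    obtain v where v: "v \<in> closure R" "word_map S w v \<in> cell2 \<delta> k" using meets[OF wU] by blast
    define tr where "tr j = coord j (word_map S w 0)" for j
    have "\<exists>l::int. \<exists>u. lo (j \<noteq> wsw w) < u \<and> u < hi (j \<noteq> wsw w) \<and> wA w j * u + tr j = h * of_int l \<and>
        \<bar>h * of_int l - (wA w j * coord (j \<noteq> wsw w) v + tr j)\<bar> \<le> h" for j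
      using v(1) by (intro ex_lattice_point_affine h_pos h_le w) (auto simp: mem_closure_R_iff)
    then obtain l u where l: "\<And>j. lo (j \<noteq> wsw w) < u j" "\<And>j. u j < hi (j \<noteq> wsw w)"
      "\<And>j. wA w j * u j + tr j = h * of_int (l j)"
      "\<And>j. \<bar>h * of_int (l j) - (wA w j * coord (j \<noteq> wsw w) v + tr j)\<bar> \<le> h"
      by metis
    have inL: "l j \<in> L j" for j
    proof -
      have "wA w j * coord (j \<noteq> wsw w) v + tr j \<in> cell \<delta> (coord j k)"
      proof -
        have "coord j (word_map S w v) \<in> cell \<delta> (coord j k)" using v(2) by (simp add: mem_cell2_iff)
        then show ?thesis by (simp only: coord_word_map[OF w(2), of j v] tr_def)
      qed
      then have "h * of_int (l j) \<in> E j" using l(4)[of j] unfolding E_def by blast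
      moreover have "h * of_int (l j) \<in> cell h (l j)" using h_pos by (simp add: cell_def)
      ultimately show ?thesis unfolding L_def by blast
    qed
    \<comment> \<open>u is indexed by the axes of the image; u' reads it by the axes of the
      source.\<close>
    define u' where "u' j = u (j \<noteq> wsw w)" for j
    have inv: "((j \<noteq> wsw w) \<noteq> wsw w) = j" for j by auto
    have "(h * of_int (l True), h * of_int (l False)) = word_map S w (u' True, u' False)"
    proof (rule word_map_eqI[OF w(2)])
      fix j
      have "coord j (h * of_int (l True), h * of_int (l False)) = h * of_int (l j)" by (cases j) auto
      then show "coord j (h * of_int (l True), h * of_int (l False))
          = wA w j * u' (j \<noteq> wsw w) + coord j (word_map S w 0)"
        using l(3)[of j] unfolding u'_def inv tr_def by simp
    qed
    moreover have "(u' True, u' False) \<in> R"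
    proof -
      have "coord j (u' True, u' False) = u' j" for j by (cases j) auto
      moreover have "lo j < u' j" "u' j < hi j" for j
        using l(1)[of "j \<noteq> wsw w"] l(2)[of "j \<noteq> wsw w"] unfolding u'_def inv by auto
      ultimately show ?thesis by (simp add: mem_R_iff)
    qed
    ultimately show ?thesis using inL by (intro bexI[of _ "(l True, l False)"]) auto
  qed
  then obtain l where l: "\<And>w. w \<in> U \<Longrightarrow> l w \<in> L True \<times> L False"
    "\<And>w. w \<in> U \<Longrightarrow> (h * of_int (fst (l w)), h * of_int (snd (l w))) \<in> word_map S w ` R"
    by metis
  have "inj_on l U"
  proof (rule inj_onI, rule ccontr)
    fix w w' assume w: "w \<in> U" "w' \<in> U" "l w = l w'" "w \<noteq> w'"
    then have wV: "w \<in> V" "w' \<in> V" using meets by auto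
    have "word_map S w ` R \<inter> word_map S w' ` R = {}"
    proof (rule disjoint_word_map_R)
      show "w' \<noteq> w @ x" for x using cut_set_not_prefix[of w] wV w(4) unfolding V_def by fastforce
      show "w \<noteq> w' @ x" for x using cut_set_not_prefix[of w'] wV w(4) unfolding V_def by fastforce
    qed (use V_words wV in auto)
    then show False using l(2)[OF w(1)] l(2)[OF w(2)] w(3) by auto
  qed
  then have "card U \<le> card (L True \<times> L False)"
  proof (rule card_inj_on_le)
    show "l ` U \<subseteq> L True \<times> L False" using l(1) by (rule image_subsetI)
    show "finite (L True \<times> L False)" using L(1) by simp
  qed
  then have "real (card U) \<le> real (card (L True)) * real (card (L False))"
    by (simp add: card_cartesian_product flip: of_nat_mult)
  also have "\<dots> \<le> (2 * (\<delta> + 2 * h) / h + 2) * (2 * (\<delta> + 2 * h) / h + 2)"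
    using L h_pos \<delta> by (intro mult_mono) auto
  finally show ?thesis by (simp add: power2_eq_square)
qed

text \<open>Across its shorter side a piece meets at most 2 * \<delta> / \<delta> + 2 = 4 rows of
  squares. Along the longer side the squares see an affine copy of one projection, and rescaling by
  that side makes their mesh comparable with the ratio of the sides.\<close>

lemma sum_piece2_le:
  assumes w: "w \<in> V" and q: "0 \<le> q"
  shows "(\<Sum>k\<in>grid \<delta> \<times> grid \<delta>. prob (word_map S w -` cell2 \<delta> k) powr q)
    \<le> 4 * (2 / rmin + 2) powr (q + 1) * grid_sum (\<nu> (big w \<noteq> wsw w)) q (len w (\<not> big w) / len w (big w))"
proof -
  define j where "j = big w"
  define F where "F m = measure (\<nu> (j \<noteq> wsw w)) {z. wA w j * z + coord j (word_map S w 0) \<in> cell \<delta> m} powr q" for m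
  define E where "E = (\<lambda>z. coord (\<not> j) (word_map S w z)) ` ({0..1} \<times> {0..1})"
  define H where "H m = (of_bool (cell \<delta> m \<inter> E \<noteq> {}) :: real)" for m
  have wI: "set w \<subseteq> I" using V_words w by blast
  have le: "prob (word_map S w -` cell2 \<delta> k) powr q \<le> F (coord j k) * H (coord (\<not> j) k)" for k
  proof (cases "cell \<delta> (coord (\<not> j) k) \<inter> E = {}")
    case True
    have b: "word_map S w -` cell2 \<delta> k \<in> events"
      using word_map_vimage_borel[OF wI cell2_borel] sets_mu by simp
    have "AE z in \<mu>. z \<notin> word_map S w -` cell2 \<delta> k"
      using AE_unit_square
    proof eventually_elim
      case (elim z)
      then have "coord (\<not> j) (word_map S w z) \<in> E" unfolding E_def by blast
      then show ?case using True by (auto simp: mem_cell2_iff)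
    qed
    then have "prob (word_map S w -` cell2 \<delta> k) = 0" using prob_eq_0[OF b] by simp
    then show ?thesis by (simp add: F_def H_def)
  next
    case False
    have c: "coord j -` cell \<delta> (coord j k) \<in> sets borel"
      using measurable_sets[OF borel_measurable_coord cell_borel] by simp
    have "prob (word_map S w -` cell2 \<delta> k) \<le> prob (word_map S w -` coord j -` cell \<delta> (coord j k))"
      using word_map_vimage_borel[OF wI c] sets_mu by (intro finite_measure_mono) (auto simp: mem_cell2_iff)
    then show ?thesis unfolding F_def H_def prob_coord_word[OF wI cell_borel, symmetric]
      using False q by (simp add: powr_mono2)
  qed
  have Ed: "\<bar>x - y\<bar> \<le> \<delta>" if "x \<in> E" "y \<in> E" for x y
  proof -
    obtain u v where uv: "u \<in> {0..1} \<times> {0..1}" "x = coord (\<not> j) (word_map S w u)"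
      "v \<in> {0..1} \<times> {0..1}" "y = coord (\<not> j) (word_map S w v)" using \<open>x \<in> E\<close> \<open>y \<in> E\<close> unfolding E_def by blast
    define i where "i = ((\<not> j) \<noteq> wsw w)"
    have "x - y = wA w (\<not> j) * (coord i u - coord i v)"
      unfolding uv(2,4) using coord_word_map[OF wI, of "\<not> j" u] coord_word_map[OF wI, of "\<not> j" v]
      by (simp add: algebra_simps i_def)
    then have "\<bar>x - y\<bar> = len w (\<not> j) * \<bar>coord i u - coord i v\<bar>" by (simp add: abs_mult len_def)
    also have "\<dots> \<le> \<delta> * 1"
    proof (intro mult_mono)
      have "coord i u \<in> {0..1}" "coord i v \<in> {0..1}" using uv by (auto simp: mem_Times_coord_iff)
      then show "\<bar>coord i u - coord i v\<bar> \<le> 1" by (auto simp: abs_le_iff)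
    qed (use len_V(1)[OF w] \<delta> in \<open>auto simp: j_def\<close>)
    finally show ?thesis by simp
  qed
  have fin: "finite (grid \<delta>)" using finite_grid \<delta> by simp
  have sumH: "(\<Sum>m\<in>grid \<delta>. H m) \<le> 4"
  proof -
    have "(\<Sum>m\<in>grid \<delta>. H m) = real (card {m\<in>grid \<delta>. cell \<delta> m \<inter> E \<noteq> {}})"
      unfolding H_def using fin by (simp add: sum.inter_filter[symmetric] of_bool_def)
    also have "\<dots> \<le> real (card {m. cell \<delta> m \<inter> E \<noteq> {}})"
      using cells_meeting(1)[of \<delta> \<delta> E] Ed \<delta> by (intro of_nat_mono card_mono) auto
    also have "\<dots> \<le> 2 * \<delta> / \<delta> + 2" using cells_meeting(2)[of \<delta> \<delta> E] Ed \<delta> by auto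
    finally show ?thesis using \<delta> by simp
  qed
  have lp: "0 < len w (\<not> j)" "0 < len w j" using len_pos[OF wI] by auto
  have sumF: "(\<Sum>m\<in>grid \<delta>. F m)
      \<le> (2 / rmin + 2) powr (q + 1) * grid_sum (\<nu> (j \<noteq> wsw w)) q (len w (\<not> j) / len w j)"
  proof -
    have eq: "\<bar>wA w j\<bar> * (len w (\<not> j) / len w j) = len w (\<not> j)" using lp by (simp add: len_def)
    have "rmin * len w (\<not> j) \<le> 1 * \<delta>"
      using len_V(1)[OF w] rmin_pos rmin_less_1 lp by (intro mult_mono) (auto simp: j_def)
    then have k: "\<delta> \<le> 1 / rmin * len w (\<not> j)" "len w (\<not> j) \<le> 1 / rmin * \<delta>"
      using len_V(2)[OF w, of "\<not> j"] rmin_pos by (simp_all add: field_simps)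
    show ?thesis
      using nu.grid_sum_affine_le[where A = "wA w j" and a = \<delta> and b = "len w (\<not> j) / len w j" and q = q
          and \<kappa> = "1 / rmin" and M = "grid \<delta>" and t = "coord j (word_map S w 0)" and j = "j \<noteq> wsw w"]
        wA_nonzero[OF wI] \<delta>(1) q lp fin k unfolding eq F_def by simp
  qed
  have "(\<Sum>k\<in>grid \<delta> \<times> grid \<delta>. prob (word_map S w -` cell2 \<delta> k) powr q)
      \<le> (\<Sum>k\<in>grid \<delta> \<times> grid \<delta>. F (coord j k) * H (coord (\<not> j) k))"
    by (intro sum_mono le)
  also have "\<dots> = (\<Sum>m\<in>grid \<delta>. F m) * (\<Sum>m\<in>grid \<delta>. H m)" by (rule sum_Times_coord)
  also have "\<dots> \<le> ((2 / rmin + 2) powr (q + 1) * grid_sum (\<nu> (j \<noteq> wsw w)) q (len w (\<not> j) / len w j)) * 4"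
    using nu.grid_sum_pos[of "len w (\<not> j) / len w j" "j \<noteq> wsw w" q] lp
    by (intro mult_mono sumF sumH mult_nonneg_nonneg sum_nonneg) (auto simp: H_def)
  finally show ?thesis by (simp add: j_def mult_ac)
qed

lemma grid_sum2_le:
  assumes q: "0 \<le> q"
  shows "grid_sum2 \<mu> q \<delta> \<le> ((2 * (\<delta> + 2 * h) / h + 2)\<^sup>2) powr q * (4 * (2 / rmin + 2) powr (q + 1)) *
    (\<Sum>w\<in>V. word_prob p w powr q * grid_sum (\<nu> (big w \<noteq> wsw w)) q (len w (\<not> big w) / len w (big w)))"
proof -
  define y where "y k w = word_prob p w * prob (word_map S w -` cell2 \<delta> k)" for k w
  define M where "M = (2 * (\<delta> + 2 * h) / h + 2)\<^sup>2"
  have y0: "0 \<le> y k w" if "w \<in> V" for k w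
    unfolding y_def using word_prob_pos[OF V_words[OF that]] by simp
  have "prob (cell2 \<delta> k) powr q \<le> M powr q * (\<Sum>w\<in>V. y k w powr q)" for k
  proof -
    \<comment> \<open>Since \<mu> is carried by the closure of R, a word charging the square has its
      image of this closure meet the square; M bounds the number of such words.\<close>
    define U where "U = {w\<in>V. y k w \<noteq> 0}"
    have "real (card U) \<le> M"
      unfolding M_def
    proof (rule card_meeting_le)
      fix w assume "w \<in> U"
      then have w: "w \<in> V" "y k w \<noteq> 0" by (auto simp: U_def)
      show "w \<in> V \<and> word_map S w ` closure R \<inter> cell2 \<delta> k \<noteq> {}"
      proof (rule conjI[OF w(1)], rule notI)
        assume e: "word_map S w ` closure R \<inter> cell2 \<delta> k = {}"
        have b: "word_map S w -` cell2 \<delta> k \<in> events"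
          using word_map_vimage_borel[OF V_words[OF w(1)] cell2_borel] sets_mu by simp
        have "AE z in \<mu>. z \<notin> word_map S w -` cell2 \<delta> k"
          using AE_closure_R by eventually_elim (use e in blast)
        then have "prob (word_map S w -` cell2 \<delta> k) = 0" using prob_eq_0[OF b] by simp
        then show False using w(2) by (simp add: y_def)
      qed
    qed
    moreover have "prob (cell2 \<delta> k) = (\<Sum>w\<in>U. y k w)"
      unfolding prob_V[OF cell2_borel] y_def[symmetric] U_def
      using finite_V by (intro sum.mono_neutral_right) auto
    moreover have "(\<Sum>w\<in>V. y k w powr q) = (\<Sum>w\<in>U. y k w powr q)"
      unfolding U_def using finite_V by (intro sum.mono_neutral_right) auto
    ultimately show ?thesis
      using finite_V y0 q by (simp only:) (intro powr_sum_le; auto simp: U_def)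
  qed
  then have "grid_sum2 \<mu> q \<delta> \<le> (\<Sum>k\<in>grid \<delta> \<times> grid \<delta>. M powr q * (\<Sum>w\<in>V. y k w powr q))"
    unfolding grid_sum2_def by (intro sum_mono)
  also have "\<dots> = M powr q * (\<Sum>w\<in>V. \<Sum>k\<in>grid \<delta> \<times> grid \<delta>. y k w powr q)"
    unfolding sum_distrib_left[symmetric] by (subst sum.swap) simp
  also have "\<dots> \<le> M powr q * (\<Sum>w\<in>V. word_prob p w powr q * (4 * (2 / rmin + 2) powr (q + 1) *
      grid_sum (\<nu> (big w \<noteq> wsw w)) q (len w (\<not> big w) / len w (big w))))"
  proof (intro mult_left_mono sum_mono)
    fix w assume w: "w \<in> V"
    have "(\<Sum>k\<in>grid \<delta> \<times> grid \<delta>. y k w powr q)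
        = word_prob p w powr q * (\<Sum>k\<in>grid \<delta> \<times> grid \<delta>. prob (word_map S w -` cell2 \<delta> k) powr q)"
      unfolding y_def sum_distrib_left
      using word_prob_pos[OF V_words[OF w]] by (intro sum.cong refl) (simp add: powr_mult)
    also have "\<dots> \<le> word_prob p w powr q * (4 * (2 / rmin + 2) powr (q + 1) *
        grid_sum (\<nu> (big w \<noteq> wsw w)) q (len w (\<not> big w) / len w (big w)))"
      by (intro mult_left_mono sum_piece2_le w q) simp
    finally show "(\<Sum>k\<in>grid \<delta> \<times> grid \<delta>. y k w powr q) \<le> \<dots>" .
  qed simp
  also have "\<dots> = M powr q * (4 * (2 / rmin + 2) powr (q + 1)) *
    (\<Sum>w\<in>V. word_prob p w powr q * grid_sum (\<nu> (big w \<noteq> wsw w)) q (len w (\<not> big w) / len w (big w)))"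
    by (simp add: sum_distrib_left mult_ac)
  finally show ?thesis unfolding M_def .
qed

text \<open>h is proportional to \<delta>, so the overlap bound is the same at every mesh.\<close>

lemma mesh_ratio_const:
  "2 * (\<delta> + 2 * h) / h + 2 = 6 / (rmin * min (hi True - lo True) (hi False - lo False)) + 6"
proof -
  have "2 * (\<delta> + 2 * h) / h + 2 = 2 * (\<delta> / h) + 6" using h_pos by (simp add: field_simps)
  also have "\<delta> / h = 3 / (rmin * min (hi True - lo True) (hi False - lo False))"
    using \<delta> by (simp add: h_def)
  finally show ?thesis by simp
qed

end

section \<open>Growth of the planar grid sums\<close>

context coordinate_rosc
begin

lemma grid_sum2_growth:
  assumes q: "0 \<le> q" and s: "\<gamma> q < s"
  obtains C where "0 < C" "\<And>\<delta>. 0 < \<delta> \<Longrightarrow> \<delta> \<le> 1 \<Longrightarrow> grid_sum2 \<mu> q \<delta> \<le> C * \<delta> powr (- s)"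
proof -
  \<comment> \<open>The gap is shared: r > \<gamma> q bounds the sums of \<psi>, and \<epsilon> = s
    - r pays for the error in the exponents of the projections.\<close>
  define r where "r = (\<gamma> q + s) / 2"
  define \<epsilon> where "\<epsilon> = s - r"
  have r: "\<gamma> q < r" "0 < \<epsilon>" "s = r + \<epsilon>" using s by (auto simp: r_def \<epsilon>_def)
  obtain B where B: "0 < B" "\<And>V. finite V \<Longrightarrow> (\<And>w. w \<in> V \<Longrightarrow> set w \<subseteq> I) \<Longrightarrow> (\<Sum>w\<in>V. psi S p \<mu> r q w) \<le> B"
    using sum_psi_bounded[OF q r(1)] by blast
  have "\<exists>C>0. \<forall>\<delta>. 0 < \<delta> \<longrightarrow> \<delta> \<le> 1 \<longrightarrow> grid_sum (\<nu> j) q \<delta> \<le> C * \<delta> powr (- (tau j q + \<epsilon>))" for j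
    using growth_exponent_upper[OF growth_exponent_grid_sum[OF q, of j] r(2)] by metis
  then obtain C0 where C0: "\<And>j. 0 < C0 j"
    "\<And>j \<delta>. 0 < \<delta> \<Longrightarrow> \<delta> \<le> 1 \<Longrightarrow> grid_sum (\<nu> j) q \<delta> \<le> C0 j * \<delta> powr (- (tau j q + \<epsilon>))"
    by metis
  define C1 where "C1 = C0 True + C0 False"
  have C1: "C0 j \<le> C1" for j using C0(1)[of True] C0(1)[of False] by (cases j) (auto simp: C1_def)
  define M where "M = ((6 / (rmin * min (hi True - lo True) (hi False - lo False)) + 6)\<^sup>2) powr q *
      (4 * (2 / rmin + 2) powr (q + 1))"
  \<comment> \<open>The sign of s is unknown and y / \<delta> lies in [rmin, 1], hence -|s|. The
    added 1 makes C positive.\<close>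
  define C where "C = M * (C1 * rmin powr (- \<bar>s\<bar>) * B) + 1"
  have M: "0 \<le> M" by (simp add: M_def)
  have C1p: "0 < C1" using C0(1)[of True] C1[of True] by simp
  show ?thesis
  proof (rule that)
    have "0 \<le> M * (C1 * rmin powr (- \<bar>s\<bar>) * B)" using M C1p B(1) by (intro mult_nonneg_nonneg) auto
    then show "0 < C" by (simp add: C_def)
    fix \<delta> :: real assume d: "0 < \<delta>" "\<delta> \<le> 1"
    interpret coordinate_rosc_cut I S p \<mu> sw A t lo hi R \<delta> by unfold_locales (use d in auto)
    have term_le: "word_prob p w powr q * grid_sum (\<nu> (big w \<noteq> wsw w)) q (len w (\<not> big w) / len w (big w))
        \<le> C1 * rmin powr (- \<bar>s\<bar>) * \<delta> powr (- s) * psi S p \<mu> r q w" if w: "w \<in> V" for w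
    proof -
      define x y \<tau> where "x = len w (big w)" and "y = len w (\<not> big w)" and "\<tau> = tau (big w \<noteq> wsw w) q"
      have wI: "set w \<subseteq> I" using V_words[OF w] .
      have xy: "0 < y" "y \<le> x" "x \<le> 1" "0 < x"
        using len_pos[OF wI] big_le(1)[of w "\<not> big w"] len_le_1[OF wI] by (auto simp: x_def y_def)
      have yd: "y \<le> \<delta>" "rmin * \<delta> \<le> y" using len_V[OF w] by (auto simp: y_def)
      have "grid_sum (\<nu> (big w \<noteq> wsw w)) q (y / x) \<le> C0 (big w \<noteq> wsw w) * (y / x) powr (- (\<tau> + \<epsilon>))"
        unfolding \<tau>_def using xy by (intro C0) auto
      also have "\<dots> \<le> C1 * (y / x) powr (- (\<tau> + \<epsilon>))" by (intro mult_right_mono C1) simp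
      \<comment> \<open>As s = r + \<epsilon>, this is the geometric factor of \<psi> at r, times x
        powr \<epsilon>, which is at most 1, times a power of y, which is comparable with
        \<delta>.\<close>
      also have "(y / x) powr (- (\<tau> + \<epsilon>)) = x powr \<epsilon> * (x powr \<tau> * y powr (r - \<tau>)) * y powr (- s)"
      proof -
        have "(y / x) powr (- e) = y powr (- e) * x powr e" for e
          using xy by (simp add: powr_divide powr_minus_divide)
        then have "(y / x) powr (- (\<tau> + \<epsilon>)) = y powr (- (\<tau> + \<epsilon>)) * x powr (\<tau> + \<epsilon>)" .
        also have "y powr (- (\<tau> + \<epsilon>)) = y powr (r - \<tau>) * y powr (- s)"
          by (simp add: r(3) flip: powr_add)
        finally show ?thesis by (simp add: powr_add mult_ac)
      qed
      also have "\<dots> \<le> 1 * (x powr \<tau> * y powr (r - \<tau>)) * (rmin powr (- \<bar>s\<bar>) * \<delta> powr (- s))"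
      proof (intro mult_mono mult_right_mono)
        show "x powr \<epsilon> \<le> 1" using xy r(2) by (simp add: powr_le1)
        have "(y / \<delta>) powr (- s) \<le> rmin powr (- \<bar>s\<bar>)"
          using yd d rmin_pos by (intro powr_bounds_of_bounds(2)) (auto simp: field_simps)
        then have "(y / \<delta>) powr (- s) * \<delta> powr (- s) \<le> rmin powr (- \<bar>s\<bar>) * \<delta> powr (- s)"
          by (intro mult_right_mono) auto
        also have "(y / \<delta>) powr (- s) * \<delta> powr (- s) = y powr (- s)"
          using d xy by (simp add: powr_divide)
        finally show "y powr (- s) \<le> rmin powr (- \<bar>s\<bar>) * \<delta> powr (- s)" .
      qed auto
      finally have "grid_sum (\<nu> (big w \<noteq> wsw w)) q (y / x)
          \<le> C1 * (1 * (x powr \<tau> * y powr (r - \<tau>)) * (rmin powr (- \<bar>s\<bar>) * \<delta> powr (- s)))"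
        using C1p by (simp add: mult_left_mono)
      then have "word_prob p w powr q * grid_sum (\<nu> (big w \<noteq> wsw w)) q (y / x)
          \<le> word_prob p w powr q * (C1 * (1 * (x powr \<tau> * y powr (r - \<tau>)) * (rmin powr (- \<bar>s\<bar>) * \<delta> powr (- s))))"
        by (intro mult_left_mono) auto
      also have "\<dots> = C1 * rmin powr (- \<bar>s\<bar>) * \<delta> powr (- s) * psi S p \<mu> r q w"
        unfolding psi_eq[OF wI] stretch_def x_def y_def \<tau>_def by (simp add: mult_ac)
      finally show ?thesis unfolding x_def y_def .
    qed
    have "grid_sum2 \<mu> q \<delta> \<le> M * (\<Sum>w\<in>V. word_prob p w powr q *
        grid_sum (\<nu> (big w \<noteq> wsw w)) q (len w (\<not> big w) / len w (big w)))"
      using grid_sum2_le[OF q] unfolding M_def mesh_ratio_const .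
    also have "\<dots> \<le> M * (\<Sum>w\<in>V. C1 * rmin powr (- \<bar>s\<bar>) * \<delta> powr (- s) * psi S p \<mu> r q w)"
      by (intro mult_left_mono sum_mono term_le M)
    also have "\<dots> = M * (C1 * rmin powr (- \<bar>s\<bar>) * \<delta> powr (- s) * (\<Sum>w\<in>V. psi S p \<mu> r q w))"
      by (simp add: sum_distrib_left)
    also have "\<dots> \<le> M * (C1 * rmin powr (- \<bar>s\<bar>) * \<delta> powr (- s) * B)"
      using C1p M B(2)[OF finite_V V_words] by (intro mult_left_mono) auto
    also have "\<dots> = (C - 1) * \<delta> powr (- s)" by (simp add: C_def)
    also have "\<dots> \<le> C * \<delta> powr (- s)" by (intro mult_right_mono) auto
    finally show "grid_sum2 \<mu> q \<delta> \<le> C * \<delta> powr (- s)" .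
  qed
qed

end

section \<open>Packings of level sets\<close>

lemma abs_coord_diff_le_dist: "\<bar>coord j x - coord j y\<bar> \<le> dist x (y :: real \<times> real)"
  using dist_fst_le[of x y] dist_snd_le[of x y] by (cases j) (simp_all add: dist_real_def)

lemma dist_le_sum_coord: "dist x (y :: real \<times> real) \<le> \<bar>coord True x - coord True y\<bar> + \<bar>coord False x - coord False y\<bar>"
  using sqrt_sum_squares_le_sum_abs[of "fst x - fst y" "snd x - snd y"]
  by (simp add: dist_prod_def dist_real_def)

lemma sum_geometric_tail_le:
  fixes \<rho> :: real
  assumes "0 < \<rho>" "\<rho> < 1" "finite K" "\<And>k. k \<in> K \<Longrightarrow> k0 \<le> k"
  shows "(\<Sum>k\<in>K. \<rho> ^ k) \<le> \<rho> ^ k0 / (1 - \<rho>)"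
proof -
  have "(\<Sum>k\<in>K. \<rho> ^ k) = \<rho> ^ k0 * (\<Sum>k\<in>K. \<rho> ^ (k - k0))"
    unfolding sum_distrib_left using assms(4) by (intro sum.cong refl) (simp flip: power_add)
  also have "(\<Sum>k\<in>K. \<rho> ^ (k - k0)) = (\<Sum>i\<in>(\<lambda>k. k - k0) ` K. \<rho> ^ i)"
  proof -
    have "inj_on (\<lambda>k. k - k0) K"
      by (rule inj_onI) (use assms(4) in \<open>metis le_add_diff_inverse\<close>)
    then show ?thesis by (simp add: sum.reindex)
  qed
  also have "\<dots> \<le> (\<Sum>i. \<rho> ^ i)"
    using assms by (intro sum_le_suminf summable_geometric) auto
  also have "\<dots> = 1 / (1 - \<rho>)" using assms by (intro suminf_geometric) simp
  finally show ?thesis using assms(1) by (simp add: mult_left_mono)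
qed

section \<open>Disjoint balls of comparable radii\<close>

context coordinate_ifs
begin

text \<open>At mesh \<delta> / 4 two centres in one square are at most \<delta> / 2 apart, less than
  the radii, so disjointness leaves one ball per square. A ball reaches only squares at index
  distance at most 5 from its centre's, and 11 * 11 = 121.\<close>

lemma sum_disjoint_balls_le:
  assumes \<delta>: "0 < \<delta>" and q: "0 \<le> q" and F: "finite F"
    and r: "\<And>x r. (x, r) \<in> F \<Longrightarrow> \<delta> / 2 < r \<and> r \<le> \<delta>"
    and disj: "disjoint_family_on (\<lambda>(x, r). cball x r) F"
  shows "(\<Sum>(x, r)\<in>F. prob (cball x r) powr q) \<le> 121 powr q * 121 * grid_sum2 \<mu> q (\<delta> / 4)"
proof -
  define a where "a = \<delta> / 4"
  have a: "0 < a" using \<delta> by (simp add: a_def)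
  define c where "c z = (\<lfloor>fst z / a\<rfloor>, \<lfloor>snd z / a\<rfloor>)" for z :: "real \<times> real"
  have c: "coord j (c z) = \<lfloor>coord j z / a\<rfloor>" for j z by (cases j) (auto simp: c_def)
  have c_cell: "z \<in> cell2 a (c z)" for z
    unfolding mem_cell2_iff c using mem_cell_floor[OF a] by blast
  define near where "near k l \<longleftrightarrow> (\<forall>j. \<bar>coord j k - coord j l\<bar> \<le> (5::int))" for k l
  have near_sym: "near k l = near l k" for k l by (auto simp: near_def abs_minus_commute)
  have near_eq: "{l. near k l} = {fst k - 5..fst k + 5} \<times> {snd k - 5..snd k + 5}" for k
    by (auto simp: near_def all_bool_eq)
  have near_card: "finite {l. near k l}" "card {l. near k l} = 121" for k
    unfolding near_eq by (auto simp: card_cartesian_product)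
  have inj: "inj_on (c \<circ> fst) F"
  proof (rule inj_onI, rule ccontr)
    fix b b' assume b: "b \<in> F" "b' \<in> F" "(c \<circ> fst) b = (c \<circ> fst) b'" "b \<noteq> b'"
    obtain x r x' r' where xr: "b = (x, r)" "b' = (x', r')" by (cases b, cases b')
    have "\<bar>coord j x - coord j x'\<bar> \<le> a" for j
      using c_cell[of x] c_cell[of x'] b(3) xr cell_diam[of "coord j x" a _ "coord j x'"] by (auto simp: mem_cell2_iff)
    from this[of True] this[of False] have "dist x x' \<le> \<delta> / 2"
      using dist_le_sum_coord[of x x'] by (simp add: a_def)
    then have "x' \<in> cball x r" using r[of x r] b xr by simp
    moreover have "x' \<in> cball x' r'" using r[of x' r'] \<delta> b xr by simp
    moreover have "cball x r \<inter> cball x' r' = {}"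
      using disj[unfolded disjoint_family_on_def, rule_format, OF b(1,2,4)] xr by simp
    ultimately show False by blast
  qed
  have "(\<Sum>b\<in>F. prob (cball (fst b) (snd b)) powr q)
      \<le> 121 powr q * 121 * (\<Sum>k\<in>grid a \<times> grid a. prob (cell2 a k) powr q)"
  proof (rule powr_sum_overlap[where R = "\<lambda>b k. near (c (fst b)) k"])
    fix b assume b: "b \<in> F"
    have "card {k\<in>grid a \<times> grid a. near (c (fst b)) k} \<le> card {k. near (c (fst b)) k}"
      using near_card by (intro card_mono) auto
    then show "real (card {k\<in>grid a \<times> grid a. near (c (fst b)) k}) \<le> 121" using near_card by simp
    obtain x r where xr: "b = (x, r)" by (cases b)
    have fin: "finite {k\<in>grid a \<times> grid a. near (c x) k}" using finite_grid[OF a] by simp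
    have "prob (cball x r) \<le> prob (\<Union>k\<in>{k\<in>grid a \<times> grid a. near (c x) k}. cell2 a k)"
    proof (rule finite_measure_mono_AE)
      show "AE z in \<mu>. z \<in> cball x r \<longrightarrow> z \<in> (\<Union>k\<in>{k\<in>grid a \<times> grid a. near (c x) k}. cell2 a k)"
        using AE_unit_square
      proof eventually_elim
        case (elim z)
        show ?case
        proof
          assume z: "z \<in> cball x r"
          have "near (c x) (c z)"
            unfolding near_def
          proof
            fix j
            have "\<bar>coord j x - coord j z\<bar> \<le> 4 * a"
              using abs_coord_diff_le_dist[of j x z] z r[of x r] b xr by (simp add: a_def)
            then have "\<bar>coord j x / a - coord j z / a\<bar> \<le> 4"
              using a by (simp add: abs_divide pos_divide_le_eq flip: diff_divide_distrib)
            then show "\<bar>coord j (c x) - coord j (c z)\<bar> \<le> 5" unfolding c by linarith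
          qed
          moreover have "c z \<in> grid a \<times> grid a"
            using elim floor_mem_grid[OF a] by (auto simp: c_def mem_Times_iff)
          ultimately have "c z \<in> {k\<in>grid a \<times> grid a. near (c x) k}" by simp
          then show "z \<in> (\<Union>k\<in>{k\<in>grid a \<times> grid a. near (c x) k}. cell2 a k)"
            using c_cell by (rule UN_I)
        qed
      qed
      have "(\<Union>k\<in>{k\<in>grid a \<times> grid a. near (c x) k}. cell2 a k) \<in> sets borel"
        by (rule sets.finite_UN[OF fin cell2_borel])
      then show "(\<Union>k\<in>{k\<in>grid a \<times> grid a. near (c x) k}. cell2 a k) \<in> events"
        using sets_mu by simp
    qed
    also have "\<dots> \<le> (\<Sum>k\<in>{k\<in>grid a \<times> grid a. near (c x) k}. prob (cell2 a k))"
      by (rule finite_measure_subadditive_finite[OF fin]) (simp add: sets_mu image_subset_iff)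
    finally show "prob (cball (fst b) (snd b)) \<le> (\<Sum>k\<in>{k\<in>grid a \<times> grid a. near (c (fst b)) k}. prob (cell2 a k))"
      using xr by simp
  next
    fix k
    have "card {b\<in>F. near (c (fst b)) k} \<le> card {l. near k l}"
    proof (rule card_inj_on_le)
      show "inj_on (c \<circ> fst) {b\<in>F. near (c (fst b)) k}" using inj by (rule inj_on_subset) auto
      show "(c \<circ> fst) ` {b\<in>F. near (c (fst b)) k} \<subseteq> {l. near k l}" 
        by (simp only: image_subset_iff mem_Collect_eq comp_apply near_sym[of k]) blast
    qed (rule near_card)
    then show "real (card {b\<in>F. near (c (fst b)) k}) \<le> 121" using near_card by simp
  qed (use F finite_grid[OF a] q in auto)
  then show ?thesis by (simp add: grid_sum2_def a_def case_prod_unfold)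
qed

text \<open>Dividing by ln r < 0 turns the upper bound for the quotient into a lower bound for the
  mass. Thresholds are dyadic so that they split the level set into countably many sets.\<close>

lemma level_set_lower_bound:
  assumes x: "x \<in> level_set \<mu> \<alpha>" and \<epsilon>: "0 < \<epsilon>"
  shows "\<exists>n. \<forall>r. 0 < r \<longrightarrow> r \<le> (1/2) ^ n \<longrightarrow> r powr (\<alpha> + \<epsilon>) \<le> prob (cball x r)"
proof -
  have "x \<in> measure_support \<mu>" and lim: "((\<lambda>r. ln (prob (cball x r)) / ln r) \<longlongrightarrow> \<alpha>) (at_right 0)"
    using x by (auto simp: level_set_def has_local_dim_def)
  then have pos: "0 < prob (cball x r)" if "0 < r" for r
  proof -
    have "0 < emeasure \<mu> (ball x r)"
      using \<open>x \<in> measure_support \<mu>\<close> that by (auto simp: measure_support_def)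
    then have "0 < prob (ball x r)" by (simp add: emeasure_eq_measure)
    also have "\<dots> \<le> prob (cball x r)" using sets_mu by (intro finite_measure_mono) auto
    finally show ?thesis .
  qed
  have "\<forall>\<^sub>F r in at_right 0. ln (prob (cball x r)) / ln r < \<alpha> + \<epsilon>"
    using order_tendstoD(2)[OF lim, of "\<alpha> + \<epsilon>"] \<epsilon> by simp
  then obtain b where b: "0 < b" "\<And>r. 0 < r \<Longrightarrow> r < b \<Longrightarrow> ln (prob (cball x r)) / ln r < \<alpha> + \<epsilon>"
    by (auto simp: eventually_at_right_field)
  obtain n where n: "(1/2) ^ n < min b 1"
    using real_arch_pow_inv[of "min b 1" "1/2"] b by auto
  have "r powr (\<alpha> + \<epsilon>) \<le> prob (cball x r)" if "0 < r" "r \<le> (1/2) ^ n" for r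
  proof -
    have r: "r < b" "r < 1" using that n by auto
    then have "ln r < 0" using that by simp
    then have "(\<alpha> + \<epsilon>) * ln r < ln (prob (cball x r))"
      using b(2)[OF that(1) r(1)] by (simp add: neg_divide_less_eq)
    then have "exp ((\<alpha> + \<epsilon>) * ln r) \<le> exp (ln (prob (cball x r)))" by simp
    then show ?thesis using pos[OF that(1)] that by (simp add: powr_def)
  qed
  then show ?thesis by blast
qed

end

section \<open>Packing measure of the level sets\<close>

context coordinate_rosc
begin

text \<open>The lower bound for the mass holds below a radius that depends on the point. Hence the
  countable splitting into sets E n with a common threshold, which the definition of
  \<open>packing_measure\<close> allows.\<close>

lemma level_set_packing_measure:
  assumes ne: "level_set \<mu> \<alpha> \<noteq> {}" and q: "0 \<le> q" and d: "\<alpha> * q + \<gamma> q < d"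
  shows "0 \<le> d" and "packing_measure d (level_set \<mu> \<alpha>) = 0"
proof -
  \<comment> \<open>Budget: \<epsilon> * q and s - \<gamma> q take at most \<eta> / 4 each, which
    leaves \<theta> at least \<eta> / 2. The divisor q + 1 stays positive at q = 0.\<close>
  define \<eta> where "\<eta> = d - (\<alpha> * q + \<gamma> q)"
  define \<epsilon> where "\<epsilon> = \<eta> / (4 * (q + 1))"
  define s where "s = \<gamma> q + \<eta> / 4"
  define e where "e = d - (\<alpha> + \<epsilon>) * q"
  define \<theta> where "\<theta> = e - s"
  have \<eta>: "0 < \<eta>" using d by (simp add: \<eta>_def)
  have \<epsilon>: "0 < \<epsilon>" "\<epsilon> * q \<le> \<eta> / 4"
    using \<eta> q by (simp_all add: \<epsilon>_def field_simps)
  have \<theta>: "0 < \<theta>"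
    using \<eta> \<epsilon>(2) \<eta>_def distrib_right[of \<alpha> \<epsilon> q] unfolding \<theta>_def e_def s_def by linarith
  have "\<gamma> q < s" using \<eta> by (simp add: s_def)
  then obtain C where C: "0 < C" "\<And>\<delta>. 0 < \<delta> \<Longrightarrow> \<delta> \<le> 1 \<Longrightarrow> grid_sum2 \<mu> q \<delta> \<le> C * \<delta> powr (- s)"
    using grid_sum2_growth[OF q] by blast
  \<comment> \<open>The factors come from replacing r by \<delta>, where e may have either sign,
    from the overlap bound for balls, and from the mesh \<delta> / 4.\<close>
  define C3 where "C3 = (1/2) powr (- \<bar>e\<bar>) * (121 powr q * 121 * (C * (1/4) powr (- s)))"
  have C3: "0 < C3" using C by (simp add: C3_def)
  define E where "E n = {x \<in> level_set \<mu> \<alpha>. \<forall>r. 0 < r \<longrightarrow> r \<le> (1/2) ^ n \<longrightarrow> r powr (\<alpha> + \<epsilon>) \<le> prob (cball x r)}" for n :: nat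
  have cover: "level_set \<mu> \<alpha> \<subseteq> (\<Union>n. E n)"
    unfolding E_def using level_set_lower_bound[OF _ \<epsilon>(1)] by blast
  have scale: "(\<Sum>(x, r)\<in>F. r powr d) \<le> C3 * \<delta> powr \<theta>"
    if \<delta>: "0 < \<delta>" "\<delta> \<le> 1" "\<delta> \<le> (1/2) ^ n" and F: "finite F"
      "\<And>x r. (x, r) \<in> F \<Longrightarrow> x \<in> E n \<and> \<delta> / 2 < r \<and> r \<le> \<delta>"
      "disjoint_family_on (\<lambda>(x, r). cball x r) F" for \<delta> n F
  proof -
    have "(\<Sum>(x, r)\<in>F. r powr d) \<le> (\<Sum>(x, r)\<in>F. (1/2) powr (- \<bar>e\<bar>) * \<delta> powr e * prob (cball x r) powr q)"
    proof (rule sum_mono, clarify)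
      fix x r assume xr: "(x, r) \<in> F"
      have r: "\<delta> / 2 < r" "r \<le> \<delta>" "0 < r" "x \<in> E n" using F(2)[OF xr] \<delta>(1) by auto
      have "r powr d = r powr e * (r powr (\<alpha> + \<epsilon>)) powr q"
        by (simp add: powr_powr e_def flip: powr_add)
      also have "\<dots> \<le> ((1/2) powr (- \<bar>e\<bar>) * \<delta> powr e) * prob (cball x r) powr q"
      proof (intro mult_mono powr_mono2)
        have "(r / \<delta>) powr e \<le> (1/2) powr (- \<bar>e\<bar>)"
          using r \<delta> by (intro powr_bounds_of_bounds(2)) (auto simp: field_simps)
        then have "(r / \<delta>) powr e * \<delta> powr e \<le> (1/2) powr (- \<bar>e\<bar>) * \<delta> powr e"
          by (intro mult_right_mono) auto
        then show "r powr e \<le> (1/2) powr (- \<bar>e\<bar>) * \<delta> powr e"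
          using r \<delta> by (simp add: powr_divide)
        show "r powr (\<alpha> + \<epsilon>) \<le> prob (cball x r)" using r \<delta>(3) by (simp add: E_def)
      qed (use q in auto)
      finally show "r powr d \<le> (1/2) powr (- \<bar>e\<bar>) * \<delta> powr e * prob (cball x r) powr q" .
    qed
    also have "\<dots> = (1/2) powr (- \<bar>e\<bar>) * \<delta> powr e * (\<Sum>(x, r)\<in>F. prob (cball x r) powr q)"
      by (simp add: sum_distrib_left case_prod_unfold)
    also have "\<dots> \<le> (1/2) powr (- \<bar>e\<bar>) * \<delta> powr e * (121 powr q * 121 * grid_sum2 \<mu> q (\<delta> / 4))"
      using F by (intro mult_left_mono sum_disjoint_balls_le \<delta> q) auto
    also have "\<dots> \<le> (1/2) powr (- \<bar>e\<bar>) * \<delta> powr e * (121 powr q * 121 * (C * (\<delta> / 4) powr (- s)))"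
      using C(2)[of "\<delta> / 4"] \<delta> by (intro mult_left_mono) auto
    also have "(\<delta> / 4) powr (- s) = (1/4) powr (- s) * \<delta> powr (- s)"
      using \<delta> powr_mult[of "1/4" \<delta> "- s"] by simp
    also have "(1/2) powr (- \<bar>e\<bar>) * \<delta> powr e * (121 powr q * 121 * (C * ((1/4) powr (- s) * \<delta> powr (- s))))
        = C3 * (\<delta> powr e * \<delta> powr (- s))"
      by (simp add: C3_def mult_ac)
    also have "\<delta> powr e * \<delta> powr (- s) = \<delta> powr \<theta>" by (simp add: \<theta>_def flip: powr_add)
    finally show ?thesis .
  qed
  \<comment> \<open>\<open>packing_dim\<close> ranges over nonnegative exponents only, while
    \<gamma> q may be negative. A single ball about a point of E n already satisfies the bound of
    \<open>scale\<close>, and for d < 0 this fails when \<delta> is small.\<close>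
  show t0: "0 \<le> d"
  proof (rule ccontr)
    assume "\<not> 0 \<le> d"
    then have tn: "d - \<theta> < 0" using \<theta> by simp
    obtain x n where x: "x \<in> E n" using ne cover by blast
    \<comment> \<open>Small enough that \<delta> powr (d - \<theta>), with negative exponent, is at
      least C3 + 1.\<close>
    define \<delta> where "\<delta> = min ((1/2) ^ n) ((C3 + 1) powr (1 / (d - \<theta>)))"
    have \<delta>: "0 < \<delta>" "\<delta> \<le> (1/2) ^ n" "\<delta> \<le> (C3 + 1) powr (1 / (d - \<theta>))"
      using C3 by (auto simp: \<delta>_def)
    have "\<delta> \<le> 1" using \<delta>(2) power_le_one[of "1/2::real" n] by linarith
    then have "\<delta> powr d \<le> C3 * \<delta> powr \<theta>"
      using scale[of \<delta> n "{(x, \<delta>)}"] \<delta> x by (simp add: disjoint_family_on_def)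
    then have "\<delta> powr d * \<delta> powr (- \<theta>) \<le> C3 * \<delta> powr \<theta> * \<delta> powr (- \<theta>)"
      by (intro mult_right_mono) auto
    then have "\<delta> powr (d - \<theta>) \<le> C3" using \<delta>(1) by (simp add: mult.assoc flip: powr_add)
    moreover have "((C3 + 1) powr (1 / (d - \<theta>))) powr (d - \<theta>) \<le> \<delta> powr (d - \<theta>)"
      using \<delta> tn by (intro powr_mono2') auto
    ultimately show False using tn C3 by (simp add: powr_powr)
  qed
  define \<rho> where "\<rho> = (1/2::real) powr \<theta>"
  have "\<theta> * ln (1/2) < 0" using \<theta> by (intro mult_pos_neg) (auto simp: ln_div)
  then have \<rho>: "0 < \<rho>" "\<rho> < 1" by (simp_all add: \<rho>_def powr_def)
  have half: "((1/2) ^ k) powr \<theta> = \<rho> ^ k" for k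
    by (simp add: \<rho>_def powr_powr mult.commute flip: powr_realpow)
  \<comment> \<open>2 powr d converts radii into diameters, and 1 / (1 - \<rho>) sums the geometric
    tail over the scales.\<close>
  define D0 where "D0 = 2 powr d * (C3 / (1 - \<rho>))"
  have D0: "0 \<le> D0" using C3 \<rho> by (simp add: D0_def)
  have pack: "packing_premeasure d (E n) \<le> ennreal (D0 * \<rho> ^ k0)" if k0: "n \<le> k0" for n k0
  proof -
    have "(\<Sum>\<^sub>\<infinity>(x, r)\<in>D. diam_pow d (cball x r)) \<le> ennreal (D0 * \<rho> ^ k0)"
      if D: "D \<in> packings ((1/2) ^ k0) (E n)" for D
    proof -
      have D': "\<And>x r. (x, r) \<in> D \<Longrightarrow> x \<in> E n \<and> 0 < r \<and> r \<le> (1/2) ^ k0"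
        "disjoint_family_on (\<lambda>(x, r). cball x r) D"
        using D by (auto simp: packings_def)
      have "(\<Sum>b\<in>F. case b of (x, r) \<Rightarrow> diam_pow d (cball x r)) \<le> ennreal (D0 * \<rho> ^ k0)"
        if F: "finite F" "F \<subseteq> D" for F
      proof -
        have rF: "0 < snd b" "snd b \<le> (1/2) ^ k0" if "b \<in> F" for b
          using D'(1)[of "fst b" "snd b"] F that by auto
        have "(\<Sum>b\<in>F. case b of (x, r) \<Rightarrow> diam_pow d (cball x r)) = (\<Sum>b\<in>F. ennreal (2 powr d * snd b powr d))"
        proof (intro sum.cong refl)
          fix b assume b: "b \<in> F"
          have "2 * snd b \<noteq> 0" "cball (fst b) (snd b) \<noteq> {}" using rF[OF b] by auto
          then show "(case b of (x, r) \<Rightarrow> diam_pow d (cball x r)) = ennreal (2 powr d * snd b powr d)"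
            using rF[OF b] by (auto simp: case_prod_unfold diam_pow_def powr_mult)
        qed
        also have "\<dots> = ennreal (2 powr d * (\<Sum>b\<in>F. snd b powr d))"
          by (simp add: sum_ennreal sum_distrib_left)
        also have "(\<Sum>b\<in>F. snd b powr d) \<le> C3 * (\<rho> ^ k0 / (1 - \<rho>))"
        proof -
          have "\<exists>k. k0 \<le> k \<and> (1/2) ^ k / 2 < snd b \<and> snd b \<le> (1/2) ^ k" if b: "b \<in> F" for b
          proof -
            have "snd b \<le> 1" using rF(2)[OF b] power_le_one[of "1/2::real" k0] by linarith
            then obtain k where k: "(1/2) ^ k / 2 < snd b" "snd b \<le> (1/2) ^ k"
              using ex_half_power_bracket rF(1)[OF b] by blast
            have "(1/2::real) ^ Suc k < (1/2) ^ k0" using k(1) rF(2)[OF b] by simp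
            then have "k0 < Suc k" by (subst (asm) power_strict_decreasing_iff) auto
            then show ?thesis using k by (intro exI[of _ k]) simp
          qed
          then obtain kf where kf: "\<And>b. b \<in> F \<Longrightarrow> k0 \<le> kf b" "\<And>b. b \<in> F \<Longrightarrow> (1/2) ^ kf b / 2 < snd b"
            "\<And>b. b \<in> F \<Longrightarrow> snd b \<le> (1/2) ^ kf b" by metis
          have "(\<Sum>b\<in>F. snd b powr d) = (\<Sum>k\<in>kf ` F. \<Sum>b\<in>{b\<in>F. kf b = k}. snd b powr d)"
            using F(1) by (rule sum.image_gen)
          also have "\<dots> \<le> (\<Sum>k\<in>kf ` F. C3 * \<rho> ^ k)"
          proof (rule sum_mono)
            fix k assume "k \<in> kf ` F"
            then have k: "k0 \<le> k" using kf(1) by auto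
            have "(\<Sum>(x, r)\<in>{b\<in>F. kf b = k}. r powr d) \<le> C3 * ((1/2) ^ k) powr \<theta>"
            proof (rule scale)
              show "(1/2::real) ^ k \<le> (1/2) ^ n" using k k0 by (intro power_decreasing) auto
              show "x \<in> E n \<and> (1/2) ^ k / 2 < r \<and> r \<le> (1/2) ^ k" if "(x, r) \<in> {b\<in>F. kf b = k}" for x r
                using that kf(2,3)[of "(x, r)"] D'(1)[of x r] F(2) by auto
              show "disjoint_family_on (\<lambda>(x, r). cball x r) {b\<in>F. kf b = k}"
                by (rule disjoint_family_on_mono[OF _ D'(2)]) (use F(2) in auto)
            qed (use F(1) in \<open>auto intro: power_le_one\<close>)
            then show "(\<Sum>b\<in>{b\<in>F. kf b = k}. snd b powr d) \<le> C3 * \<rho> ^ k"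
              by (simp add: half case_prod_unfold)
          qed
          also have "\<dots> = C3 * (\<Sum>k\<in>kf ` F. \<rho> ^ k)" by (simp add: sum_distrib_left)
          also have "\<dots> \<le> C3 * (\<rho> ^ k0 / (1 - \<rho>))"
            using C3 \<rho> F(1) kf(1) by (intro mult_left_mono sum_geometric_tail_le) auto
          finally show ?thesis .
        qed
        then have "ennreal (2 powr d * (\<Sum>b\<in>F. snd b powr d)) \<le> ennreal (2 powr d * (C3 * (\<rho> ^ k0 / (1 - \<rho>))))"
          by (intro ennreal_leI mult_left_mono) auto
        finally show ?thesis by (simp add: D0_def mult_ac)
      qed
      \<comment> \<open>An infinite sum in \<open>ennreal\<close> is the supremum of its finite
        partial sums.\<close>
      then show ?thesis
        by (subst nonneg_infsum_complete) (auto intro!: SUP_least)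
    qed
    then have "(SUP D \<in> packings ((1/2) ^ k0) (E n). \<Sum>\<^sub>\<infinity>(x, r)\<in>D. diam_pow d (cball x r)) \<le> ennreal (D0 * \<rho> ^ k0)"
      by (rule SUP_least)
    then show ?thesis unfolding packing_premeasure_def by (intro INF_lower2[of "(1/2) ^ k0"]) auto
  qed
  have zero: "packing_premeasure d (E n) = 0" for n
  proof -
    have "(\<lambda>k. D0 * \<rho> ^ k) \<longlonglongrightarrow> D0 * 0"
      using \<rho> by (intro tendsto_mult tendsto_const LIMSEQ_power_zero) auto
    then have "(\<lambda>k. ennreal (D0 * \<rho> ^ k)) \<longlonglongrightarrow> 0"
      using tendsto_ennrealI by fastforce
    then have "packing_premeasure d (E n) \<le> 0"
      by (rule LIMSEQ_le_const) (use pack in blast)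
    then show ?thesis by simp
  qed
  have "packing_measure d (level_set \<mu> \<alpha>) \<le> (\<Sum>n. packing_premeasure d (E n))"
    unfolding packing_measure_def using cover by (intro INF_lower) simp
  then show "packing_measure d (level_set \<mu> \<alpha>) = 0" by (simp add: zero)
qed

text \<open>Every real number above \<alpha> * q + \<gamma> q is an admissible exponent, and
  \<open>dense_ge\<close> passes to the infimum. An empty level set has dimension minus infinity by
  convention.\<close>

lemma packing_spectrum_le:
  assumes q: "0 \<le> q"
  shows "packing_spectrum \<mu> \<alpha> \<le> ereal (\<alpha> * q + \<gamma> q)"
proof (cases "level_set \<mu> \<alpha> = {}")
  case True
  then show ?thesis by (simp add: packing_spectrum_def packing_dim_def)
next
  case False
  have "packing_dim (level_set \<mu> \<alpha>) \<le> y" if "ereal (\<alpha> * q + \<gamma> q) < y" for y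
  proof (cases y)
    case (real d)
    then have "\<alpha> * q + \<gamma> q < d" using that by simp
    then show ?thesis unfolding packing_dim_def real
      using level_set_packing_measure[OF False q] False by (auto intro!: Inf_lower)
  qed (use that in auto)
  then show ?thesis unfolding packing_spectrum_def by (rule dense_ge)
qed

end

theorem corollary2p7:
  fixes I :: "'i set"
    and S :: "'i \<Rightarrow> real \<times> real \<Rightarrow> real \<times> real"
    and p :: "'i \<Rightarrow> real"
    and \<mu> :: "(real \<times> real) measure"
    and \<alpha> :: real
  assumes "box_like_measure I S p \<mu>"
    and "rect_open_set_condition I S"
    and "0 \<le> \<alpha>"
  shows "hausdorff_spectrum \<mu> \<alpha> \<le> packing_spectrum \<mu> \<alpha> \<and>
         packing_spectrum \<mu> \<alpha> \<le> legendre_transform (moment_scaling_gamma I S p \<mu>) \<alpha>"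
proof -
  have "\<forall>i\<in>I. \<exists>s a t. (\<forall>j z. coord j (S i z) = a j * coord (j \<noteq> s) z + t j) \<and> (\<forall>j. 0 < \<bar>a j\<bar> \<and> \<bar>a j\<bar> < 1)"
    using assms(1) box_like_map_coord unfolding box_like_measure_def box_like_ifs_def by blast
  then obtain sw A t where coords: "\<And>i j z. i \<in> I \<Longrightarrow> coord j (S i z) = A i j * coord (j \<noteq> sw i) z + t i j"
    "\<And>i j. i \<in> I \<Longrightarrow> 0 < \<bar>A i j\<bar> \<and> \<bar>A i j\<bar> < 1"
    by metis
  obtain a b c d where R: "a < b" "c < d" "\<forall>i\<in>I. S i ` ({a<..<b} \<times> {c<..<d}) \<subseteq> {a<..<b} \<times> {c<..<d}"
    "disjoint_family_on (\<lambda>i. S i ` ({a<..<b} \<times> {c<..<d})) I"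
    using assms(2) unfolding rect_open_set_condition_def Let_def by (elim exE conjE) (rule that)
  define lo hi where "lo j = (if j then a else c)" and "hi j = (if j then b else d)" for j
  interpret coordinate_rosc I S p \<mu> sw A t lo hi "{a<..<b} \<times> {c<..<d}"
  proof
    show "lo j < hi j" for j using R(1,2) by (simp add: lo_def hi_def)
    show "{a<..<b} \<times> {c<..<d} = {lo True<..<hi True} \<times> {lo False<..<hi False}"
      by (simp add: lo_def hi_def)
  qed (fact assms(1) coords R(4) bspec[OF R(3)])+
  have "packing_spectrum \<mu> \<alpha> \<le> legendre_transform (moment_scaling_gamma I S p \<mu>) \<alpha>"
    unfolding legendre_transform_def by (intro INF_greatest packing_spectrum_le) simp
  moreover have "hausdorff_spectrum \<mu> \<alpha> \<le> packing_spectrum \<mu> \<alpha>"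
    unfolding hausdorff_spectrum_def packing_spectrum_def by (rule hausdorff_dim_le_packing_dim)
  ultimately show ?thesis by blast
qed

end
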